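(* Suppose the Borel set $E\subset\mathbb{R}^d$ has Hausdorff dimension $\beta$. (a) If $d=2$ and $\beta>1/2$, then $$\dim\{x\in\mathbb{R}^2:\ \dim D_x(E)<(2\beta-1)/3\}=0 .$$ (b) If $d>2$ and $\beta>d-2$, then $$\dim\{x\in\mathbb{R}^d:\ \dim D_x(E)<(\beta+2-d)/2\}=0 .$$
   Context: $\dim$ denotes Hausdorff dimension (with $\dim\emptyset=0$). For $E\subset\mathbb{R}^d$ and $x\in\mathbb{R}^d$, the pinned distance set of $E$ at $x$ is $D_x(E)=\{|x-y|: y\in E\}\subset[0,\infty)$. *)

theory Defs
  imports "HOL-Analysis.Analysis"
begin

text \<open>
  The weight of a bounded covering set is \<open>diam(U)^s\<close>, with the usual conventions that
  the empty set has weight 0 for every \<open>s \<ge> 0\<close> and that \<open>0^0 = 1\<close> for nonempty sets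
  (so that the 0-dimensional measure counts points). These cases are spelled out because
  \<open>0 powr 0 = 0\<close> in HOL.
\<close>

definition diameter_weight :: "real \<Rightarrow> 'a::metric_space set \<Rightarrow> ennreal" where
  "diameter_weight s U =
     (if U = {} then 0 else if s = 0 then 1 else ennreal (diameter U powr s))"

text \<open>
  Covers are sequences of arbitrary sets; finite covers are included by padding with the empty
  set. Boundedness is required explicitly because \<^term>\<open>diameter\<close> is real-valued and hence
  meaningless on unbounded sets.
\<close>

definition hausdorff_premeasure :: "real \<Rightarrow> real \<Rightarrow> 'a::metric_space set \<Rightarrow> ennreal" where
  "hausdorff_premeasure s \<delta> A =
     (INF U \<in> {U :: nat \<Rightarrow> 'a set.
                 A \<subseteq> (\<Union>i. U i) \<and> (\<forall>i. bounded (U i) \<and> diameter (U i) \<le> \<delta>)}.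
        \<Sum>i. diameter_weight s (U i))"

text \<open>
  The premeasure is antimonotone in \<open>\<delta>\<close>, so the limit as \<open>\<delta>\<close> tends to 0 is a supremum.
\<close>

definition hausdorff_measure :: "real \<Rightarrow> 'a::metric_space set \<Rightarrow> ennreal" where
  "hausdorff_measure s A = (SUP \<delta> \<in> {0<..}. hausdorff_premeasure s \<delta> A)"

text \<open>
  The infimum is taken in the extended reals, so it is \<open>\<infinity>\<close> if no exponent is admissible. The
  dimension of the empty set is 0.
\<close>

definition hausdorff_dim :: "'a::metric_space set \<Rightarrow> ereal" where
  "hausdorff_dim A = (INF s \<in> {s. 0 \<le> s \<and> hausdorff_measure s A = 0}. ereal s)"

definition pinned_distance_set :: "'a::metric_space \<Rightarrow> 'a set \<Rightarrow> real set" where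
  "pinned_distance_set x E = {dist x y | y. y \<in> E}"

end

theory Submission
  imports Defs
begin

text \<open>
  Write \<open>d\<close> for the dimension and \<open>\<delta> = 2^(-k)\<close> for a dyadic scale. Fix \<open>\<tau>\<close> below the claimed threshold
  and suppose that the exceptional set \<open>F\<close> of those \<open>x\<close> for which \<open>D_x(E)\<close> is null in some dimension at
  most \<open>\<tau>\<close> had positive dimension.

  \<^bold>\<open>One scale, one pair of pins.\<close> For \<open>x\<close> in \<open>F\<close> the set \<open>D_x(E)\<close> has a cover which uses, at each scale
  \<open>\<delta>\<close>, at most \<open>\<delta>^(-\<tau>)\<close> intervals of length comparable to \<open>\<delta>\<close>, and only small scales. Pulling
  this cover back under \<open>y \<mapsto> |x - y|\<close>, the set \<open>E\<close> is covered by unions \<open>A_x(k)\<close> of at most \<open>\<delta>^(-\<tau>)\<close>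
  annuli of width \<open>\<delta>\<close> around \<open>x\<close>. For a Frostman mass on \<open>E\<close> of exponent \<open>s < \<beta>\<close>, some \<open>A_x(k)\<close> carries a
  proportion \<open>\<delta>^\<epsilon>\<close> of the mass. The scale depends on \<open>x\<close>, but by subadditivity of content
  one \<open>k\<close> serves a subset of \<open>F\<close> of content at least \<open>\<delta>^\<epsilon>\<close> up to a constant. As \<open>F\<close> has positive
  dimension, that subset contains about \<open>\<delta>^(-\<epsilon>)\<close> points at mutual distance \<open>\<delta>^(\<kappa>')\<close> or more, where \<open>\<kappa>'\<close> is a
  multiple of \<open>\<epsilon>\<close>. By pigeonholing (\<open>overlapping_pair_exists\<close>) two of
  them, \<open>x\<close> and \<open>x'\<close>, satisfy: the intersection of \<open>A_x(k)\<close> and \<open>A_x'(k)\<close> has mass at least \<open>\<delta>^(2\<epsilon>)\<close>, up to a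
  constant. All of these losses are arbitrarily small powers of \<open>\<delta>\<close>.

  \<^bold>\<open>The geometry of two pins.\<close> Split this intersection according to the distance from the line
  through \<open>x\<close> and \<open>x'\<close>. At distance at least \<open>\<delta>^\<kappa>\<close> from the line, an annulus around \<open>x\<close> and one around \<open>x'\<close>
  meet in a neighbourhood of a \<open>(d-2)\<close>-sphere, which consists of about \<open>\<delta>^(2-d-\<kappa>)\<close> cubes of side \<open>\<delta>\<close>; over
  all pairs of annuli the mass is at most about \<open>\<delta>^(s+2-d-\<kappa>-2\<tau>)\<close>. The part nearer to the line is a tube that
  can be covered by \<open>\<delta>^(-\<kappa>)\<close> cubes of side \<open>\<delta>^\<kappa>\<close>, so it has mass at most about \<open>\<delta>^(\<kappa>(s-1))\<close>; alternatively each
  annulus around \<open>x\<close> meets it in boundedly many such cubes, which gives \<open>\<delta>^(\<kappa>s-\<tau>)\<close>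
  (\<open>mass_of_annuli_intersection_le\<close>). The lower bound is contradicted as soon as
  \<open>2\<tau> + d - 2 + \<kappa> < s\<close> and either \<open>s > 1\<close> or \<open>\<tau> < \<kappa>s\<close> (\<open>exceptional_pins_content_zero\<close>).

  \<^bold>\<open>The exponents.\<close> If \<open>\<beta> > 1\<close>, a small \<open>\<kappa>\<close> works for every \<open>\<tau> < (\<beta>+2-d)/2\<close>. For \<open>d = 2\<close> this number is \<open>\<beta>/2\<close>, which is at
  least \<open>(2\<beta>-1)/3\<close> because \<open>\<beta> \<le> 2\<close>. For \<open>d > 2\<close> the hypothesis \<open>\<beta> > d - 2\<close> forces \<open>\<beta> > 1\<close>. If \<open>d = 2\<close> and \<open>\<beta> \<le> 1\<close>, some \<open>\<kappa>\<close> is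
  admissible (for \<open>s\<close> near \<open>\<beta>\<close>) when \<open>\<tau> < \<beta>^2/(2\<beta>+1)\<close>, and \<open>(2\<beta>-1)/3\<close> does not exceed this bound.

  \<^bold>\<open>The Frostman mass.\<close> Only a finitely additive mass on dyadic cubes is needed, and it can be
  distributed down the dyadic tree in proportion to content. Since finitely many scales
  have to suffice to cover the support of the mass, this support must be compact. So a Borel set of positive
  content must contain a compact set of positive content. This is Choquet's capacitability argument: dyadic
  content is continuous along increasing unions of arbitrary sets (\<open>dyadic_content_incseq_le\<close>), and a Borel set is the projection
  of a closed subset of \<open>(nat \<Rightarrow> nat) \<times> R^d\<close> (\<open>borel_imp_closed_projection\<close>).
\<close>

section \<open>Dyadic cubes and dyadic content\<close>

definition cell :: "nat \<Rightarrow> real^'n \<Rightarrow> 'n \<Rightarrow> int" where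
  "cell k y = (\<lambda>i. \<lfloor>2 ^ k * y $ i\<rfloor>)"

definition cube :: "nat \<times> ('n \<Rightarrow> int) \<Rightarrow> (real^'n) set" where
  "cube Q = {y. cell (fst Q) y = snd Q}"

text \<open>
The cost is a measure on the countable set of indices of cubes, so that additivity and continuity
from below are available for families of cubes.
\<close>

definition cube_cost :: "real \<Rightarrow> (nat \<times> ('n \<Rightarrow> int)) set \<Rightarrow> ennreal" where
  "cube_cost s = emeasure (point_measure UNIV (\<lambda>Q. ennreal (2 powr (- s * real (fst Q)))))"

text \<open>
The net version of Hausdorff content: only dyadic cubes of side at most 1 compete. Any two of these are
nested or disjoint, and this is what makes the content continuous along increasing unions. Its null sets
are Hausdorff null sets when \<open>s > 0\<close>.
\<close>

definition dyadic_content :: "real \<Rightarrow> (real^'n) set \<Rightarrow> ennreal" where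
  "dyadic_content s A = (INF \<X>\<in>{\<X>. A \<subseteq> (\<Union>Q\<in>\<X>. cube Q)}. cube_cost s \<X>)"

text \<open>
The index at level \<open>j\<close> of the cube that contains the cube of level \<open>k \<ge> j\<close> with index \<open>q\<close>.
\<close>

definition ancestor :: "nat \<Rightarrow> nat \<Rightarrow> ('n \<Rightarrow> int) \<Rightarrow> 'n \<Rightarrow> int" where
  "ancestor j k q = (\<lambda>i. q i div 2 ^ (k - j))"

lemma ancestor_cell:
  assumes "j \<le> k" shows "ancestor j k (cell k y) = cell j y"
proof
  fix i
  have "(2::real) ^ k = 2 ^ j * 2 ^ (k - j)" using assms(1) by (simp flip: power_add)
  then have "\<lfloor>2 ^ j * y $ i\<rfloor> = \<lfloor>(2 ^ k * y $ i) / real_of_int (2 ^ (k - j))\<rfloor>"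
    by simp
  then show "ancestor j k (cell k y) i = cell j y i"
    unfolding cell_def ancestor_def using floor_divide_real_eq_div[of "2 ^ (k-j)" "2 ^ k * y $ i"] by simp
qed

lemma cell_mono:
  "j \<le> k \<Longrightarrow> cell k x = cell k y \<Longrightarrow> cell j x = cell j y"
  using ancestor_cell[of j k x] ancestor_cell[of j k y] by simp

lemma same_cell_coordinate:
  fixes x y :: "real^'n"
  assumes "cell k x l = cell k y l" shows "\<bar>(x - y) $ l\<bar> \<le> (1/2) ^ k"
proof -
  have "\<bar>2 ^ k * x $ l - 2 ^ k * y $ l\<bar> \<le> 1" using assms unfolding cell_def by linarith
  then have "2 ^ k * \<bar>x $ l - y $ l\<bar> \<le> 1" by (metis abs_mult abs_numeral power_abs right_diff_distrib)
  then show ?thesis by (simp add: power_one_over field_simps)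
qed

lemma cubes_nested:
  assumes "fst P \<le> fst Q" "y \<in> cube P" "y \<in> cube Q"
  shows "cube Q \<subseteq> cube P"
proof
  fix x assume "x \<in> cube Q"
  then have "cell (fst Q) x = cell (fst Q) y" using assms(3) unfolding cube_def by simp
  from cell_mono[OF assms(1) this] show "x \<in> cube P" using assms(2) unfolding cube_def by simp
qed

lemma cube_cost_mono: "\<X> \<subseteq> \<Y> \<Longrightarrow> cube_cost s \<X> \<le> cube_cost s \<Y>"
  unfolding cube_cost_def by (rule emeasure_mono) auto

lemma cube_cost_Un_Int: "cube_cost s (\<X> \<union> \<Y>) + cube_cost s (\<X> \<inter> \<Y>) = cube_cost s \<X> + cube_cost s \<Y>"
proof -
  have "cube_cost s (\<X> \<union> \<Y>) = cube_cost s \<X> + cube_cost s (\<Y> - \<X>)"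
  proof -
    have "\<X> \<union> (\<Y> - \<X>) = \<X> \<union> \<Y>" by blast
    then show ?thesis unfolding cube_cost_def by (subst plus_emeasure) auto
  qed
  moreover have "cube_cost s \<Y> = cube_cost s (\<Y> - \<X>) + cube_cost s (\<X> \<inter> \<Y>)"
  proof -
    have "(\<Y> - \<X>) \<union> (\<X> \<inter> \<Y>) = \<Y>" by blast
    then show ?thesis unfolding cube_cost_def by (subst plus_emeasure) auto
  qed
  ultimately show ?thesis by (simp only: add.assoc)
qed

lemma cube_cost_UN: "cube_cost s (\<Union>n::nat. \<X> n) \<le> (\<Sum>n. cube_cost s (\<X> n))"
  unfolding cube_cost_def by (rule emeasure_subadditive_countably) auto

lemma cube_cost_finite: "finite \<X> \<Longrightarrow> cube_cost s \<X> = (\<Sum>Q\<in>\<X>. ennreal (2 powr (- s * real (fst Q))))"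
  unfolding cube_cost_def by (rule emeasure_point_measure_finite2) auto

lemma dyadic_content_le_cost: "A \<subseteq> (\<Union>Q\<in>\<X>. cube Q) \<Longrightarrow> dyadic_content s A \<le> cube_cost s \<X>"
  unfolding dyadic_content_def by (rule INF_lower) simp

lemma dyadic_content_mono: "A \<subseteq> B \<Longrightarrow> dyadic_content s A \<le> dyadic_content s B"
  unfolding dyadic_content_def by (rule INF_superset_mono) auto

lemma dyadic_content_empty [simp]: "dyadic_content s {} = 0"
  using dyadic_content_le_cost[of "{}" "{}" s] by (simp add: cube_cost_def)

lemma near_optimal_cover:
  assumes "dyadic_content s A < top" "0 < (e::real)"
  obtains \<X> where "A \<subseteq> (\<Union>Q\<in>\<X>. cube Q)" "cube_cost s \<X> \<le> dyadic_content s A + ennreal e"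
proof -
  have "dyadic_content s A < dyadic_content s A + ennreal e"
    using assms by (cases "dyadic_content s A") (auto simp: ennreal_less_iff simp flip: ennreal_plus)
  then obtain \<X> where "A \<subseteq> (\<Union>Q\<in>\<X>. cube Q)" "cube_cost s \<X> < dyadic_content s A + ennreal e"
    unfolding dyadic_content_def INF_less_iff by auto
  then show thesis using that by (meson less_imp_le)
qed

lemma suminf_geometric_ennreal: "0 \<le> e \<Longrightarrow> (\<Sum>n. ennreal (e * (1/2) ^ Suc n)) = ennreal e"
  using sums_mult[OF power_half_series, of e] by (intro suminf_ennreal_eq) auto

lemma dyadic_content_UN:
  "dyadic_content s (\<Union>n::nat. A n) \<le> (\<Sum>n. dyadic_content s (A n))"
proof (cases "\<forall>n. dyadic_content s (A n) < top")
  case True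
  show ?thesis
  proof (rule ennreal_le_epsilon)
    fix e :: real assume e: "0 < e"
    have "\<exists>\<X>. A n \<subseteq> (\<Union>Q\<in>\<X>. cube Q) \<and> cube_cost s \<X> \<le> dyadic_content s (A n) + ennreal (e * (1/2) ^ Suc n)" for n
      using near_optimal_cover[of s "A n" "e * (1/2) ^ Suc n"] True e by (metis mult_pos_pos zero_less_power half_gt_zero_iff zero_less_one)
    then obtain \<X> where X: "\<And>n. A n \<subseteq> (\<Union>Q\<in>\<X> n. cube Q)"
      "\<And>n. cube_cost s (\<X> n) \<le> dyadic_content s (A n) + ennreal (e * (1/2) ^ Suc n)" by metis
    have "dyadic_content s (\<Union>n. A n) \<le> cube_cost s (\<Union>n. \<X> n)"
      using X(1) by (intro dyadic_content_le_cost) (auto, blast)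
    also have "\<dots> \<le> (\<Sum>n. cube_cost s (\<X> n))" by (rule cube_cost_UN)
    also have "\<dots> \<le> (\<Sum>n. dyadic_content s (A n) + ennreal (e * (1/2) ^ Suc n))"
      by (intro suminf_le X) auto
    also have "\<dots> = (\<Sum>n. dyadic_content s (A n)) + (\<Sum>n. ennreal (e * (1/2) ^ Suc n))"
      by (rule suminf_add[symmetric]) auto
    also have "(\<Sum>n. ennreal (e * (1/2) ^ Suc n)) = ennreal e" using e by (intro suminf_geometric_ennreal) simp
    finally show "dyadic_content s (\<Union>n. A n) \<le> (\<Sum>n. dyadic_content s (A n)) + ennreal e" .
  qed
next
  case False
  then obtain n where "dyadic_content s (A n) = top" using top.not_eq_extremum by blast
  moreover have "dyadic_content s (A n) \<le> (\<Sum>n. dyadic_content s (A n))"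
    using sum_le_suminf[of "\<lambda>n. dyadic_content s (A n)" "{n}"] by auto
  ultimately show ?thesis by (simp add: top_unique)
qed

lemma dyadic_content_Union_finite:
  assumes "finite I" shows "dyadic_content s (\<Union>i\<in>I. A i) \<le> (\<Sum>i\<in>I. dyadic_content s (A i))"
  using assms
proof (induction I)
  case (insert i I)
  have "dyadic_content s (A i \<union> B) \<le> dyadic_content s (A i) + dyadic_content s B" for B
  proof -
    let ?C = "\<lambda>n::nat. if n = 0 then A i else if n = 1 then B else {}"
    have "dyadic_content s (A i \<union> B) \<le> dyadic_content s (\<Union>n. ?C n)"
      by (intro dyadic_content_mono) (auto split: if_splits intro: exI[of _ 0] exI[of _ 1])
    also have "\<dots> \<le> (\<Sum>n. dyadic_content s (?C n))" by (rule dyadic_content_UN)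
    also have "\<dots> = (\<Sum>n\<in>{0,1}. dyadic_content s (?C n))" by (rule suminf_finite) auto
    finally show ?thesis by simp
  qed
  then have "dyadic_content s (\<Union>i\<in>insert i I. A i) \<le> dyadic_content s (A i) + dyadic_content s (\<Union>i\<in>I. A i)" by simp
  also have "\<dots> \<le> (\<Sum>i\<in>insert i I. dyadic_content s (A i))" using insert by (simp add: add_left_mono)
  finally show ?case .
qed simp

text \<open>
Levels are natural numbers, so every cube of the family lies in a maximal one; discarding the other cubes keeps the union.
\<close>

definition maximal_cubes :: "(nat \<times> ('n::finite \<Rightarrow> int)) set \<Rightarrow> (nat \<times> ('n \<Rightarrow> int)) set" where
  "maximal_cubes \<X> = {Q \<in> \<X>. \<not> (\<exists>P\<in>\<X>. fst P < fst Q \<and> cube Q \<subseteq> cube P)}"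

lemma Union_maximal_cubes: "(\<Union>Q\<in>maximal_cubes \<X>. cube Q) = (\<Union>Q\<in>\<X>. cube Q)"
proof
  show "(\<Union>Q\<in>\<X>. cube Q) \<subseteq> (\<Union>Q\<in>maximal_cubes \<X>. cube Q)"
  proof
    fix y assume "y \<in> (\<Union>Q\<in>\<X>. cube Q)"
    then obtain Q0 where "Q0 \<in> \<X> \<and> y \<in> cube Q0" by auto
    from ex_has_least_nat[of "\<lambda>Q. Q \<in> \<X> \<and> y \<in> cube Q", OF this, of fst]
    obtain Q where Q: "Q \<in> \<X>" "y \<in> cube Q" "\<And>P. P \<in> \<X> \<Longrightarrow> y \<in> cube P \<Longrightarrow> fst Q \<le> fst P" by blast
    then have "Q \<in> maximal_cubes \<X>" unfolding maximal_cubes_def using not_less by blast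
    then show "y \<in> (\<Union>Q\<in>maximal_cubes \<X>. cube Q)" using Q by auto
  qed
qed (auto simp: maximal_cubes_def)

text \<open>
Strong subadditivity of the content, stated for covers. A point of \<open>A\<close> lies in a cube of each family, and these two cubes are nested.
The smaller one is either not maximal in the union, or it equals the other and lies in both families. Hence the
cubes which are left over after the maximal ones are paid for still cover \<open>A\<close>.
\<close>

lemma cost_maximal_cubes_Un:
  assumes "A \<subseteq> (\<Union>Q\<in>\<X>. cube Q)" "A \<subseteq> (\<Union>Q\<in>\<Y>. cube Q)"
  shows "cube_cost s (maximal_cubes (\<X> \<union> \<Y>)) + dyadic_content s A \<le> cube_cost s \<X> + cube_cost s \<Y>"
proof -
  let ?Z = "maximal_cubes (\<X> \<union> \<Y>)"
  have Z: "?Z \<subseteq> \<X> \<union> \<Y>" by (auto simp: maximal_cubes_def)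
  have cover: "A \<subseteq> (\<Union>Q\<in>((\<X> \<union> \<Y>) - ?Z) \<union> (\<X> \<inter> \<Y>). cube Q)"
  proof
    fix y assume "y \<in> A"
    then obtain P Q where PQ: "P \<in> \<X>" "Q \<in> \<Y>" "y \<in> cube P" "y \<in> cube Q" using assms by blast
    consider "fst P < fst Q" | "fst Q < fst P" | "fst P = fst Q" by linarith
    then show "y \<in> (\<Union>Q\<in>((\<X> \<union> \<Y>) - ?Z) \<union> (\<X> \<inter> \<Y>). cube Q)"
    proof cases
      case 1
      then have "Q \<notin> ?Z" using cubes_nested[of P Q y] PQ by (auto simp: maximal_cubes_def)
      then show ?thesis using PQ by blast
    next
      case 2
      then have "P \<notin> ?Z" using cubes_nested[of Q P y] PQ by (auto simp: maximal_cubes_def)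
      then show ?thesis using PQ by blast
    next
      case 3
      then have "P = Q" using PQ by (auto simp: cube_def prod_eq_iff)
      then show ?thesis using PQ by blast
    qed
  qed
  have "dyadic_content s A \<le> cube_cost s (((\<X> \<union> \<Y>) - ?Z) \<union> (\<X> \<inter> \<Y>))" by (rule dyadic_content_le_cost[OF cover])
  also have "\<dots> \<le> cube_cost s ((\<X> \<union> \<Y>) - ?Z) + cube_cost s (\<X> \<inter> \<Y>)"
    using cube_cost_Un_Int[of s "(\<X> \<union> \<Y>) - ?Z" "\<X> \<inter> \<Y>"] by (metis le_iff_add)
  finally have "cube_cost s ?Z + dyadic_content s A
      \<le> (cube_cost s ?Z + cube_cost s ((\<X> \<union> \<Y>) - ?Z)) + cube_cost s (\<X> \<inter> \<Y>)"
    by (simp add: add.assoc add_left_mono)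
  also have "cube_cost s ?Z + cube_cost s ((\<X> \<union> \<Y>) - ?Z) = cube_cost s (\<X> \<union> \<Y>)"
  proof -
    have "?Z \<union> ((\<X> \<union> \<Y>) - ?Z) = \<X> \<union> \<Y>" "?Z \<inter> ((\<X> \<union> \<Y>) - ?Z) = {}" using Z by auto
    then show ?thesis using cube_cost_Un_Int[of s ?Z "(\<X> \<union> \<Y>) - ?Z"]
      by (simp add: cube_cost_def)
  qed
  finally show ?thesis by (simp add: cube_cost_Un_Int)
qed

lemma ennreal_add_right_cancel_le_finite: "x + a \<le> y + a \<Longrightarrow> a < top \<Longrightarrow> x \<le> (y::ennreal)"
  using ennreal_add_left_cancel_le[of a x y] by (metis add.commute infinity_ennreal_def less_irrefl)

text \<open>
Take nearly optimal covers of the sets \<open>A n\<close>, with summable errors, and keep the maximal cubes of all of them together.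
By strong subadditivity, each further cover raises the cost by no more than the growth of the content plus
its own error, because the cubes that become redundant pay for the content of the preceding set. So all
partial costs, and with them the total cost, stay below the bound plus the sum of the errors.
The sets \<open>A n\<close> are arbitrary, and so the statement applies to the projections of closed sets used below.
\<close>

lemma dyadic_content_incseq_le:
  assumes inc: "incseq A" and le: "\<And>n. dyadic_content s (A n) \<le> c"
  shows "dyadic_content s (\<Union>n. A n) \<le> c"
proof (cases "c = top")
  case False
  then have fin: "dyadic_content s (A n) < top" for n
    using le[of n] le_less_trans[of _ c top] top.not_eq_extremum[of c] by blast
  show ?thesis
  proof (rule ennreal_le_epsilon)
    fix e :: real assume e: "0 < e"
    have "\<exists>\<X>. A n \<subseteq> (\<Union>Q\<in>\<X>. cube Q) \<and> cube_cost s \<X> \<le> dyadic_content s (A n) + ennreal (e * (1/2) ^ Suc n)" for n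
      using near_optimal_cover[of s "A n" "e * (1/2) ^ Suc n"] fin e by (metis mult_pos_pos zero_less_power half_gt_zero_iff zero_less_one)
    then obtain V where V: "\<And>n. A n \<subseteq> (\<Union>Q\<in>V n. cube Q)"
      "\<And>n. cube_cost s (V n) \<le> dyadic_content s (A n) + ennreal (e * (1/2) ^ Suc n)" by metis
    \<comment> \<open>Adding the cover \<open>V (Suc N)\<close> to the maximal cubes of \<open>U N\<close> leaves redundant cubes that cover \<open>A N\<close>;
      they pay for the term \<open>content (A N)\<close> that is cancelled in the induction step.\<close>
    define U where "U N = (\<Union>n\<le>N. V n)" for N
    have step: "cube_cost s (maximal_cubes (U N)) \<le> dyadic_content s (A N) + (\<Sum>n\<le>N. ennreal (e * (1/2) ^ Suc n))" for N
    proof (induction N)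
      case 0
      have "cube_cost s (maximal_cubes (U 0)) \<le> cube_cost s (V 0)"
        by (rule cube_cost_mono) (auto simp: maximal_cubes_def U_def)
      also note V(2)[of 0]
      finally show ?case by simp
    next
      case (Suc N)
      let ?r = "\<lambda>n. ennreal (e * (1/2) ^ Suc n)"
      have "maximal_cubes (U (Suc N)) \<subseteq> maximal_cubes (maximal_cubes (U N) \<union> V (Suc N))"
        unfolding maximal_cubes_def U_def by (auto simp: atMost_Suc)
      then have "cube_cost s (maximal_cubes (U (Suc N))) + dyadic_content s (A N)
         \<le> cube_cost s (maximal_cubes (maximal_cubes (U N) \<union> V (Suc N))) + dyadic_content s (A N)"
        by (intro add_right_mono cube_cost_mono)
      also have "\<dots> \<le> cube_cost s (maximal_cubes (U N)) + cube_cost s (V (Suc N))"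
      proof (rule cost_maximal_cubes_Un)
        show "A N \<subseteq> (\<Union>Q\<in>maximal_cubes (U N). cube Q)"
          unfolding Union_maximal_cubes U_def using V(1)[of N] by auto
        show "A N \<subseteq> (\<Union>Q\<in>V (Suc N). cube Q)"
          using incseq_SucD[OF inc, of N] V(1)[of "Suc N"] by blast
      qed
      also have "\<dots> \<le> (dyadic_content s (A N) + (\<Sum>n\<le>N. ?r n)) + (dyadic_content s (A (Suc N)) + ?r (Suc N))"
        by (rule add_mono[OF Suc.IH V(2)])
      also have "\<dots> = (dyadic_content s (A (Suc N)) + (\<Sum>n\<le>Suc N. ?r n)) + dyadic_content s (A N)"
        by (simp add: ac_simps)
      finally show ?case
        using fin[of N] by (metis ennreal_add_right_cancel_le_finite)
    qed
    let ?W = "maximal_cubes (\<Union>N. U N)"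
    have "dyadic_content s (\<Union>n. A n) \<le> cube_cost s ?W"
    proof (rule dyadic_content_le_cost)
      show "(\<Union>n. A n) \<subseteq> (\<Union>Q\<in>?W. cube Q)"
        unfolding Union_maximal_cubes U_def using V(1) by (auto, blast)
    qed
    \<comment> \<open>A cube that is maximal in the union of all covers is maximal in every partial union to which it belongs.\<close>
    also have "?W = (\<Union>N. ?W \<inter> U N)" by (auto simp: maximal_cubes_def)
    also have "cube_cost s \<dots> = (SUP N. cube_cost s (?W \<inter> U N))"
      unfolding cube_cost_def
    proof (rule SUP_emeasure_incseq[symmetric])
      have "U M \<subseteq> U N" if "M \<le> N" for M N using that by (auto simp: U_def intro: order_trans)
      then show "incseq (\<lambda>N. ?W \<inter> U N)" unfolding incseq_def by blast
    qed auto
    also have "\<dots> \<le> c + ennreal e"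
    proof (rule SUP_least)
      fix N
      have "cube_cost s (?W \<inter> U N) \<le> cube_cost s (maximal_cubes (U N))"
        by (rule cube_cost_mono) (auto simp: maximal_cubes_def)
      also have "\<dots> \<le> dyadic_content s (A N) + (\<Sum>n\<le>N. ennreal (e * (1/2) ^ Suc n))" by (rule step)
      also have "\<dots> \<le> c + ennreal e"
      proof (rule add_mono[OF le])
        have "(\<Sum>n\<le>N. ennreal (e * (1/2) ^ Suc n)) \<le> (\<Sum>n. ennreal (e * (1/2) ^ Suc n))"
          by (rule sum_le_suminf) simp_all
        then show "(\<Sum>n\<le>N. ennreal (e * (1/2) ^ Suc n)) \<le> ennreal e"
          using suminf_geometric_ennreal[of e] e by (metis less_imp_le)
      qed
      finally show "cube_cost s (?W \<inter> U N) \<le> c + ennreal e" .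
    qed
    finally show "dyadic_content s (\<Union>n. A n) \<le> c + ennreal e" .
  qed
qed simp

section \<open>Borel sets as projections of closed sets\<close>

text \<open>
In a Polish space these are the analytic sets. The class is closed under countable unions and intersections, whereas
closure under complements fails; for Borel sets the complement is therefore carried along in the induction.
\<close>

definition closed_projection :: "'a::topological_space set \<Rightarrow> bool" where
  "closed_projection A \<longleftrightarrow> (\<exists>C :: ((nat \<Rightarrow> nat) \<times> 'a) set. closed C \<and> A = snd ` C)"

lemma closed_reindex_preimage:
  fixes C :: "((nat \<Rightarrow> nat) \<times> 'a::topological_space) set" and r :: "nat \<Rightarrow> nat"
  assumes "closed C"
  shows "closed {p. (fst p \<circ> r, snd p) \<in> C}"
proof -
  have "continuous_on UNIV (\<lambda>p :: (nat \<Rightarrow> nat) \<times> 'a. (\<lambda>i. fst p (r i), snd p))"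
    by (intro continuous_intros continuous_on_coordinatewise_then_product
        continuous_on_compose2[OF continuous_on_product_coordinates]) auto
  from closed_vimage[OF assms this] show ?thesis by (auto simp: vimage_def comp_def)
qed

lemma closed_coordinate_preimage: "closed {p :: (nat \<Rightarrow> nat) \<times> 'a::topological_space. fst p i \<in> M}"
proof -
  have "continuous_on UNIV (\<lambda>p :: (nat \<Rightarrow> nat) \<times> 'a. fst p i)"
    using continuous_on_compose2[OF continuous_on_product_coordinates[of i] continuous_on_fst[OF continuous_on_id]]
    by simp
  moreover have "closed M" for M :: "nat set" by (simp add: closed_def open_discrete)
  ultimately show ?thesis
    using closed_vimage[of M "\<lambda>p :: (nat \<Rightarrow> nat) \<times> 'a. fst p i"] by (auto simp: vimage_def)
qed

lemma closed_projection_closed: "closed A \<Longrightarrow> closed_projection A"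
  unfolding closed_projection_def
  by (intro exI[of _ "UNIV \<times> A"] conjI closed_Times closed_UNIV) (simp_all add: snd_image_times)

text \<open>
The first entry of the sequence records to which set of the union the point belongs.
\<close>

lemma closed_projection_UN:
  assumes "\<And>n::nat. closed_projection (A n)" shows "closed_projection (\<Union>n. A n)"
proof -
  obtain C where C: "\<And>n. closed (C n)" "\<And>n. A n = snd ` (C n :: ((nat \<Rightarrow> nat) \<times> 'a) set)"
    using assms unfolding closed_projection_def by metis
  define D where "D = (\<Inter>m. {p. fst p 0 \<in> - {m}} \<union> {p. (fst p \<circ> Suc, snd p) \<in> C m})"
  have "closed D" unfolding D_def
    by (intro closed_INT ballI closed_Un closed_coordinate_preimage closed_reindex_preimage C)
  moreover have "(\<Union>n. A n) = snd ` D"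
  proof (intro equalityI subsetI)
    fix y assume "y \<in> (\<Union>n. A n)"
    then obtain n \<sigma> where "(\<sigma>, y) \<in> C n" using C(2) by fastforce
    then have "(case_nat n \<sigma>, y) \<in> D" by (auto simp: D_def comp_def)
    then show "y \<in> snd ` D" by force
  next
    fix y assume "y \<in> snd ` D"
    then obtain \<sigma> where "(\<sigma>, y) \<in> D" by auto
    then have "(\<sigma> \<circ> Suc, y) \<in> C (\<sigma> 0)" by (auto simp: D_def)
    then show "y \<in> (\<Union>n. A n)" using C(2) by force
  qed
  ultimately show ?thesis unfolding closed_projection_def by blast
qed

text \<open>
One sequence codes the countably many witnesses, by means of a bijection between pairs of naturals and naturals.
\<close>

lemma closed_projection_INT:
  assumes "\<And>n::nat. closed_projection (A n)" shows "closed_projection (\<Inter>n. A n)"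
proof -
  obtain C where C: "\<And>n. closed (C n)" "\<And>n. A n = snd ` (C n :: ((nat \<Rightarrow> nat) \<times> 'a) set)"
    using assms unfolding closed_projection_def by metis
  define D where "D = (\<Inter>n. {p. (fst p \<circ> (\<lambda>i. prod_encode (n, i)), snd p) \<in> C n})"
  have "closed D" unfolding D_def by (intro closed_INT ballI closed_reindex_preimage C)
  moreover have "(\<Inter>n. A n) = snd ` D"
  proof (intro equalityI subsetI)
    fix y assume "y \<in> (\<Inter>n. A n)"
    then have "\<forall>n. \<exists>\<sigma>. (\<sigma>, y) \<in> C n" using C(2) by fastforce
    then obtain \<sigma> where \<sigma>: "\<And>n. (\<sigma> n, y) \<in> C n" by metis
    then have "((\<lambda>j. case prod_decode j of (n, i) \<Rightarrow> \<sigma> n i), y) \<in> D" by (auto simp: D_def comp_def)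
    then show "y \<in> snd ` D" by force
  next
    fix y assume "y \<in> snd ` D"
    then obtain \<sigma> where "(\<sigma>, y) \<in> D" by auto
    then have "(\<sigma> \<circ> (\<lambda>i. prod_encode (n, i)), y) \<in> C n" for n by (auto simp: D_def)
    then show "y \<in> (\<Inter>n. A n)" using C(2) by force
  qed
  ultimately show ?thesis unfolding closed_projection_def by blast
qed

text \<open>
Open sets of a metric space are countable unions of closed sets, namely of the points at distance at least \<open>1/(n+1)\<close>
from the complement. The class of sets which are closed projections together with their complements is thus
a sigma-algebra that contains the open sets.
\<close>

lemma borel_imp_closed_projection:
  fixes A :: "'a::metric_space set"
  assumes "A \<in> sets borel" shows "closed_projection A"
proof -
  have "A \<in> sigma_sets UNIV {S. open S}" using assms by (simp add: borel_def sets_measure_of)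
  then have "closed_projection A \<and> closed_projection (- A)"
  proof induction
    case (Basic S)
    then have S: "open S" by simp
    have "closed_projection S"
    proof (cases "S = UNIV")
      case False
      let ?B = "\<lambda>n. {x. 1 / real (Suc n) \<le> infdist x (- S)}"
      have "closed (?B n)" for n by (intro closed_Collect_le continuous_intros)
      then have "closed_projection (\<Union>n. ?B n)" by (intro closed_projection_UN closed_projection_closed)
      moreover have "(\<Union>n. ?B n) = S"
      proof (intro equalityI subsetI)
        fix x assume "x \<in> (\<Union>n. ?B n)"
        then obtain n where "1 / real (Suc n) \<le> infdist x (- S)" by auto
        moreover have "0 < 1 / real (Suc n)" by simp
        ultimately have "infdist x (- S) \<noteq> 0" by linarith
        then show "x \<in> S" using infdist_zero[of x "- S"] by blast
      next
        fix x assume "x \<in> S"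
        then have "infdist x (- S) \<noteq> 0"
          using in_closed_iff_infdist_zero[of "- S" x] S False unfolding closed_def by blast
        then have "0 < infdist x (- S)" using infdist_nonneg[of x "- S"] by linarith
        then obtain n where "1 / real (Suc n) < infdist x (- S)" by (rule nat_approx_posE)
        then have "x \<in> ?B n" by simp
        then show "x \<in> (\<Union>n. ?B n)" by blast
      qed
      ultimately show ?thesis by simp
    qed (simp add: closed_projection_closed)
    then show ?case using S closed_projection_closed[of "- S"] unfolding closed_def by simp
  next
    case Empty
    show ?case by (simp add: closed_projection_closed)
  next
    case (Compl S)
    moreover have "UNIV - S = - S" "- (UNIV - S) = S" by auto
    ultimately show ?case by simp
  next
    case (Union S)
    have "- (\<Union>n. S n) = (\<Inter>n. - S n)" by blast
    then show ?case using Union.IH closed_projection_UN[of S] closed_projection_INT[of "\<lambda>n. - S n"] by simp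
  qed
  then show ?thesis by simp
qed

section \<open>Compact subsets of positive content\<close>

lemma cell_adjacent:
  fixes x y :: "real^'n"
  assumes "\<And>i. \<bar>x $ i - y $ i\<bar> < (1/2) ^ k"
  shows "\<bar>cell k x i - cell k y i\<bar> \<le> 1"
proof -
  have "\<bar>2 ^ k * x $ i - 2 ^ k * y $ i\<bar> = 2 ^ k * \<bar>x $ i - y $ i\<bar>"
    by (metis abs_mult abs_numeral power_abs right_diff_distrib)
  also have "\<dots> < 2 ^ k * (1/2) ^ k" using assms[of i] by (intro mult_strict_left_mono) auto
  also have "\<dots> = 1" by (simp add: power_one_over)
  finally show ?thesis unfolding cell_def by linarith
qed

text \<open>
A cover by half-open cubes has to be made open before compactness can be applied. The enlargement is small enough to lie in the
cube and its immediate neighbours of the same level.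
\<close>

definition open_cube :: "nat \<times> ('n::finite \<Rightarrow> int) \<Rightarrow> (real^'n) set" where
  "open_cube Q = (\<Union>y\<in>cube Q. ball y ((1/2) ^ fst Q))"

lemma open_open_cube: "open (open_cube Q)"
  unfolding open_cube_def by (intro open_UN ballI open_ball)

lemma cube_subset_open_cube: "cube Q \<subseteq> open_cube Q"
  unfolding open_cube_def by (auto intro!: bexI)

definition shift_cube :: "('n \<Rightarrow> int) \<Rightarrow> nat \<times> ('n \<Rightarrow> int) \<Rightarrow> nat \<times> ('n \<Rightarrow> int)" where
  "shift_cube v Q = (fst Q, \<lambda>i. snd Q i + v i)"

lemma card_unit_shifts:
  "finite (PiE (UNIV :: 'n::finite set) (\<lambda>_. {-1..1::int}))"
  "card (PiE (UNIV :: 'n::finite set) (\<lambda>_. {-1..1::int})) = 3 ^ CARD('n)"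
  by (auto intro: finite_PiE simp: card_PiE)

lemma cube_cost_shift: "cube_cost s (shift_cube v ` \<X>) = cube_cost s \<X>"
proof -
  have cost: "cube_cost s \<Y> = (\<integral>\<^sup>+Q. ennreal (2 powr (- s * real (fst Q))) \<partial>count_space \<Y>)"
    for \<Y> :: "(nat \<times> ('a \<Rightarrow> int)) set"
    unfolding cube_cost_def point_measure_def by (simp add: emeasure_density nn_integral_count_space_indicator)
  have "inj_on (shift_cube v) \<X>" by (auto simp: inj_on_def shift_cube_def fun_eq_iff prod_eq_iff)
  then have "bij_betw (shift_cube v) \<X> (shift_cube v ` \<X>)" by (rule inj_on_imp_bij_betw)
  from nn_integral_bij_count_space[OF this, of "\<lambda>Q. ennreal (2 powr (- s * real (fst Q)))"]
  show ?thesis unfolding cost by (simp add: shift_cube_def)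
qed

lemma open_cube_subset_shifts:
  "open_cube Q \<subseteq> (\<Union>v\<in>PiE UNIV (\<lambda>_. {-1..1}). cube (shift_cube v Q))"
proof
  fix x assume "x \<in> open_cube Q"
  then obtain y where y: "cell (fst Q) y = snd Q" "dist y x < (1/2) ^ fst Q"
    by (auto simp: open_cube_def cube_def)
  have "\<bar>x $ i - y $ i\<bar> < (1/2) ^ fst Q" for i
    using y(2) component_le_norm_cart[of "x - y" i] by (simp add: dist_norm norm_minus_commute)
  from cell_adjacent[OF this] have near: "\<bar>cell (fst Q) x i - snd Q i\<bar> \<le> 1" for i unfolding y(1) .
  let ?v = "\<lambda>i. cell (fst Q) x i - snd Q i"
  have "?v \<in> PiE UNIV (\<lambda>_. {-1..1})" using near by (auto simp: PiE_UNIV_domain abs_le_iff) (smt (verit))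
  moreover have "x \<in> cube (shift_cube ?v Q)" by (simp add: cube_def shift_cube_def)
  ultimately show "x \<in> (\<Union>v\<in>PiE UNIV (\<lambda>_. {-1..1}). cube (shift_cube v Q))" by blast
qed

text \<open>
The enlarged cubes are covered by the \<open>3^d\<close> translates of the family by vectors with entries in \<open>{-1, 0, 1}\<close>, and each translate has the
same cost.
\<close>

lemma dyadic_content_le_of_open_cubes:
  fixes \<X> :: "(nat \<times> ('n::finite \<Rightarrow> int)) set"
  assumes "A \<subseteq> (\<Union>Q\<in>\<X>. open_cube Q)"
  shows "dyadic_content s A \<le> 3 ^ CARD('n) * cube_cost s \<X>"
proof -
  let ?V = "PiE (UNIV :: 'n set) (\<lambda>_. {-1..1::int})"
  have "A \<subseteq> (\<Union>v\<in>?V. \<Union>Q\<in>shift_cube v ` \<X>. cube Q)"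
  proof
    fix x assume "x \<in> A"
    then obtain Q where "Q \<in> \<X>" "x \<in> open_cube Q" using assms by blast
    then obtain v where "v \<in> ?V" "x \<in> cube (shift_cube v Q)"
      using open_cube_subset_shifts[of Q] by blast
    then show "x \<in> (\<Union>v\<in>?V. \<Union>Q\<in>shift_cube v ` \<X>. cube Q)"
      using \<open>Q \<in> \<X>\<close> by (intro UN_I[of v] UN_I[of "shift_cube v Q"] imageI)
  qed
  then have "dyadic_content s A \<le> dyadic_content s (\<Union>v\<in>?V. \<Union>Q\<in>shift_cube v ` \<X>. cube Q)"
    by (rule dyadic_content_mono)
  also have "\<dots> \<le> (\<Sum>v\<in>?V. dyadic_content s (\<Union>Q\<in>shift_cube v ` \<X>. cube Q))"
    by (rule dyadic_content_Union_finite) (rule card_unit_shifts)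
  also have "\<dots> \<le> (\<Sum>v\<in>?V. cube_cost s \<X>)"
  proof (rule sum_mono)
    fix v
    show "dyadic_content s (\<Union>Q\<in>shift_cube v ` \<X>. cube Q) \<le> cube_cost s \<X>"
      using dyadic_content_le_cost[OF subset_refl, of s "shift_cube v ` \<X>"] by (simp add: cube_cost_shift)
  qed
  also have "\<dots> = 3 ^ CARD('n) * cube_cost s \<X>" by (simp only: sum_constant card_unit_shifts) simp
  finally show ?thesis .
qed

text \<open>
Choquet's argument. Let \<open>A\<close> be the projection of a closed set \<open>C\<close>. By continuity along increasing unions, bounds \<open>m 0, m 1, \<dots>\<close>
for the entries of the sequence coordinate can be imposed one at a time such that the content of the projection
stays above a constant \<open>c\<close>. With all bounds imposed, the sequences range over a compact product, and the projection \<open>K\<close> is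
compact. An open set which contains \<open>K\<close> contains the projection with only finitely many bounds imposed. Applied to
an enlarged cheap cover of \<open>K\<close> this would make the content of such a projection smaller than \<open>c\<close>.
\<close>

theorem compact_subset_positive_content:
  fixes A :: "(real^'n) set"
  assumes "closed_projection A" "bounded A" "0 < dyadic_content s A"
  obtains K where "K \<subseteq> A" "compact K" "0 < dyadic_content s K"
proof -
  obtain C :: "((nat \<Rightarrow> nat) \<times> (real^'n)) set" where C: "closed C" "A = snd ` C"
    using assms(1) unfolding closed_projection_def by auto
  obtain c where c: "0 < c" "c < dyadic_content s A" using assms(3) dense by blast
  define S where "S n g = snd ` {p \<in> C. \<forall>i<n. fst p i \<le> g i}" for n and g :: "nat \<Rightarrow> nat"
  have "\<exists>g. \<forall>n. c < dyadic_content s (S n (g n)) \<and> (\<forall>i<n. g (Suc n) i = g n i)"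
  proof (rule dependent_nat_choice)
    show "\<exists>g. c < dyadic_content s (S 0 g)" using c(2) C(2) by (simp add: S_def)
    fix g n assume g: "c < dyadic_content s (S n g)"
    have "\<exists>j. c < dyadic_content s (S (Suc n) (g(n := j)))"
    proof (rule ccontr)
      assume "\<nexists>j. c < dyadic_content s (S (Suc n) (g(n := j)))"
      then have "dyadic_content s (S (Suc n) (g(n := j))) \<le> c" for j by (simp add: not_less)
      moreover have "incseq (\<lambda>j. S (Suc n) (g(n := j)))"
        unfolding incseq_def S_def by (intro allI impI image_mono Collect_mono) (auto simp: less_Suc_eq)
      ultimately have "dyadic_content s (\<Union>j. S (Suc n) (g(n := j))) \<le> c"
        by (intro dyadic_content_incseq_le)
      moreover have "S n g \<subseteq> (\<Union>j. S (Suc n) (g(n := j)))"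
      proof
        fix y assume "y \<in> S n g"
        then obtain \<sigma> where "(\<sigma>, y) \<in> C" "\<forall>i<n. \<sigma> i \<le> g i" by (auto simp: S_def)
        then have "y \<in> S (Suc n) (g(n := \<sigma> n))" unfolding S_def
          by (intro image_eqI[where x="(\<sigma>, y)"]) (auto simp: less_Suc_eq)
        then show "y \<in> (\<Union>j. S (Suc n) (g(n := j)))" by blast
      qed
      ultimately show False using g dyadic_content_mono by (metis leD order_trans)
    qed
    then show "\<exists>g'. c < dyadic_content s (S (Suc n) g') \<and> (\<forall>i<n. g' i = g i)" by (metis fun_upd_apply less_irrefl)
  qed
  then obtain g where g: "\<And>n. c < dyadic_content s (S n (g n))" "\<And>n i. i < n \<Longrightarrow> g (Suc n) i = g n i" by blast
  define m where "m i = g (Suc i) i" for i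
  have "g (Suc i + k) i = m i" for i k by (induction k) (auto simp: m_def g(2))
  then have gm: "g n i = m i" if "i < n" for i n using that by (metis less_iff_Suc_add add_Suc)
  have S: "c < dyadic_content s (S n m)" for n
  proof -
    have "S n m = S n (g n)" unfolding S_def using gm by (intro arg_cong[where f="image snd"] Collect_cong) auto
    then show ?thesis using g(1) by simp
  qed
  define B where "B = PiE UNIV (\<lambda>i. {..m i})"
  define K where "K = snd ` (C \<inter> (B \<times> closure A))"
  have B: "compact B"
  proof -
    have "compactin (product_topology (\<lambda>i. euclidean) UNIV) B"
      unfolding B_def compactin_PiE by (auto simp: finite_imp_compact)
    then show ?thesis by (simp add: euclidean_product_topology)
  qed
  then have "compact (B \<times> closure A)" using assms(2) by (intro compact_Times) (auto simp: compact_closure)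
  then have "compact (C \<inter> (B \<times> closure A))" using C(1) by (rule closed_Int_compact[rotated])
  then have K: "compact K" unfolding K_def by (intro compact_continuous_image continuous_intros)
  have KA: "K \<subseteq> A" unfolding K_def C(2) by auto
  \<comment> \<open>Otherwise there are points of \<open>C\<close> that satisfy more and more of the bounds and project outside \<open>U\<close>. Truncating their
    sequences puts them into a compact set, so they accumulate at a point of \<open>C\<close> that satisfies all bounds but projects outside \<open>U\<close>.\<close>
  have nbhd: "\<exists>n. S n m \<subseteq> U" if U: "open U" "K \<subseteq> U" for U
  proof (rule ccontr)
    assume "\<not> ?thesis"
    then have nU: "\<not> S n m \<subseteq> U" for n by blast
    have "\<exists>\<sigma> y. (\<sigma>, y) \<in> C \<and> (\<forall>i<n. \<sigma> i \<le> m i) \<and> y \<notin> U" for n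
    proof -
      obtain y where "y \<in> S n m" "y \<notin> U" using nU[of n] by blast
      then obtain \<sigma> where "(\<sigma>, y) \<in> C" "\<forall>i<n. \<sigma> i \<le> m i" by (auto simp: S_def)
      with \<open>y \<notin> U\<close> show ?thesis by blast
    qed
    then obtain \<sigma> y where \<sigma>: "\<And>n. (\<sigma> n, y n) \<in> C" "\<And>n i. i < n \<Longrightarrow> \<sigma> n i \<le> m i" "\<And>n. y n \<notin> U" by metis
    define \<tau> where "\<tau> n = (\<lambda>i. if i < n then \<sigma> n i else 0)" for n
    have "(\<tau> n, y n) \<in> B \<times> closure A" for n
    proof -
      have "\<tau> n \<in> B" using \<sigma>(2) by (auto simp: B_def \<tau>_def)
      moreover have "y n \<in> A" using \<sigma>(1)[of n] unfolding C(2) by (rule rev_image_eqI) simp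
      ultimately show ?thesis using closure_subset[of A] by blast
    qed
    then have in_B: "\<forall>n. (\<tau> n, y n) \<in> B \<times> closure A" by (rule allI)
    have "seq_compact (B \<times> closure A)" using \<open>compact (B \<times> closure A)\<close> by (rule compact_imp_seq_compact)
    from seq_compactE[OF this in_B] obtain l r where l: "l \<in> B \<times> closure A" "strict_mono r" "((\<lambda>n. (\<tau> n, y n)) \<circ> r) \<longlonglongrightarrow> l"
      by this
    have ty: "(\<lambda>n. \<tau> (r n)) \<longlonglongrightarrow> fst l" "(\<lambda>n. y (r n)) \<longlonglongrightarrow> snd l"
      using tendsto_fst[OF l(3)] tendsto_snd[OF l(3)] by (auto simp: comp_def)
    have "(\<lambda>n. \<sigma> (r n)) \<longlonglongrightarrow> fst l"
    proof -
      have "(\<lambda>n. \<sigma> (r n) i) \<longlonglongrightarrow> fst l i" for i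
      proof -
      have "(\<lambda>n. \<tau> (r n) i) \<longlonglongrightarrow> fst l i"
        using continuous_on_tendsto_compose[OF continuous_on_product_coordinates ty(1)] by simp
      moreover have "\<forall>\<^sub>F n in sequentially. \<tau> (r n) i = \<sigma> (r n) i"
        using eventually_gt_at_top[of i]
      proof eventually_elim
        case (elim n)
        then show ?case using seq_suble[OF l(2), of n] by (simp add: \<tau>_def)
      qed
      ultimately show "(\<lambda>n. \<sigma> (r n) i) \<longlonglongrightarrow> fst l i" by (rule Lim_transform_eventually)
      qed
      then have "limitin (product_topology (\<lambda>i. euclidean) UNIV) (\<lambda>n. \<sigma> (r n)) (fst l) sequentially"
        unfolding limitin_componentwise by (simp add: limitin_canonical_iff)
      then show ?thesis by (simp add: euclidean_product_topology limitin_canonical_iff)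
    qed
    then have "(\<lambda>n. (\<sigma> (r n), y (r n))) \<longlonglongrightarrow> (fst l, snd l)" using ty(2) by (rule tendsto_Pair)
    then have "(fst l, snd l) \<in> C"
      using closed_sequentially[OF C(1), of "\<lambda>n. (\<sigma> (r n), y (r n))"] \<sigma>(1) by simp
    then have "snd l \<in> K" unfolding K_def using l(1) by (intro image_eqI[of _ snd "(fst l, snd l)"]) auto
    then have "snd l \<in> U" using U(2) by blast
    moreover have "snd l \<in> - U"
      using closed_sequentially[of "- U" "\<lambda>n. y (r n)"] \<sigma>(3) ty(2) U(1) unfolding closed_def by simp
    ultimately show False by simp
  qed
  have "0 < dyadic_content s K"
  proof (rule ccontr)
    assume "\<not> ?thesis"
    then have 0: "dyadic_content s K = 0" by simp
    obtain e where e: "0 < e" "3 ^ CARD('n) * ennreal e < c"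
    proof (cases c)
      case (real r)
      then have "0 < r" using c(1) by simp
      let ?e = "r / (2 * 3 ^ CARD('n))"
      have "(3::ennreal) ^ CARD('n) = ennreal (3 ^ CARD('n))" by (simp flip: ennreal_power)
      then have "3 ^ CARD('n) * ennreal ?e = ennreal (3 ^ CARD('n) * ?e)"
        using \<open>0 < r\<close> by (subst ennreal_mult) simp_all
      also have "\<dots> = ennreal (r / 2)" by simp
      also have "\<dots> < c" using \<open>0 < r\<close> real by (simp add: ennreal_lessI)
      finally show ?thesis using that[of ?e] \<open>0 < r\<close> by simp
    next
      case top
      then show ?thesis using c(2) by simp
    qed
    obtain \<X> where X: "K \<subseteq> (\<Union>Q\<in>\<X>. cube Q)" "cube_cost s \<X> \<le> 0 + ennreal e"
      using near_optimal_cover[of s K e] 0 e(1) by auto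
    have "K \<subseteq> (\<Union>Q\<in>\<X>. open_cube Q)" using X(1) cube_subset_open_cube by blast
    then obtain n where "S n m \<subseteq> (\<Union>Q\<in>\<X>. open_cube Q)"
      using nbhd[of "\<Union>Q\<in>\<X>. open_cube Q"] open_open_cube by blast
    then have "dyadic_content s (S n m) \<le> 3 ^ CARD('n) * cube_cost s \<X>" by (rule dyadic_content_le_of_open_cubes)
    also have "\<dots> \<le> 3 ^ CARD('n) * ennreal e" using X(2) by (intro mult_left_mono) auto
    finally show False using S[of n] e(2) by order
  qed
  then show thesis using that[OF KA K] by blast
qed

section \<open>Comparison with Hausdorff measure\<close>

lemma cube_cost_eq_suminf:
  fixes \<X> :: "(nat \<times> ('n::finite \<Rightarrow> int)) set"
  shows "cube_cost s \<X> = (\<Sum>i. if i \<in> to_nat ` \<X> then ennreal (2 powr (- s * real (fst (from_nat i :: nat \<times> ('n \<Rightarrow> int))))) else 0)"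
proof -
  let ?w = "\<lambda>Q :: nat \<times> ('n \<Rightarrow> int). ennreal (2 powr (- s * real (fst Q)))"
  have "cube_cost s \<X> = (\<integral>\<^sup>+Q. ?w Q \<partial>count_space \<X>)"
    unfolding cube_cost_def point_measure_def by (simp add: emeasure_density nn_integral_count_space_indicator)
  also have "\<dots> = (\<integral>\<^sup>+Q. ?w (from_nat (to_nat Q)) \<partial>count_space \<X>)" by simp
  also have "\<dots> = (\<integral>\<^sup>+i. ?w (from_nat i) \<partial>count_space (to_nat ` \<X>))"
    by (rule nn_integral_bij_count_space) (simp add: bij_betw_imageI inj_on_def)
  also have "\<dots> = (\<integral>\<^sup>+i. ?w (from_nat i) * indicator (to_nat ` \<X>) i \<partial>count_space UNIV)"
    by (rule nn_integral_count_space_indicator) simp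
  also have "\<dots> = (\<Sum>i. ?w (from_nat i) * indicator (to_nat ` \<X>) i)"
    by (rule nn_integral_count_space_nat)
  also have "\<dots> = (\<Sum>i. if i \<in> to_nat ` \<X> then ?w (from_nat i) else 0)"
    by (intro arg_cong[where f=suminf] ext) (simp add: indicator_def)
  finally show ?thesis .
qed

lemma dist_same_cell:
  fixes x y :: "real^'n"
  assumes "cell k x = cell k y" shows "dist x y \<le> real CARD('n) * (1/2) ^ k"
proof -
  have "dist x y \<le> (\<Sum>i\<in>UNIV. \<bar>(x - y) $ i\<bar>)" unfolding dist_norm by (rule norm_le_l1_cart)
  also have "\<dots> \<le> (\<Sum>i\<in>(UNIV :: 'n set). (1/2) ^ k)" by (intro sum_mono same_cell_coordinate) (simp add: assms)
  finally show ?thesis by simp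
qed

lemma bounded_cube: "bounded (cube Q)"
  and diameter_cube: "diameter (cube Q :: (real^'n) set) \<le> real CARD('n) * (1/2) ^ fst Q"
proof -
  have d: "dist x y \<le> real CARD('n) * (1/2) ^ fst Q" if "x \<in> cube Q" "y \<in> cube Q" for x y :: "real^'n" and Q
    using that by (intro dist_same_cell) (simp add: cube_def)
  show "bounded (cube Q)" for Q :: "nat \<times> ('n \<Rightarrow> int)" using d[of _ Q] unfolding bounded_two_points by blast
  show "diameter (cube Q :: (real^'n) set) \<le> real CARD('n) * (1/2) ^ fst Q"
    using d by (intro diameter_le) (auto simp: dist_norm)
qed

text \<open>
A cover of small total cost consists of small cubes only, since each single cube costs at most the total. Therefore content zero already implies
that the premeasures vanish at every scale.
\<close>

lemma hausdorff_measure_zero_if_dyadic_content_zero: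
  fixes A :: "(real^'n) set"
  assumes "0 < s" "dyadic_content s A = 0"
  shows "hausdorff_measure s A = 0"
proof -
  have "hausdorff_premeasure s \<delta> A = 0" if \<delta>: "0 < \<delta>" for \<delta>
  proof -
    have "hausdorff_premeasure s \<delta> A \<le> 0 + ennreal e" if e: "0 < e" for e :: real
    proof -
      define d where "d = real CARD('n)"
      have d: "0 < d" by (simp add: d_def)
      \<comment> \<open>The first bound makes the total weight at most \<open>e\<close>, the second one makes all diameters at most \<open>\<delta>\<close>.\<close>
      define e' where "e' = min (e / d powr s) ((\<delta> / d) powr s)"
      have e': "0 < e'" "d powr s * e' \<le> e" "e' \<le> (\<delta> / d) powr s"
        using e d \<delta> by (auto simp: e'_def min_def field_simps)
      obtain \<X> where X: "A \<subseteq> (\<Union>Q\<in>\<X>. cube Q)" "cube_cost s \<X> \<le> 0 + ennreal e'"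
        using near_optimal_cover[of s A e'] assms(2) e'(1) by auto
      have small: "real CARD('n) * (1/2) ^ fst Q \<le> \<delta>" if "Q \<in> \<X>" for Q
      proof -
        have "ennreal (2 powr (- s * real (fst Q))) = cube_cost s {Q}" by (simp add: cube_cost_finite)
        also have "\<dots> \<le> cube_cost s \<X>" using that by (intro cube_cost_mono) simp
        also have "\<dots> \<le> ennreal e'" using X(2) by simp
        finally have "2 powr (- s * real (fst Q)) \<le> e'" using e'(1) by (simp add: ennreal_le_iff)
        also have "2 powr (- s * real (fst Q)) = ((1/2) ^ fst Q) powr s"
          by (simp add: powr_minus powr_powr power_one_over powr_realpow[symmetric] mult.commute powr_divide inverse_eq_divide)
        finally have "((1/2) ^ fst Q) powr s \<le> (\<delta> / d) powr s" using e'(3) by simp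
        then have "(1/2) ^ fst Q \<le> \<delta> / d" using powr_less_mono2[OF assms(1), of "\<delta>/d" "(1/2) ^ fst Q"] d \<delta> by fastforce
        then show ?thesis using d by (simp add: d_def field_simps)
      qed
      define U where "U i = (if i \<in> to_nat ` \<X> then cube (from_nat i) else {} :: (real^'n) set)" for i
      have U: "U \<in> {U. A \<subseteq> (\<Union>i. U i) \<and> (\<forall>i. bounded (U i) \<and> diameter (U i) \<le> \<delta>)}"
      proof (rule CollectI, intro conjI allI)
        show "A \<subseteq> (\<Union>i. U i)"
        proof
          fix y assume "y \<in> A"
          then obtain Q where Q: "Q \<in> \<X>" "y \<in> cube Q" using X(1) by blast
          then have "y \<in> U (to_nat Q)" by (simp add: U_def)
          then show "y \<in> (\<Union>i. U i)" by blast
        qed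
        fix i
        show "bounded (U i)" by (simp add: U_def bounded_cube)
        show "diameter (U i) \<le> \<delta>"
        proof (cases "i \<in> to_nat ` \<X>")
          case True
          then obtain Q where "Q \<in> \<X>" "i = to_nat Q" by blast
          then show ?thesis using small[of Q] diameter_cube[of Q] by (simp add: U_def)
        qed (use \<delta> in \<open>simp add: U_def\<close>)
      qed
      have "hausdorff_premeasure s \<delta> A \<le> (\<Sum>i. diameter_weight s (U i))"
        unfolding hausdorff_premeasure_def by (rule INF_lower[OF U])
      also have "\<dots> \<le> (\<Sum>i. ennreal (d powr s) * (if i \<in> to_nat ` \<X> then ennreal (2 powr (- s * real (fst (from_nat i :: nat \<times> ('n \<Rightarrow> int))))) else 0))"
      proof (intro suminf_le allI)
        fix i
        show "diameter_weight s (U i) \<le> ennreal (d powr s) * (if i \<in> to_nat ` \<X> then ennreal (2 powr (- s * real (fst (from_nat i :: nat \<times> ('n \<Rightarrow> int))))) else 0)"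
        proof (cases "U i = {}")
          case False
          then obtain Q where Q: "Q \<in> \<X>" "i = to_nat Q" by (auto simp: U_def split: if_splits)
          have "diameter (cube Q) powr s \<le> (d * (1/2) ^ fst Q) powr s"
            using diameter_cube[of Q] assms(1) by (intro powr_mono2) (auto simp: d_def diameter_ge_0 bounded_cube)
          also have "\<dots> = d powr s * 2 powr (- s * real (fst Q))"
            using d by (simp add: powr_mult powr_minus powr_powr power_one_over powr_realpow[symmetric] mult.commute powr_divide inverse_eq_divide)
          finally show ?thesis using False assms(1) Q
            by (simp add: diameter_weight_def U_def ennreal_leI flip: ennreal_mult)
        qed (simp add: diameter_weight_def)
      qed simp_all
      also have "\<dots> = ennreal (d powr s) * cube_cost s \<X>"
        unfolding cube_cost_eq_suminf by (rule ennreal_suminf_cmult)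
      also have "\<dots> \<le> ennreal (d powr s) * ennreal e'" using X(2) by (intro mult_left_mono) auto
      also have "\<dots> = ennreal (d powr s * e')" using e' by (simp add: ennreal_mult)
      also have "\<dots> \<le> ennreal e" using e'(2) by (rule ennreal_leI)
      finally show ?thesis by simp
    qed
    then have "hausdorff_premeasure s \<delta> A \<le> 0" by (rule ennreal_le_epsilon)
    then show ?thesis by simp
  qed
  then show ?thesis unfolding hausdorff_measure_def by simp
qed

text \<open>
Covering sets may be single points, of diameter 0 and weight 0, so there can be infinitely many of them at no cost. Every diameter is increased by a
summable positive amount, after which each set is contained in a ball of positive radius.
\<close>

lemma hausdorff_null_ball_cover:
  fixes D :: "'a::metric_space set"
  assumes null: "hausdorff_measure s\<^sub>0 D = 0" and s: "0 \<le> s\<^sub>0" "s\<^sub>0 \<le> s" "0 < s" and e: "0 < (e::real)"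
  obtains u :: "nat \<Rightarrow> 'a" and \<rho> :: "nat \<Rightarrow> real"
  where "\<And>i. 0 < \<rho> i" "D \<subseteq> (\<Union>i. ball (u i) (\<rho> i))" "(\<Sum>i. ennreal (\<rho> i powr s)) < ennreal e"
proof -
  define e' where "e' = e / (2 powr s * 2)"
  have e': "0 < e'" "2 powr s * (e' + e') = e" using e by (auto simp: e'_def field_simps)
  have "hausdorff_premeasure s\<^sub>0 1 D \<le> hausdorff_measure s\<^sub>0 D"
    unfolding hausdorff_measure_def by (rule SUP_upper) simp
  then have "hausdorff_premeasure s\<^sub>0 1 D < ennreal e'" using null e'(1) by simp
  then obtain U where U: "D \<subseteq> (\<Union>i::nat. U i)" "\<And>i. bounded (U i)" "\<And>i. diameter (U i) \<le> 1"
    "(\<Sum>i. diameter_weight s\<^sub>0 (U i)) < ennreal e'"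
    unfolding hausdorff_premeasure_def INF_less_iff by auto
  define \<eta> where "\<eta> i = (e' * (1/2) ^ Suc i) powr (1 / s)" for i
  have \<eta>: "0 < \<eta> i" "\<eta> i powr s = e' * (1/2) ^ Suc i" for i
    using e'(1) s(3) by (auto simp: \<eta>_def powr_powr)
  define u where "u i = (SOME y. y \<in> U i)" for i
  define \<rho> where "\<rho> i = diameter (U i) + \<eta> i" for i
  have dpos: "0 \<le> diameter (U i)" for i using U(2) by (simp add: diameter_ge_0)
  show thesis
  proof (rule that[of \<rho> u])
    show "0 < \<rho> i" for i using dpos[of i] \<eta>(1)[of i] by (simp add: \<rho>_def)
    show "D \<subseteq> (\<Union>i. ball (u i) (\<rho> i))"
    proof
      fix y assume "y \<in> D"
      then obtain i where i: "y \<in> U i" using U(1) by blast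
      then have "u i \<in> U i" unfolding u_def by (rule someI)
      then have "dist (u i) y \<le> diameter (U i)" using diameter_bounded_bound[OF U(2)] i by blast
      then have "y \<in> ball (u i) (\<rho> i)" using \<eta>(1)[of i] by (simp add: \<rho>_def)
      then show "y \<in> (\<Union>i. ball (u i) (\<rho> i))" by blast
    qed
    have summand: "ennreal (\<rho> i powr s) \<le> ennreal (2 powr s) * (diameter_weight s\<^sub>0 (U i) + ennreal (e' * (1/2) ^ Suc i))" for i
    proof -
      let ?d = "diameter (U i)"
      have "\<rho> i powr s \<le> (2 * max ?d (\<eta> i)) powr s"
        unfolding \<rho>_def using s(3) dpos[of i] \<eta>(1)[of i] by (intro powr_mono2) auto
      also have "\<dots> = 2 powr s * (max ?d (\<eta> i)) powr s" using dpos[of i] \<eta>(1)[of i] by (intro powr_mult)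
      also have "(max ?d (\<eta> i)) powr s \<le> ?d powr s + \<eta> i powr s" by (simp add: max_def)
      finally have "\<rho> i powr s \<le> 2 powr s * (?d powr s + e' * (1/2) ^ Suc i)" by (simp add: \<eta>(2))
      then have "ennreal (\<rho> i powr s) \<le> ennreal (2 powr s * (?d powr s + e' * (1/2) ^ Suc i))" by (rule ennreal_leI)
      also have "\<dots> = ennreal (2 powr s) * (ennreal (?d powr s) + ennreal (e' * (1/2) ^ Suc i))"
        using e'(1) by (simp add: ennreal_mult ennreal_plus[symmetric] del: ennreal_plus)
      also have "\<dots> \<le> ennreal (2 powr s) * (diameter_weight s\<^sub>0 (U i) + ennreal (e' * (1/2) ^ Suc i))"
      proof (intro mult_left_mono add_right_mono)
        show "ennreal (?d powr s) \<le> diameter_weight s\<^sub>0 (U i)"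
        proof (cases "?d = 0")
          case False
          have "?d powr s \<le> ?d powr s\<^sub>0" using dpos[of i] U(3)[of i] s(2) by (intro powr_mono') auto
          moreover have "?d powr 0 = 1" using False by simp
          ultimately show ?thesis using False by (auto simp: diameter_weight_def intro!: ennreal_leI)
        qed simp
      qed simp
      finally show ?thesis .
    qed
    have "(\<Sum>i. ennreal (\<rho> i powr s)) \<le> (\<Sum>i. ennreal (2 powr s) * (diameter_weight s\<^sub>0 (U i) + ennreal (e' * (1/2) ^ Suc i)))"
      by (intro suminf_le allI summand) simp_all
    also have "\<dots> = ennreal (2 powr s) * (\<Sum>i. diameter_weight s\<^sub>0 (U i) + ennreal (e' * (1/2) ^ Suc i))"
      by (rule ennreal_suminf_cmult)
    also have "(\<Sum>i. diameter_weight s\<^sub>0 (U i) + ennreal (e' * (1/2) ^ Suc i))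
        = (\<Sum>i. diameter_weight s\<^sub>0 (U i)) + (\<Sum>i. ennreal (e' * (1/2) ^ Suc i))"
      by (rule suminf_add[symmetric]) simp_all
    also have "(\<Sum>i. ennreal (e' * (1/2) ^ Suc i)) = ennreal e'" using e'(1) by (intro suminf_geometric_ennreal) simp
    also have "ennreal (2 powr s) * ((\<Sum>i. diameter_weight s\<^sub>0 (U i)) + ennreal e') < ennreal (2 powr s) * (ennreal e' + ennreal e')"
    proof (rule ennreal_mult_strict_left_mono)
      show "(\<Sum>i. diameter_weight s\<^sub>0 (U i)) + ennreal e' < ennreal e' + ennreal e'"
        using U(4) by (cases "\<Sum>i. diameter_weight s\<^sub>0 (U i)") (use e'(1) in \<open>auto simp: ennreal_less_iff simp flip: ennreal_plus\<close>)
    qed simp_all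
    also have "\<dots> = ennreal (2 powr s * (e' + e'))" using e'(1) by (simp add: ennreal_mult ennreal_plus[symmetric] del: ennreal_plus)
    also have "\<dots> = ennreal e" unfolding e'(2) ..
    finally show "(\<Sum>i. ennreal (\<rho> i powr s)) < ennreal e" .
  qed
qed

text \<open>
The balls of the preceding cover are sorted by the dyadic size of the radius. If the total cost is less than \<open>2^(-s(k0+1))\<close>, then
there are at most \<open>2^(s k)\<close> radii of size \<open>2^(-k)\<close>, and none for \<open>k < k0\<close>.
\<close>

lemma hausdorff_null_cover_by_scales:
  fixes D :: "'a::metric_space set"
  assumes null: "hausdorff_measure s\<^sub>0 D = 0" and s: "0 \<le> s\<^sub>0" "s\<^sub>0 \<le> s" "0 < s"
  obtains T :: "nat \<Rightarrow> 'a set"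
  where "\<And>k. finite (T k)" "\<And>k. real (card (T k)) \<le> 2 powr (s * real k)" "\<And>k. k < k\<^sub>0 \<Longrightarrow> T k = {}"
    "D \<subseteq> (\<Union>k. \<Union>t\<in>T k. ball t ((1/2) ^ k))"
proof -
  define e where "e = 2 powr (- s * (real k\<^sub>0 + 1))"
  have e: "0 < e" by (simp add: e_def)
  obtain u \<rho> where u: "\<And>i::nat. 0 < \<rho> i" "D \<subseteq> (\<Union>i. ball (u i) (\<rho> i))" "(\<Sum>i. ennreal (\<rho> i powr s)) < ennreal e"
    by (rule hausdorff_null_ball_cover[OF null s e]) (rule that)
  define I where "I k = {i. (1/2) ^ Suc k < \<rho> i \<and> \<rho> i \<le> (1/2) ^ k}" for k
  have fin_sum: "(\<Sum>i\<in>F. \<rho> i powr s) < e" if "finite F" for F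
  proof -
    have "ennreal (\<Sum>i\<in>F. \<rho> i powr s) = (\<Sum>i\<in>F. ennreal (\<rho> i powr s))" by (rule sum_ennreal[symmetric]) simp
    also have "\<dots> \<le> (\<Sum>i. ennreal (\<rho> i powr s))" by (rule sum_le_suminf) (auto simp: that)
    finally have "ennreal (\<Sum>i\<in>F. \<rho> i powr s) < ennreal e" using u(3) by (rule le_less_trans)
    then show ?thesis by (simp add: ennreal_less_iff sum_nonneg)
  qed
  have card_F: "real (card F) < 2 powr (s * (real k - real k\<^sub>0))" if F: "finite F" "F \<subseteq> I k" for F k
  proof -
    have "real (card F) * 2 powr (- s * (real k + 1)) = (\<Sum>i\<in>F. ((1/2) ^ Suc k) powr s)"
    proof -
      have "((1/2) ^ Suc k :: real) = 2 powr (- (real k + 1))"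
      proof -
        have "(2::real) powr (- real (Suc k)) = inverse (2 ^ Suc k)" by (subst powr_minus, subst powr_realpow) simp_all
        then show ?thesis by (simp add: power_one_over inverse_eq_divide add.commute)
      qed
      then have "((1/2) ^ Suc k :: real) powr s = 2 powr (- s * (real k + 1))" by (simp add: powr_powr algebra_simps)
      then show ?thesis by simp
    qed
    also have "\<dots> \<le> (\<Sum>i\<in>F. \<rho> i powr s)"
      using F(2) s(3) by (intro sum_mono powr_mono2) (auto simp: I_def)
    also have "\<dots> < e" by (rule fin_sum[OF F(1)])
    finally have "real (card F) < e / 2 powr (- s * (real k + 1))" by (simp add: pos_less_divide_eq)
    also have "\<dots> = 2 powr (s * (real k - real k\<^sub>0))" unfolding e_def powr_diff[symmetric] by (simp add: algebra_simps)
    finally show ?thesis .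
  qed
  have fin: "finite (I k)" for k
  proof (rule ccontr)
    assume inf: "infinite (I k)"
    obtain n :: nat where n: "2 powr (s * (real k - real k\<^sub>0)) < real n" using reals_Archimedean2 by blast
    obtain F where "F \<subseteq> I k" "finite F" "card F = n" using infinite_arbitrarily_large[OF inf] by blast
    then show False using card_F[of F k] n by simp
  qed
  show thesis
  proof (rule that[of "\<lambda>k. u ` I k"])
    show "finite (u ` I k)" for k using fin by simp
    have c: "real (card (u ` I k)) < 2 powr (s * (real k - real k\<^sub>0))" for k
      using card_F[OF fin subset_refl, of k] card_image_le[OF fin, of u k] by linarith
    show "real (card (u ` I k)) \<le> 2 powr (s * real k)" for k
    proof -
      have "2 powr (s * (real k - real k\<^sub>0)) \<le> 2 powr (s * real k)" using s(3) by (intro powr_mono) auto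
      then show ?thesis using c[of k] by linarith
    qed
    show "u ` I k = {}" if "k < k\<^sub>0" for k
    proof -
      have "2 powr (s * (real k - real k\<^sub>0)) \<le> 2 powr 0" using s(3) that by (intro powr_mono) (auto simp: mult_le_0_iff)
      then have "real (card (u ` I k)) < 1" using c[of k] by simp
      then show ?thesis using fin[of k] by simp
    qed
    show "D \<subseteq> (\<Union>k. \<Union>t\<in>u ` I k. ball t ((1/2) ^ k))"
    proof
      fix y assume "y \<in> D"
      then obtain i where i: "dist (u i) y < \<rho> i" using u(2) by auto
      have "\<rho> i powr s < 1"
      proof -
        have "\<rho> i powr s < e" using fin_sum[of "{i}"] by simp
        also have "e \<le> 2 powr 0" unfolding e_def using s(3) by (intro powr_mono) (auto simp: mult_le_0_iff)
        finally show ?thesis by simp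
      qed
      then have "\<rho> i < 1" using powr_mono2[of s 1 "\<rho> i"] s(3) by fastforce
      define n where "n = (LEAST n. (1/2) ^ n < \<rho> i)"
      have "\<exists>n. (1/2) ^ n < \<rho> i" using real_arch_pow_inv[of "\<rho> i" "1/2"] u(1) by auto
      then have n: "(1/2) ^ n < \<rho> i" unfolding n_def by (rule LeastI_ex)
      have "n \<noteq> 0" using n \<open>\<rho> i < 1\<close> by (intro notI) simp
      then obtain k where k: "n = Suc k" using not0_implies_Suc by blast
      have "\<not> (1/2) ^ k < \<rho> i" using not_less_Least[of k "\<lambda>n. (1/2) ^ n < \<rho> i"] k by (simp add: n_def)
      then have "i \<in> I k" "\<rho> i \<le> (1/2) ^ k" using n k by (auto simp: I_def)
      then show "y \<in> (\<Union>k. \<Union>t\<in>u ` I k. ball t ((1/2) ^ k))" using i by (intro UN_I[of k] UN_I[of "u i"]) auto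
    qed
  qed
qed

section \<open>Frostman masses on the dyadic tree\<close>

lemma finite_cells_bounded:
  fixes K :: "(real^'n) set"
  assumes "bounded K" shows "finite (cell k ` K)"
proof -
  obtain R where R: "\<And>y. y \<in> K \<Longrightarrow> norm y \<le> R" using assms unfolding bounded_iff by blast
  have "cell k ` K \<subseteq> PiE UNIV (\<lambda>_. {-\<lceil>2 ^ k * R\<rceil> - 1 .. \<lceil>2 ^ k * R\<rceil>})"
  proof
    fix q assume "q \<in> cell k ` K"
    then obtain y where y: "y \<in> K" "q = cell k y" by blast
    have "q i \<in> {-\<lceil>2 ^ k * R\<rceil> - 1 .. \<lceil>2 ^ k * R\<rceil>}" for i
    proof -
      have "\<bar>y $ i\<bar> \<le> R" using component_le_norm_cart[of y i] R[OF y(1)] by linarith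
      then have "2 ^ k * \<bar>y $ i\<bar> \<le> 2 ^ k * R" by (intro mult_left_mono) auto
      then have "\<bar>2 ^ k * y $ i\<bar> \<le> 2 ^ k * R" by (simp add: abs_mult)
      then have "-\<lceil>2 ^ k * R\<rceil> - 1 \<le> \<lfloor>2 ^ k * y $ i\<rfloor>" "\<lfloor>2 ^ k * y $ i\<rfloor> \<le> \<lceil>2 ^ k * R\<rceil>" by linarith+
      then show ?thesis unfolding y(2) cell_def by simp
    qed
    then show "q \<in> PiE UNIV (\<lambda>_. {-\<lceil>2 ^ k * R\<rceil> - 1 .. \<lceil>2 ^ k * R\<rceil>})" by (auto simp: PiE_UNIV_domain)
  qed
  moreover have "finite (PiE (UNIV :: 'n set) (\<lambda>_. {-\<lceil>2 ^ k * R\<rceil> - 1 .. \<lceil>2 ^ k * R\<rceil>}))"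
    by (rule finite_PiE) auto
  ultimately show ?thesis by (rule finite_subset)
qed

lemma ancestor_in_cells: "j \<le> k \<Longrightarrow> q \<in> cell k ` K \<Longrightarrow> ancestor j k q \<in> cell j ` K"
  by (auto simp: ancestor_cell)

text \<open>
The number \<open>L k q\<close> is the mass of the cube of level \<open>k\<close> with index \<open>q\<close>. Such a mass is finitely additive, and it is
never applied to anything but finite unions of cubes of one level.
\<close>

definition frostman_mass :: "real \<Rightarrow> (real^'n) set \<Rightarrow> (nat \<Rightarrow> ('n \<Rightarrow> int) \<Rightarrow> real) \<Rightarrow> bool" where
  "frostman_mass s K L \<longleftrightarrow>
     (\<forall>k q. 0 \<le> L k q \<and> L k q \<le> 2 powr (- s * real k)) \<and>
     (\<forall>k. \<forall>p\<in>cell k ` K. L k p = (\<Sum>q | q \<in> cell (Suc k) ` K \<and> ancestor k (Suc k) q = p. L (Suc k) q))"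

lemma frostman_mass_ancestors:
  assumes "frostman_mass s K L" "bounded K" "j \<le> k" "S \<subseteq> cell j ` K"
  shows "(\<Sum>q\<in>S. L j q) = (\<Sum>q | q \<in> cell k ` K \<and> ancestor j k q \<in> S. L k q)"
  using assms(3)
proof (induction rule: dec_induct)
  case base
  have "{q \<in> cell j ` K. ancestor j j q \<in> S} = S" using assms(4) by (auto simp: ancestor_def)
  then show ?case by simp
next
  case (step k)
  let ?A = "{q \<in> cell k ` K. ancestor j k q \<in> S}" and ?B = "{q \<in> cell (Suc k) ` K. ancestor j (Suc k) q \<in> S}"
  have anc: "ancestor j k (ancestor k (Suc k) q) = ancestor j (Suc k) q" if "q \<in> cell (Suc k) ` K" for q
    using that step(1) by (auto simp: ancestor_cell)
  have fin: "finite ?A" "finite ?B" using finite_cells_bounded[OF assms(2)] by auto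
  have "(\<Sum>p\<in>?A. L k p) = (\<Sum>p\<in>?A. \<Sum>q | q \<in> cell (Suc k) ` K \<and> ancestor k (Suc k) q = p. L (Suc k) q)"
    using assms(1) by (intro sum.cong) (auto simp: frostman_mass_def)
  also have "\<dots> = (\<Sum>p\<in>?A. \<Sum>q | q \<in> ?B \<and> ancestor k (Suc k) q = p. L (Suc k) q)"
  proof (rule sum.cong[OF refl])
    fix p assume p: "p \<in> ?A"
    have "ancestor j (Suc k) q \<in> S" if "q \<in> cell (Suc k) ` K" "ancestor k (Suc k) q = p" for q
      using anc[OF that(1)] that p by simp
    then have "{q. q \<in> cell (Suc k) ` K \<and> ancestor k (Suc k) q = p} = {q. q \<in> ?B \<and> ancestor k (Suc k) q = p}"
      by blast
    then show "(\<Sum>q | q \<in> cell (Suc k) ` K \<and> ancestor k (Suc k) q = p. L (Suc k) q)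
        = (\<Sum>q | q \<in> ?B \<and> ancestor k (Suc k) q = p. L (Suc k) q)" by simp
  qed
  also have "\<dots> = (\<Sum>q\<in>?B. L (Suc k) q)"
  proof (rule sum.group[OF fin(2) fin(1)])
    show "ancestor k (Suc k) ` ?B \<subseteq> ?A"
      using anc ancestor_in_cells[of k "Suc k" _ K] by auto
  qed
  finally show ?case using step.IH by simp
qed

lemma dyadic_content_cube_le: "dyadic_content s (K \<inter> cube Q) \<le> ennreal (2 powr (- s * real (fst Q)))"
proof -
  have "dyadic_content s (K \<inter> cube Q) \<le> cube_cost s {Q}" by (rule dyadic_content_le_cost) simp
  then show ?thesis by (simp add: cube_cost_finite)
qed

text \<open>
The mass is passed from each cube to its children in proportion to their contents. It never
exceeds the content: this is inherited by the children because the content of a cube is at most the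
sum of theirs.
\<close>

theorem frostman_mass_exists:
  fixes K :: "(real^'n) set"
  assumes K: "bounded K" and pos: "0 < dyadic_content s K"
  obtains L where "frostman_mass s K L" "0 < (\<Sum>q\<in>cell 0 ` K. L 0 q)"
proof -
  define \<mu> where "\<mu> k q = enn2real (dyadic_content s (K \<inter> cube (k, q)))" for k q
  have le: "dyadic_content s (K \<inter> cube (k, q)) \<le> ennreal (2 powr (- s * real k))" for k q
    using dyadic_content_cube_le[of s K "(k, q)"] by simp
  then have \<mu>_eq: "ennreal (\<mu> k q) = dyadic_content s (K \<inter> cube (k, q))" for k q
    unfolding \<mu>_def by (meson ennreal_enn2real ennreal_less_top le_less_trans)
  then have \<mu>_le: "\<mu> k q \<le> 2 powr (- s * real k)" for k q using le[of k q] by (metis ennreal_le_iff powr_ge_zero)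
  have \<mu>_nonneg: "0 \<le> \<mu> k q" for k q by (simp add: \<mu>_def)
  define children where "children k p = {q \<in> cell (Suc k) ` K. ancestor k (Suc k) q = p}" for k p
  have fin: "finite (children k p)" for k p using finite_cells_bounded[OF K] by (simp add: children_def)
  have \<mu>_sub: "\<mu> k p \<le> (\<Sum>q\<in>children k p. \<mu> (Suc k) q)" for k p
  proof -
    have "K \<inter> cube (k, p) \<subseteq> (\<Union>q\<in>children k p. K \<inter> cube (Suc k, q))"
    proof
      fix y assume y: "y \<in> K \<inter> cube (k, p)"
      then have "cell (Suc k) y \<in> children k p" by (simp add: children_def ancestor_cell cube_def)
      then show "y \<in> (\<Union>q\<in>children k p. K \<inter> cube (Suc k, q))" using y by (intro UN_I) (auto simp: cube_def)
    qed
    then have "dyadic_content s (K \<inter> cube (k, p)) \<le> dyadic_content s (\<Union>q\<in>children k p. K \<inter> cube (Suc k, q))"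
      by (rule dyadic_content_mono)
    also have "\<dots> \<le> (\<Sum>q\<in>children k p. dyadic_content s (K \<inter> cube (Suc k, q)))"
      by (rule dyadic_content_Union_finite[OF fin])
    also have "\<dots> = ennreal (\<Sum>q\<in>children k p. \<mu> (Suc k) q)"
      by (simp add: \<mu>_eq[symmetric] \<mu>_nonneg sum_ennreal)
    finally show ?thesis by (simp add: \<mu>_eq[symmetric] ennreal_le_iff \<mu>_nonneg sum_nonneg)
  qed
  define D where "D k p = (\<Sum>q\<in>children k p. \<mu> (Suc k) q)" for k p
  have D_nonneg: "0 \<le> D k p" for k p by (simp add: D_def \<mu>_nonneg sum_nonneg)
  \<comment> \<open>If the children have total content \<open>D = 0\<close>, the parent has content and hence mass 0, which agrees with division by 0 giving 0.\<close>
  define L where "L = rec_nat (\<mu> 0) (\<lambda>k Lk q. \<mu> (Suc k) q * (Lk (ancestor k (Suc k) q) / D k (ancestor k (Suc k) q)))"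
  have L0: "L 0 = \<mu> 0" by (simp add: L_def)
  have LS: "L (Suc k) q = \<mu> (Suc k) q * (L k (ancestor k (Suc k) q) / D k (ancestor k (Suc k) q))" for k q
    by (simp add: L_def)
  have L: "0 \<le> L k q \<and> L k q \<le> \<mu> k q" for k q
  proof (induction k arbitrary: q)
    case (Suc k)
    let ?p = "ancestor k (Suc k) q"
    have p: "0 \<le> L k ?p" "L k ?p \<le> D k ?p" using Suc[of ?p] \<mu>_sub[of k ?p] by (auto simp: D_def)
    then have "L k ?p / D k ?p \<le> 1" using D_nonneg[of k ?p] by (simp add: divide_le_eq)
    then have "\<mu> (Suc k) q * (L k ?p / D k ?p) \<le> \<mu> (Suc k) q * 1" by (intro mult_left_mono \<mu>_nonneg)
    then show ?case using p D_nonneg[of k ?p] \<mu>_nonneg[of "Suc k" q] by (simp add: LS)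
  qed (simp add: L0 \<mu>_nonneg)
  have split: "L k p = (\<Sum>q\<in>children k p. L (Suc k) q)" for k p
  proof -
    have "(\<Sum>q\<in>children k p. L (Suc k) q) = (\<Sum>q\<in>children k p. \<mu> (Suc k) q * (L k p / D k p))"
      by (intro sum.cong refl) (auto simp: LS children_def)
    also have "\<dots> = D k p * (L k p / D k p)" by (simp only: sum_distrib_right[symmetric] D_def[symmetric])
    also have "\<dots> = L k p"
    proof (cases "D k p = 0")
      case True
      then have "L k p = 0" using L[of k p] \<mu>_sub[of k p] by (simp add: D_def)
      then show ?thesis by simp
    qed simp
    finally show ?thesis by simp
  qed
  show thesis
  proof (rule that[of L])
    show "frostman_mass s K L" unfolding frostman_mass_def

    proof (intro conjI allI ballI)
      show "L k q \<le> 2 powr (- s * real k)" for k q using L[of k q] \<mu>_le[of k q] by linarith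
      show "0 \<le> L k q" for k q using L[of k q] by simp
      show "L k p = (\<Sum>q | q \<in> cell (Suc k) ` K \<and> ancestor k (Suc k) q = p. L (Suc k) q)" for k p
        using split[of k p] unfolding children_def .
    qed
    have "dyadic_content s K \<le> dyadic_content s (\<Union>q\<in>cell 0 ` K. K \<inter> cube (0, q))"
      by (rule dyadic_content_mono) (auto simp: cube_def)
    also have "\<dots> \<le> (\<Sum>q\<in>cell 0 ` K. dyadic_content s (K \<inter> cube (0, q)))"
      by (rule dyadic_content_Union_finite[OF finite_cells_bounded[OF K]])
    also have "\<dots> = ennreal (\<Sum>q\<in>cell 0 ` K. L 0 q)"
      by (simp add: \<mu>_eq[symmetric] \<mu>_nonneg sum_ennreal L0)
    finally show "0 < (\<Sum>q\<in>cell 0 ` K. L 0 q)" using pos by (metis ennreal_less_zero_iff less_le_trans)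
  qed
qed

section \<open>Counting dyadic cubes near two spheres\<close>

lemma card_le_mult_card_image:
  assumes "finite S" "\<And>b. b \<in> f ` S \<Longrightarrow> real (card {a \<in> S. f a = b}) \<le> B"
  shows "real (card S) \<le> B * real (card (f ` S))"
proof -
  have "S = (\<Union>b\<in>f ` S. {a \<in> S. f a = b})" by blast
  then have "card S \<le> (\<Sum>b\<in>f ` S. card {a \<in> S. f a = b})"
    using card_UN_le[of "f ` S" "\<lambda>b. {a \<in> S. f a = b}"] assms(1) by simp
  then have "real (card S) \<le> (\<Sum>b\<in>f ` S. real (card {a \<in> S. f a = b}))" by (simp flip: of_nat_sum)
  also have "\<dots> \<le> (\<Sum>b\<in>f ` S. B)" by (intro sum_mono assms(2))
  finally show ?thesis by (simp add: mult.commute)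
qed

lemma card_int_interval_le:
  assumes "(1::real) \<le> B" shows "real (card {a - \<lfloor>B\<rfloor> .. a + \<lfloor>B\<rfloor>}) \<le> 3 * B"
proof -
  have "card {a - \<lfloor>B\<rfloor> .. a + \<lfloor>B\<rfloor>} = nat (2 * \<lfloor>B\<rfloor> + 1)" by simp
  moreover have "0 \<le> \<lfloor>B\<rfloor>" using assms by simp
  ultimately show ?thesis using assms by simp linarith
qed

lemma in_int_interval: "real_of_int \<bar>a - b\<bar> \<le> B \<Longrightarrow> a \<in> {b - \<lfloor>B\<rfloor> .. b + \<lfloor>B\<rfloor>}"
proof -
  assume "real_of_int \<bar>a - b\<bar> \<le> B"
  then have "a - b \<le> \<lfloor>B\<rfloor>" "b - a \<le> \<lfloor>B\<rfloor>" by (simp_all add: le_floor_iff abs_le_iff)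
  then show ?thesis by simp
qed

lemma card_box_le:
  fixes S :: "('n::finite \<Rightarrow> int) set"
  assumes "1 \<le> B" "\<And>p q l. p \<in> S \<Longrightarrow> q \<in> S \<Longrightarrow> real_of_int \<bar>p l - q l\<bar> \<le> B"
  shows "real (card S) \<le> (3 * B) ^ CARD('n)"
proof (cases "S = {}")
  case False
  then obtain p where p: "p \<in> S" by blast
  let ?P = "PiE UNIV (\<lambda>l. {p l - \<lfloor>B\<rfloor> .. p l + \<lfloor>B\<rfloor>})"
  have "S \<subseteq> ?P"
  proof
    fix q assume "q \<in> S"
    then have "q l \<in> {p l - \<lfloor>B\<rfloor> .. p l + \<lfloor>B\<rfloor>}" for l using assms(2)[OF _ p] by (intro in_int_interval)
    then show "q \<in> ?P" by (simp add: PiE_UNIV_domain)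
  qed
  then have "card S \<le> card ?P" by (rule card_mono[rotated]) (auto intro: finite_PiE)
  then have "real (card S) \<le> (\<Prod>l\<in>(UNIV :: 'n set). real (card {p l - \<lfloor>B\<rfloor> .. p l + \<lfloor>B\<rfloor>}))"
    by (simp add: card_PiE flip: of_nat_prod)
  also have "\<dots> \<le> (\<Prod>l\<in>(UNIV :: 'n set). 3 * B)"
    by (intro prod_mono conjI card_int_interval_le assms(1)) simp
  finally show ?thesis by simp
qed (use assms(1) in simp)

text \<open>
The counting below eliminates one coordinate at a time: if a coordinate is determined up to an error \<open>B\<close> by the others,
deleting it costs a factor comparable to \<open>B\<close>.
\<close>

lemma card_forget_coordinate_le:
  fixes S :: "('n::finite \<Rightarrow> int) set"
  assumes "finite S" "1 \<le> B"
    and diff: "\<And>p q. p \<in> S \<Longrightarrow> q \<in> S \<Longrightarrow> (\<And>l. l \<noteq> i \<Longrightarrow> p l = q l) \<Longrightarrow> real_of_int \<bar>p i - q i\<bar> \<le> B"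
  shows "real (card S) \<le> 3 * B * real (card ((\<lambda>q. q(i := 0)) ` S))"
proof (rule card_le_mult_card_image[OF assms(1)])
  fix b assume "b \<in> (\<lambda>q. q(i := 0)) ` S"
  then obtain p where p: "p \<in> S" "b = p(i := 0)" by blast
  let ?F = "{a \<in> S. a(i := 0) = b}"
  have agree: "q l = p l" if "q \<in> ?F" "l \<noteq> i" for q l
    using that p(2) by (auto dest: fun_cong[of _ _ l])
  have "inj_on (\<lambda>q. q i) ?F"
  proof (rule inj_onI)
    fix q q' assume "q \<in> ?F" "q' \<in> ?F" "q i = q' i"
    then have "q l = q' l" for l using agree[of q l] agree[of q' l] by (cases "l = i") auto
    then show "q = q'" by blast
  qed
  moreover have "(\<lambda>q. q i) ` ?F \<subseteq> {p i - \<lfloor>B\<rfloor> .. p i + \<lfloor>B\<rfloor>}"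
    using diff[OF _ p(1)] agree by (auto simp del: atLeastAtMost_iff intro!: in_int_interval)
  ultimately have "card ?F \<le> card {p i - \<lfloor>B\<rfloor> .. p i + \<lfloor>B\<rfloor>}" by (rule card_inj_on_le) simp
  then show "real (card ?F) \<le> 3 * B" using card_int_interval_le[OF assms(2), of "p i"] by linarith
qed

lemma cell_diff_le:
  fixes x y :: "real^'n"
  assumes "\<bar>x $ l - y $ l\<bar> \<le> B * (1/2) ^ k" shows "real_of_int \<bar>cell k x l - cell k y l\<bar> \<le> B + 1"
proof -
  have "\<bar>2 ^ k * x $ l - 2 ^ k * y $ l\<bar> = 2 ^ k * \<bar>x $ l - y $ l\<bar>"
    by (metis abs_mult abs_numeral power_abs right_diff_distrib)
  also have "\<dots> \<le> 2 ^ k * (B * (1/2) ^ k)" using assms by (intro mult_left_mono) auto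
  also have "\<dots> = B" by (simp add: power_one_over)
  finally show ?thesis unfolding cell_def by linarith
qed

lemma abs_cell_le:
  fixes y :: "real^'n"
  assumes "norm y \<le> R" "1 \<le> R" shows "real_of_int \<bar>cell k y l\<bar> \<le> 2 * (2 ^ k * R)"
proof -
  have "\<bar>y $ l - 0 $ l\<bar> \<le> (2 ^ k * R) * (1/2) ^ k"
    using component_le_norm_cart[of y l] assms(1) by (simp add: power_one_over)
  from cell_diff_le[OF this] have "real_of_int \<bar>cell k y l\<bar> \<le> 2 ^ k * R + 1" by (simp add: cell_def)
  moreover have "1 * 1 \<le> 2 ^ k * R" using assms(2) by (intro mult_mono) auto
  ultimately show ?thesis by simp
qed

text \<open>
If the coordinates outside \<open>J\<close> barely move, an almost constant inner product is a constraint on those in \<open>J\<close>.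
\<close>

lemma inner_restrict_le:
  fixes a w :: "real^'n"
  assumes "\<And>l. l \<notin> J \<Longrightarrow> \<bar>a $ l\<bar> \<le> \<delta>" "\<And>l. \<bar>w $ l\<bar> \<le> M" "0 \<le> \<delta>"
  shows "\<bar>\<Sum>l\<in>J. a $ l * w $ l\<bar> \<le> \<bar>a \<bullet> w\<bar> + real CARD('n) * (\<delta> * M)"
proof -
  have M: "0 \<le> M" using assms(2)[of undefined] abs_ge_zero order_trans by blast
  have "a \<bullet> w = (\<Sum>l\<in>J. a $ l * w $ l) + (\<Sum>l\<in>-J. a $ l * w $ l)"
    using sum.union_disjoint[of J "-J" "\<lambda>l. a $ l * w $ l"] by (simp add: inner_vec_def Compl_partition)
  moreover have "\<bar>\<Sum>l\<in>-J. a $ l * w $ l\<bar> \<le> real CARD('n) * (\<delta> * M)"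
  proof -
    have "\<bar>\<Sum>l\<in>-J. a $ l * w $ l\<bar> \<le> (\<Sum>l\<in>-J. \<bar>a $ l * w $ l\<bar>)" by (rule sum_abs)
    also have "\<dots> \<le> (\<Sum>l\<in>-J. \<delta> * M)" using assms M by (intro sum_mono) (auto simp: abs_mult intro!: mult_mono)
    also have "\<dots> \<le> real CARD('n) * (\<delta> * M)"
      using assms(3) M by (simp add: card_mono mult_right_mono)
    finally show ?thesis .
  qed
  ultimately show ?thesis by linarith
qed


text \<open>
Let \<open>\<delta> = 2^(-k)\<close>. The hypothesis \<open>e1\<close> confines \<open>Y\<close> to a thin slab orthogonal to \<open>v\<close>, a vector with dominant coordinate \<open>i\<close>, and \<open>e2\<close>
confines it to a thin annulus around \<open>x\<close>. The slab determines coordinate \<open>i\<close> from the other ones. If all coordinates except \<open>i\<close> and \<open>j\<close> are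
fixed, movement in the slab is along \<open>u = e_j - (v_j/v_i) e_i\<close>, up to errors of size \<open>\<delta>/c\<close>, and the squared radius changes
along \<open>u\<close> at the rate \<open>2 (y - x) \<bullet> u\<close>. The hypothesis \<open>far\<close> says that the average of this rate over two points of \<open>Y\<close> has absolute
value at least \<open>h\<close>, so coordinate \<open>j\<close> is determined up to \<open>\<delta>/(c h)\<close>. The remaining \<open>d - 2\<close> coordinates are free.
\<close>

lemma card_cells_transversal_le:
  fixes Y :: "(real^'n) set" and v x :: "real^'n"
  assumes ij: "i \<noteq> j" and R: "1 \<le> R" and E: "0 \<le> E" and c: "0 < c" "c \<le> 1" "c \<le> \<bar>v $ i\<bar>" "\<bar>v $ i\<bar> \<le> 2 * R"
    and vmax: "\<And>l. \<bar>v $ l\<bar> \<le> \<bar>v $ i\<bar>"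
    and Y: "\<And>y. y \<in> Y \<Longrightarrow> norm y \<le> R" "norm x \<le> R"
    and e1: "\<And>y y'. y \<in> Y \<Longrightarrow> y' \<in> Y \<Longrightarrow> \<bar>(y - y') \<bullet> v\<bar> \<le> E * (1/2) ^ k"
    and e2: "\<And>y y'. y \<in> Y \<Longrightarrow> y' \<in> Y \<Longrightarrow> \<bar>(norm (y - x))\<^sup>2 - (norm (y' - x))\<^sup>2\<bar> \<le> E * (1/2) ^ k"
    and h: "0 < h" "h \<le> 1"
    and far: "\<And>y y'. y \<in> Y \<Longrightarrow> y' \<in> Y \<Longrightarrow>
        h \<le> \<bar>((y - x) $ j - v $ j / v $ i * (y - x) $ i) + ((y' - x) $ j - v $ j / v $ i * (y' - x) $ i)\<bar>"
  shows "real (card (cell k ` Y)) \<le> 180 * R * (E + 4 * R * real CARD('n))\<^sup>2 * (5 * R) ^ (CARD('n) - 2)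
            * (2 ^ k) ^ (CARD('n) - 2) / (c\<^sup>2 * h)"
proof -
  define d where "d = real CARD('n)"
  define M where "M = E + 4 * R * d"
  define \<delta> :: real where "\<delta> = (1/2) ^ k"
  have d: "1 \<le> d" by (simp add: d_def Suc_leI)
  have \<delta>: "0 < \<delta>" by (simp add: \<delta>_def)
  have "1 * 1 \<le> R * d" using R d by (intro mult_mono) auto
  then have M: "1 \<le> M" "E + 2 * R * d \<le> M" using E by (auto simp: M_def)
  define B0 where "B0 = M / c"
  have B0: "1 \<le> B0" using M(1) c by (simp add: B0_def le_divide_eq)
  define B1 where "B1 = 5 * R * M / (c * h)"
  have "c * h \<le> 1 * 1" using c h by (intro mult_mono) auto
  moreover have "1 * 1 \<le> R * M" using R M(1) by (intro mult_mono) auto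
  ultimately have B1: "1 \<le> B1" using c h by (simp add: B1_def le_divide_eq)
  have vi: "v $ i \<noteq> 0" using c by auto
  have bounded_Y: "bounded Y" using Y(1) unfolding bounded_iff by blast
  \<comment> \<open>the slab, as a constraint on the coordinates in \<open>J\<close>\<close>
  have lin: "\<bar>\<Sum>l\<in>J. (y - y') $ l * v $ l\<bar> \<le> M * \<delta>"
    if "y \<in> Y" "y' \<in> Y" "\<And>l. l \<notin> J \<Longrightarrow> cell k y l = cell k y' l" for y y' J
  proof -
    have "\<bar>\<Sum>l\<in>J. (y - y') $ l * v $ l\<bar> \<le> \<bar>(y - y') \<bullet> v\<bar> + real CARD('n) * (\<delta> * (2 * R))"
    proof (rule inner_restrict_le)
      show "\<bar>(y - y') $ l\<bar> \<le> \<delta>" if "l \<notin> J" for l unfolding \<delta>_def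
        by (rule same_cell_coordinate) (use that \<open>\<And>l. l \<notin> J \<Longrightarrow> cell k y l = cell k y' l\<close> in blast)
      show "\<bar>v $ l\<bar> \<le> 2 * R" for l using vmax[of l] c(4) by linarith
    qed (use \<delta> in simp)
    also have "\<dots> \<le> E * \<delta> + real CARD('n) * (\<delta> * (2 * R))" using e1[OF that(1,2)] by (simp add: \<delta>_def)
    also have "\<dots> = (E + 2 * R * d) * \<delta>" by (simp add: d_def algebra_simps)
    also have "\<dots> \<le> M * \<delta>" using M(2) \<delta> by (intro mult_right_mono) auto
    finally show ?thesis .
  qed
  \<comment> \<open>the annulus in the same form, because a difference of two squared norms is the inner product of difference and sum\<close>
  have quad: "\<bar>\<Sum>l\<in>J. (y - y') $ l * ((y - x) + (y' - x)) $ l\<bar> \<le> M * \<delta>"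
    if "y \<in> Y" "y' \<in> Y" "\<And>l. l \<notin> J \<Longrightarrow> cell k y l = cell k y' l" for y y' J
  proof -
    have "\<bar>\<Sum>l\<in>J. (y - y') $ l * ((y - x) + (y' - x)) $ l\<bar> \<le> \<bar>(y - y') \<bullet> ((y - x) + (y' - x))\<bar> + real CARD('n) * (\<delta> * (4 * R))"
    proof (rule inner_restrict_le)
      show "\<bar>(y - y') $ l\<bar> \<le> \<delta>" if "l \<notin> J" for l unfolding \<delta>_def
        by (rule same_cell_coordinate) (use that \<open>\<And>l. l \<notin> J \<Longrightarrow> cell k y l = cell k y' l\<close> in blast)
      show "\<bar>((y - x) + (y' - x)) $ l\<bar> \<le> 4 * R" for l
        using component_le_norm_cart[of y l] component_le_norm_cart[of y' l] component_le_norm_cart[of x l]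
          Y(1)[OF that(1)] Y(1)[OF that(2)] Y(2) by simp
    qed (use \<delta> in simp)
    also have "(y - y') \<bullet> ((y - x) + (y' - x)) = (norm (y - x))\<^sup>2 - (norm (y' - x))\<^sup>2"
    proof -
      have "(a - b) \<bullet> (a + b) = (norm a)\<^sup>2 - (norm b)\<^sup>2" for a b :: "real^'n"
        by (simp add: power2_norm_eq_inner inner_diff_left inner_add_right inner_commute[of b a])
      from this[of "y - x" "y' - x"] show ?thesis by simp
    qed
    also have "\<bar>(norm (y - x))\<^sup>2 - (norm (y' - x))\<^sup>2\<bar> + real CARD('n) * (\<delta> * (4 * R)) \<le> E * \<delta> + real CARD('n) * (\<delta> * (4 * R))"
      using e2[OF that(1,2)] by (simp add: \<delta>_def)
    also have "\<dots> = M * \<delta>" by (simp add: M_def d_def algebra_simps)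
    finally show ?thesis .
  qed
  let ?S = "cell k ` Y"
  let ?fi = "\<lambda>q :: 'n \<Rightarrow> int. q(i := 0)" and ?fj = "\<lambda>q :: 'n \<Rightarrow> int. q(j := 0)"
  have fin: "finite ?S" by (rule finite_cells_bounded[OF bounded_Y])
  have step_i: "real (card ?S) \<le> 3 * (2 * B0) * real (card (?fi ` ?S))"
  proof (rule card_forget_coordinate_le[OF fin])
    fix p q assume pq: "p \<in> ?S" "q \<in> ?S" "\<And>l. l \<noteq> i \<Longrightarrow> p l = q l"
    then obtain y y' where y: "y \<in> Y" "y' \<in> Y" "p = cell k y" "q = cell k y'" by blast
    have "\<bar>(y - y') $ i * v $ i\<bar> \<le> M * \<delta>" using lin[OF y(1,2), of "{i}"] pq(3) y(3,4) by simp
    then have "\<bar>(y - y') $ i\<bar> * \<bar>v $ i\<bar> \<le> M * \<delta>" by (simp add: abs_mult)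
    moreover have "\<bar>(y - y') $ i\<bar> * c \<le> \<bar>(y - y') $ i\<bar> * \<bar>v $ i\<bar>" using c(3) by (intro mult_left_mono) auto
    ultimately have "\<bar>(y - y') $ i\<bar> * c \<le> M * \<delta>" by linarith
    then have "\<bar>y $ i - y' $ i\<bar> \<le> B0 * (1/2) ^ k" using c(1) by (simp add: B0_def \<delta>_def field_simps)
    from cell_diff_le[OF this] show "real_of_int \<bar>p i - q i\<bar> \<le> 2 * B0" using y(3,4) B0 by simp
  qed (use B0 in simp)
  have step_j: "real (card (?fi ` ?S)) \<le> 3 * (2 * B1) * real (card (?fj ` ?fi ` ?S))"
  proof (rule card_forget_coordinate_le)
    fix p q assume pq: "p \<in> ?fi ` ?S" "q \<in> ?fi ` ?S" "\<And>l. l \<noteq> j \<Longrightarrow> p l = q l"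
    then obtain y y' where y: "y \<in> Y" "y' \<in> Y" "p = ?fi (cell k y)" "q = ?fi (cell k y')" by blast
    have same: "cell k y l = cell k y' l" if "l \<notin> {i, j}" for l using pq(3)[of l] y(3,4) that by simp
    let ?a = "(y - y') $ i" and ?b = "(y - y') $ j"
    define si sj where "si = ((y - x) + (y' - x)) $ i" and "sj = ((y - x) + (y' - x)) $ j"
    have l: "\<bar>?a * v $ i + ?b * v $ j\<bar> \<le> M * \<delta>" using lin[OF y(1,2), of "{i, j}"] same ij by simp
    have q: "\<bar>?a * si + ?b * sj\<bar> \<le> M * \<delta>" using quad[OF y(1,2), of "{i, j}"] same ij by (simp add: si_def sj_def)
    have s: "\<bar>si\<bar> \<le> 4 * R" unfolding si_def
      using component_le_norm_cart[of y i] component_le_norm_cart[of y' i] component_le_norm_cart[of x i]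
          Y(1)[OF y(1)] Y(1)[OF y(2)] Y(2) by simp
    \<comment> \<open>Eliminating the displacement \<open>?a\<close> in coordinate \<open>i\<close> leaves the displacement \<open>?b\<close> times the transversality that \<open>far\<close> bounds below.\<close>
    have "?b * (sj - v $ j / v $ i * si) = (?a * si + ?b * sj) - (si / v $ i) * (?a * v $ i + ?b * v $ j)"
      using vi by (simp add: field_simps)
    then have "\<bar>?b * (sj - v $ j / v $ i * si)\<bar> \<le> \<bar>?a * si + ?b * sj\<bar> + \<bar>(si / v $ i) * (?a * v $ i + ?b * v $ j)\<bar>"
      using abs_triangle_ineq4[of "?a * si + ?b * sj" "(si / v $ i) * (?a * v $ i + ?b * v $ j)"] by (simp only:)
    also have "\<dots> \<le> M * \<delta> + (4 * R / c) * (M * \<delta>)"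
    proof (rule add_mono[OF q])
      have "\<bar>si / v $ i\<bar> \<le> 4 * R / c" using s c R unfolding abs_divide by (intro frac_le) auto
      then show "\<bar>(si / v $ i) * (?a * v $ i + ?b * v $ j)\<bar> \<le> (4 * R / c) * (M * \<delta>)"
        unfolding abs_mult[of "si / v $ i"] using l R c by (intro mult_mono) auto
    qed
    also have "\<dots> \<le> 5 * R / c * (M * \<delta>)"
    proof -
      have "1 \<le> R / c" using R c by (simp add: le_divide_eq)
      then have le: "1 * (M * \<delta>) \<le> R / c * (M * \<delta>)" using M(1) \<delta> by (intro mult_right_mono) auto
      have eq: "4 * R / c * (M * \<delta>) = 4 * (R / c * (M * \<delta>))" "5 * R / c * (M * \<delta>) = 5 * (R / c * (M * \<delta>))" by simp_all
      have "a + 4 * b \<le> 5 * b" if "1 * a \<le> b" for a b :: real using that by simp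
      from this[OF le] show ?thesis unfolding eq .
    qed
    finally have up: "\<bar>?b\<bar> * \<bar>sj - v $ j / v $ i * si\<bar> \<le> 5 * R / c * (M * \<delta>)" by (simp add: abs_mult)
    have "h \<le> \<bar>sj - v $ j / v $ i * si\<bar>"
    proof -
      have "(a - r * b) + (a' - r * b') = (a + a') - r * (b + b')" for a b a' b' r :: real by (simp add: algebra_simps)
      then show ?thesis using far[OF y(1,2)] by (simp only: si_def sj_def vector_add_component)
    qed
    then have "\<bar>?b\<bar> * h \<le> \<bar>?b\<bar> * \<bar>sj - v $ j / v $ i * si\<bar>" by (intro mult_left_mono) auto
    with up have "\<bar>?b\<bar> * h \<le> 5 * R / c * (M * \<delta>)" by linarith
    then have "\<bar>y $ j - y' $ j\<bar> \<le> B1 * (1/2) ^ k" using h c by (simp add: B1_def \<delta>_def field_simps)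
    from cell_diff_le[OF this] show "real_of_int \<bar>p j - q j\<bar> \<le> 2 * B1" using y(3,4) B1 ij by simp
  qed (use B1 fin in auto)
  have step_rest: "real (card (?fj ` ?fi ` ?S)) \<le> (5 * (2 ^ k * R)) ^ (CARD('n) - 2)"
  proof -
    let ?N = "\<lfloor>2 * (2 ^ k * R)\<rfloor>"
    let ?P = "PiE UNIV (\<lambda>l. if l \<in> {i, j} then {0} else {0 - ?N..0 + ?N})"
    have "?fj ` ?fi ` ?S \<subseteq> ?P"
    proof
      fix q assume "q \<in> ?fj ` ?fi ` ?S"
      then obtain y where y: "y \<in> Y" "q = ?fj (?fi (cell k y))" by blast
      have "cell k y l \<in> {0 - ?N..0 + ?N}" for l
        using abs_cell_le[OF Y(1)[OF y(1)] R, of k l] by (intro in_int_interval) simp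
      then show "q \<in> ?P" unfolding y(2) by (simp add: PiE_UNIV_domain)
    qed
    then have "card (?fj ` ?fi ` ?S) \<le> card ?P" by (rule card_mono[rotated]) (auto intro!: finite_PiE)
    also have "card ?P = (\<Prod>l\<in>UNIV. card (if l \<in> {i, j} then {0} else {0 - ?N..0 + ?N}))" by (simp add: card_PiE)
    also have "\<dots> = (\<Prod>l\<in>- {i, j}. card {0 - ?N..0 + ?N})"
      by (rule prod.mono_neutral_cong_right) auto
    also have "\<dots> = card {0 - ?N..0 + ?N} ^ (CARD('n) - 2)"
    proof -
      have "card (- {i, j}) = CARD('n) - 2" using ij by (simp add: Compl_eq_Diff_UNIV card_Diff_subset)
      then show ?thesis by (simp only: prod_constant)
    qed
    finally have "real (card (?fj ` ?fi ` ?S)) \<le> real (card {0 - ?N..0 + ?N}) ^ (CARD('n) - 2)"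
      by (simp flip: of_nat_power)
    also have "\<dots> \<le> (5 * (2 ^ k * R)) ^ (CARD('n) - 2)"
    proof (rule power_mono)
      have "1 * 1 \<le> 2 ^ k * R" using R by (intro mult_mono) auto
      then show "real (card {0 - ?N..0 + ?N}) \<le> 5 * (2 ^ k * R)" by simp linarith
    qed simp
    finally show ?thesis .
  qed
  have "real (card ?S) \<le> 3 * (2 * B0) * (3 * (2 * B1) * (5 * (2 ^ k * R)) ^ (CARD('n) - 2))"
  proof -
    have "real (card ?S) \<le> 3 * (2 * B0) * real (card (?fi ` ?S))" by (rule step_i)
    also have "\<dots> \<le> 3 * (2 * B0) * (3 * (2 * B1) * real (card (?fj ` ?fi ` ?S)))"
      using B0 step_j by (intro mult_left_mono) auto
    also have "\<dots> \<le> 3 * (2 * B0) * (3 * (2 * B1) * (5 * (2 ^ k * R)) ^ (CARD('n) - 2))"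
      using B0 B1 step_rest by (intro mult_left_mono) auto
    finally show ?thesis .
  qed
  also have "\<dots> = 180 * R * M\<^sup>2 * (5 * R) ^ (CARD('n) - 2) * (2 ^ k) ^ (CARD('n) - 2) / (c\<^sup>2 * h)"
    using c h by (simp add: B0_def B1_def power_mult_distrib power2_eq_square field_simps)
  finally show ?thesis by (simp add: M_def d_def)
qed

lemma abs_diff_le_of_slope:
  fixes r :: real
  assumes "\<bar>r\<bar> \<le> 1" "\<bar>b - b'\<bar> \<le> D" "\<bar>a - r * b\<bar> \<le> \<delta>" "\<bar>a' - r * b'\<bar> \<le> \<delta>"
  shows "\<bar>a - a'\<bar> \<le> 2 * \<delta> + D"
proof -
  have "\<bar>r * (b - b')\<bar> \<le> 1 * D" unfolding abs_mult using assms(1,2) by (intro mult_mono) auto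
  then have "\<bar>r * b - r * b'\<bar> \<le> D" by (simp add: right_diff_distrib)
  then show ?thesis using assms(3,4) by linarith
qed

text \<open>
Near the line \<open>x + \<real> v\<close> the dominant coordinate determines all others, as the slopes \<open>v_l/v_i\<close> are at most 1.
\<close>

lemma card_cells_near_line_le:
  fixes Y :: "(real^'n) set" and v x :: "real^'n"
  assumes R: "1 \<le> R" and Y: "\<And>y. y \<in> Y \<Longrightarrow> norm y \<le> R" and vi: "v $ i \<noteq> 0"
    and vmax: "\<And>l. \<bar>v $ l\<bar> \<le> \<bar>v $ i\<bar>"
    and near: "\<And>y l. y \<in> Y \<Longrightarrow> \<bar>(y - x) $ l - v $ l / v $ i * (y - x) $ i\<bar> \<le> (1/2) ^ k"
  shows "real (card (cell k ` Y)) \<le> 12 ^ CARD('n) * (6 * (2 ^ k * R))"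
proof -
  have bounded_Y: "bounded Y" using Y(1) unfolding bounded_iff by blast
  have fin: "finite (cell k ` Y)" by (rule finite_cells_bounded[OF bounded_Y])
  have "real (card (cell k ` Y)) \<le> 12 ^ CARD('n) * real (card ((\<lambda>q. q i) ` cell k ` Y))"
  proof (rule card_le_mult_card_image[OF fin])
    fix b assume "b \<in> (\<lambda>q. q i) ` cell k ` Y"
    have "real (card {a \<in> cell k ` Y. a i = b}) \<le> (3 * 4) ^ CARD('n)"
    proof (rule card_box_le)
      fix p q l assume "p \<in> {a \<in> cell k ` Y. a i = b}" "q \<in> {a \<in> cell k ` Y. a i = b}"
      then obtain y y' where y: "y \<in> Y" "y' \<in> Y" "p = cell k y" "q = cell k y'" "cell k y i = cell k y' i" by auto
      have r: "\<bar>v $ l / v $ i\<bar> \<le> 1" using vmax[of l] vi by (simp add: abs_divide divide_le_eq_1)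
      have "\<bar>(y - x) $ i - (y' - x) $ i\<bar> \<le> (1/2) ^ k" using same_cell_coordinate[OF y(5)] by simp
      from abs_diff_le_of_slope[OF r this near[OF y(1)] near[OF y(2)]]
      have "\<bar>y $ l - y' $ l\<bar> \<le> 3 * (1/2) ^ k" by simp
      from cell_diff_le[OF this] show "real_of_int \<bar>p l - q l\<bar> \<le> 4" using y(3,4) by simp
    qed simp
    then show "real (card {a \<in> cell k ` Y. a i = b}) \<le> 12 ^ CARD('n)" by simp
  qed
  moreover have "real (card ((\<lambda>q. q i) ` cell k ` Y)) \<le> 6 * (2 ^ k * R)"
  proof -
    let ?N = "\<lfloor>2 * (2 ^ k * R)\<rfloor>"
    have one: "1 * 1 \<le> 2 ^ k * R" using R by (intro mult_mono) auto
    have "(\<lambda>q. q i) ` cell k ` Y \<subseteq> {0 - ?N..0 + ?N}"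
    proof
      fix b assume "b \<in> (\<lambda>q. q i) ` cell k ` Y"
      then obtain y where y: "y \<in> Y" "b = cell k y i" by blast
      show "b \<in> {0 - ?N..0 + ?N}" using abs_cell_le[OF Y(1)[OF y(1)] R, of k i] y(2) by (intro in_int_interval) simp
    qed
    then have "card ((\<lambda>q. q i) ` cell k ` Y) \<le> card {0 - ?N..0 + ?N}" by (rule card_mono[rotated]) simp
    then show ?thesis using card_int_interval_le[of "2 * (2 ^ k * R)" 0] one by simp
  qed
  ultimately show ?thesis by (meson mult_left_mono order_trans zero_le_numeral zero_le_power)
qed

text \<open>
A sphere around \<open>x\<close> meets the line \<open>x + \<real> v\<close> in two points, one on each side of \<open>x\<close>. On either side the radius determines the
dominant coordinate, and hence the whole point, up to a bounded multiple of the side of a cube.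
\<close>

lemma card_cells_near_pole_le:
  fixes Y :: "(real^'n) set" and v x :: "real^'n"
  assumes bounded_Y: "bounded Y" and vi: "v $ i \<noteq> 0" and a: "0 \<le> a"
    and vmax: "\<And>l. \<bar>v $ l\<bar> \<le> \<bar>v $ i\<bar>"
    and near: "\<And>y l. y \<in> Y \<Longrightarrow> \<bar>(y - x) $ l - v $ l / v $ i * (y - x) $ i\<bar> \<le> (1/2) ^ k"
    and rad: "\<And>y. y \<in> Y \<Longrightarrow> \<bar>norm (y - x) - t\<bar> \<le> a * (1/2) ^ k"
  shows "real (card (cell k ` Y)) \<le> 2 * (3 * (2 * (real CARD('n) + a) + 3)) ^ CARD('n)"
proof -
  define d where "d = real CARD('n)"
  have half: "real (card (cell k ` Z)) \<le> (3 * (2 * (d + a) + 3)) ^ CARD('n)"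
    if Z: "Z \<subseteq> Y" "\<And>y y'. y \<in> Z \<Longrightarrow> y' \<in> Z \<Longrightarrow> 0 \<le> (y - x) $ i * (y' - x) $ i" for Z
  proof (rule card_box_le)
    show "1 \<le> 2 * (d + a) + 3" using a by (simp add: d_def)
    fix p q l assume "p \<in> cell k ` Z" "q \<in> cell k ` Z"
    then obtain y y' where y: "y \<in> Z" "y' \<in> Z" "p = cell k y" "q = cell k y'" by blast
    have len: "\<bar>norm (((z - x) $ i / v $ i) *\<^sub>R v) - t\<bar> \<le> (d + a) * (1/2) ^ k" if "z \<in> Z" for z
    proof -
      have "norm ((z - x) - ((z - x) $ i / v $ i) *\<^sub>R v) \<le> (\<Sum>l\<in>UNIV. \<bar>((z - x) - ((z - x) $ i / v $ i) *\<^sub>R v) $ l\<bar>)"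
        by (rule norm_le_l1_cart)
      also have "\<dots> \<le> (\<Sum>l\<in>(UNIV :: 'n set). (1/2) ^ k)"
        using near[of z] that Z(1) by (intro sum_mono) (auto simp: mult.commute)
      also have "\<dots> = d * (1/2) ^ k" by (simp add: d_def)
      finally have "\<bar>norm (z - x) - norm (((z - x) $ i / v $ i) *\<^sub>R v)\<bar> \<le> d * (1/2) ^ k"
        using norm_triangle_ineq3[of "z - x" "((z - x) $ i / v $ i) *\<^sub>R v"] by linarith
      moreover have "z \<in> Y" using that Z(1) by blast
      ultimately show ?thesis using rad[of z] by (simp add: distrib_right)
    qed
    define r where "r = norm v / \<bar>v $ i\<bar>"
    have r: "1 \<le> r" using component_le_norm_cart[of v i] vi by (simp add: r_def le_divide_eq)
    have nr: "norm (((z - x) $ i / v $ i) *\<^sub>R v) = \<bar>(z - x) $ i\<bar> * r" for z by (simp add: r_def abs_divide)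
    have "\<bar>(y - x) $ i - (y' - x) $ i\<bar> = \<bar>\<bar>(y - x) $ i\<bar> - \<bar>(y' - x) $ i\<bar>\<bar>"
      using Z(2)[OF y(1,2)] by (auto simp: abs_if zero_le_mult_iff)
    then have "\<bar>(y - x) $ i - (y' - x) $ i\<bar> * 1 \<le> \<bar>\<bar>(y - x) $ i\<bar> - \<bar>(y' - x) $ i\<bar>\<bar> * r"
      using r by (simp add: mult_le_cancel_left1)
    also have "\<dots> = \<bar>\<bar>(y - x) $ i\<bar> * r - \<bar>(y' - x) $ i\<bar> * r\<bar>"
      using r by (simp add: abs_mult flip: left_diff_distrib)
    also have "\<dots> \<le> 2 * (d + a) * (1/2) ^ k" using len[OF y(1)] len[OF y(2)] unfolding nr by linarith
    finally have i: "\<bar>(y - x) $ i - (y' - x) $ i\<bar> \<le> 2 * (d + a) * (1/2) ^ k" by simp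
    have r: "\<bar>v $ l / v $ i\<bar> \<le> 1" using vmax[of l] vi by (simp add: abs_divide divide_le_eq_1)
    have "y \<in> Y" "y' \<in> Y" using y Z(1) by auto
    from abs_diff_le_of_slope[OF r i near[OF this(1)] near[OF this(2)]]
    have "\<bar>y $ l - y' $ l\<bar> \<le> 2 * (1/2) ^ k + 2 * (d + a) * (1/2) ^ k" by simp
    then have "\<bar>y $ l - y' $ l\<bar> \<le> (2 * (d + a) + 2) * (1/2) ^ k" by (simp add: algebra_simps)
    from cell_diff_le[OF this] show "real_of_int \<bar>p l - q l\<bar> \<le> 2 * (d + a) + 3" using y(3,4) by simp
  qed
  let ?Z1 = "{y \<in> Y. 0 \<le> (y - x) $ i}" and ?Z2 = "{y \<in> Y. (y - x) $ i \<le> 0}"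
  have "Y = ?Z1 \<union> ?Z2" by auto
  then have "cell k ` Y = cell k ` ?Z1 \<union> cell k ` ?Z2" by (metis image_Un)
  then have "card (cell k ` Y) \<le> card (cell k ` ?Z1) + card (cell k ` ?Z2)" by (simp add: card_Un_le)
  moreover have "real (card (cell k ` ?Z1)) \<le> (3 * (2 * (d + a) + 3)) ^ CARD('n)"
    by (rule half) (auto simp: zero_le_mult_iff)
  moreover have "real (card (cell k ` ?Z2)) \<le> (3 * (2 * (d + a) + 3)) ^ CARD('n)"
    by (rule half) (auto simp: zero_le_mult_iff)
  ultimately show ?thesis by (simp add: d_def)
qed

section \<open>The mass of intersections of annuli\<close>

text \<open>
The part of \<open>K\<close> in a union of annuli around \<open>x\<close>, rounded up to whole cubes whose side is the width of the annuli.
\<close>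

definition annuli_cells :: "nat \<Rightarrow> (real^'n) set \<Rightarrow> real^'n \<Rightarrow> real set \<Rightarrow> ('n \<Rightarrow> int) set" where
  "annuli_cells k K x T = cell k ` {y \<in> K. \<exists>t\<in>T. \<bar>dist x y - t\<bar> < (1/2) ^ k}"

lemma frostman_mass_nonneg: "frostman_mass s K L \<Longrightarrow> 0 \<le> L k q"
  and frostman_mass_le: "frostman_mass s K L \<Longrightarrow> L k q \<le> 2 powr (- s * real k)"
  by (auto simp: frostman_mass_def)

lemma frostman_mass_sum_le_card:
  assumes "frostman_mass s K L"
  shows "(\<Sum>q\<in>S. L k q) \<le> real (card S) * 2 powr (- s * real k)"
  using sum_bounded_above[of S "L k" "2 powr (- s * real k)"] frostman_mass_le[OF assms] by simp

text \<open>
The ancestor of a cube that meets \<open>Z\<close> meets \<open>Z\<close> as well, and its mass includes that of the smaller cube.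
\<close>

lemma frostman_mass_coarsen:
  assumes "frostman_mass s K L" "bounded K" "j \<le> k" "Z \<subseteq> K"
  shows "(\<Sum>q\<in>cell k ` Z. L k q) \<le> (\<Sum>q\<in>cell j ` Z. L j q)"
proof -
  have "(\<Sum>q\<in>cell j ` Z. L j q) = (\<Sum>q | q \<in> cell k ` K \<and> ancestor j k q \<in> cell j ` Z. L k q)"
    by (rule frostman_mass_ancestors[OF assms(1-3)]) (use assms(4) in blast)
  moreover have "(\<Sum>q\<in>cell k ` Z. L k q) \<le> (\<Sum>q | q \<in> cell k ` K \<and> ancestor j k q \<in> cell j ` Z. L k q)"
  proof (rule sum_mono2)
    show "finite {q \<in> cell k ` K. ancestor j k q \<in> cell j ` Z}" using finite_cells_bounded[OF assms(2)] by simp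
    show "cell k ` Z \<subseteq> {q \<in> cell k ` K. ancestor j k q \<in> cell j ` Z}"
      using assms(3,4) by (auto simp: ancestor_cell)
  qed (rule frostman_mass_nonneg[OF assms(1)])
  ultimately show ?thesis by simp
qed

lemma diff_squares_le:
  fixes a b :: real
  assumes "\<bar>a - t\<bar> \<le> e" "\<bar>b - t\<bar> \<le> e" "0 \<le> a" "a \<le> M" "0 \<le> b" "b \<le> M"
  shows "\<bar>a\<^sup>2 - b\<^sup>2\<bar> \<le> 4 * M * e"
proof -
  have "a\<^sup>2 - b\<^sup>2 = (a - b) * (a + b)" by (simp add: power2_eq_square algebra_simps)
  then have "\<bar>a\<^sup>2 - b\<^sup>2\<bar> = \<bar>a - b\<bar> * \<bar>a + b\<bar>" by (simp add: abs_mult)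
  also have "\<dots> \<le> (2 * e) * (2 * M)" using assms by (intro mult_mono) auto
  finally show ?thesis by (simp add: mult_ac)
qed

lemma largest_coordinate:
  fixes v :: "real^'n"
  obtains i where "\<And>l. \<bar>v $ l\<bar> \<le> \<bar>v $ i\<bar>" "norm v \<le> real CARD('n) * \<bar>v $ i\<bar>"
proof -
  obtain i where i: "\<bar>v $ i\<bar> = Max (range (\<lambda>l. \<bar>v $ l\<bar>))"
    using Max_in[of "range (\<lambda>l. \<bar>v $ l\<bar>)"] by (metis (mono_tags, lifting) finite finite_imageI image_iff image_is_empty UNIV_not_empty)
  have max: "\<bar>v $ l\<bar> \<le> \<bar>v $ i\<bar>" for l unfolding i by (rule Max_ge) auto
  have "norm v \<le> (\<Sum>l\<in>UNIV. \<bar>v $ l\<bar>)" by (rule norm_le_l1_cart)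
  also have "\<dots> \<le> (\<Sum>l\<in>(UNIV :: 'n set). \<bar>v $ i\<bar>)" by (intro sum_mono max)
  finally show thesis using that[OF max] by simp
qed

text \<open>
By \<open>2 (y - x) \<bullet> (x' - x) = |y - x|^2 - |y - x'|^2 + |x' - x|^2\<close>, two annuli of width \<open>\<delta>\<close> confine \<open>y\<close> to a
slab and an annulus. The sign \<open>\<sigma>\<close> selects one side of the line through the pins, and on one side the transversality at two
points does not cancel.
\<close>

lemma card_cells_two_annuli_le:
  fixes K :: "(real^'n) set" and x x' :: "real^'n" and R \<rho> \<sigma> t t' :: real and j k :: nat
  defines "d \<equiv> real CARD('n)"
  defines "E \<equiv> 8 * R * (d + 2)"
  assumes R: "1 \<le> R" and x: "norm x \<le> R" "norm x' \<le> R" and \<rho>: "0 < \<rho>" "\<rho> \<le> 1" "\<rho> \<le> dist x x'"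
    and K: "\<And>y. y \<in> K \<Longrightarrow> norm y \<le> R"
    and i: "\<And>l. \<bar>(x' - x) $ l\<bar> \<le> \<bar>(x' - x) $ i\<bar>" "norm (x' - x) \<le> d * \<bar>(x' - x) $ i\<bar>" "i \<noteq> l"
    and \<sigma>: "\<sigma> = 1 \<or> \<sigma> = - 1"
  shows "real (card (cell k ` {y \<in> K. \<bar>dist x y - t\<bar> \<le> (1/2) ^ k \<and> \<bar>dist x' y - t'\<bar> \<le> (d + 1) * (1/2) ^ k \<and>
      (1/2) ^ j \<le> \<sigma> * ((y - x) $ l - (x' - x) $ l / (x' - x) $ i * (y - x) $ i)}))
    \<le> 180 * R * (E + 4 * R * d)\<^sup>2 * (5 * R) ^ (CARD('n) - 2) * d\<^sup>2 * ((2 ^ k) ^ (CARD('n) - 2) * 2 ^ j / \<rho>\<^sup>2)"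
    (is "real (card (cell k ` ?Y)) \<le> _")
proof -
  let ?v = "x' - x"
  have d: "1 \<le> d" by (simp add: d_def Suc_leI)
  have dist_le: "dist z y \<le> 2 * R" if "norm z \<le> R" "y \<in> ?Y" for y z
  proof -
    have "dist z y \<le> norm z + norm y" unfolding dist_norm by (rule norm_triangle_ineq4)
    then show ?thesis using that K[of y] by simp
  qed
  have q1: "\<bar>(norm (y - x))\<^sup>2 - (norm (y' - x))\<^sup>2\<bar> \<le> 8 * R * (1/2) ^ k" if y: "y \<in> ?Y" "y' \<in> ?Y" for y y'
  proof -
    have "\<bar>(dist x y)\<^sup>2 - (dist x y')\<^sup>2\<bar> \<le> 4 * (2 * R) * (1/2) ^ k"
      using y by (intro diff_squares_le[of _ t] dist_le x) auto
    then show ?thesis by (simp add: dist_norm norm_minus_commute)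
  qed
  have q2: "\<bar>(norm (y - x'))\<^sup>2 - (norm (y' - x'))\<^sup>2\<bar> \<le> 8 * R * (d + 1) * (1/2) ^ k" if y: "y \<in> ?Y" "y' \<in> ?Y" for y y'
  proof -
    have "\<bar>(dist x' y)\<^sup>2 - (dist x' y')\<^sup>2\<bar> \<le> 4 * (2 * R) * ((d + 1) * (1/2) ^ k)"
      using y by (intro diff_squares_le[of _ t'] dist_le x) auto
    then show ?thesis by (simp add: dist_norm norm_minus_commute)
  qed
  have card: "real (card (cell k ` ?Y)) \<le> 180 * R * (E + 4 * R * real CARD('n))\<^sup>2 * (5 * R) ^ (CARD('n) - 2)
            * (2 ^ k) ^ (CARD('n) - 2) / ((\<rho> / d)\<^sup>2 * (1/2) ^ j)"
  proof (rule card_cells_transversal_le[OF i(3) R, where v = "?v" and x = x])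
    show "0 \<le> E" using R d by (simp add: E_def)
    show "0 < \<rho> / d" "\<rho> / d \<le> 1" using \<rho> d by (simp_all add: divide_le_eq)
    have "\<rho> \<le> d * \<bar>?v $ i\<bar>" using \<rho>(3) i(2) by (simp add: dist_norm norm_minus_commute)
    then show "\<rho> / d \<le> \<bar>?v $ i\<bar>" using d by (simp add: divide_le_eq mult.commute)
    show "\<bar>?v $ i\<bar> \<le> 2 * R"
      using component_le_norm_cart[of x i] component_le_norm_cart[of x' i] x by simp
    show "\<bar>?v $ l\<bar> \<le> \<bar>?v $ i\<bar>" for l by (rule i(1))
    show "norm y \<le> R" if "y \<in> ?Y" for y using that K by blast
    show "norm x \<le> R" by (rule x)
    show "\<bar>(norm (y - x))\<^sup>2 - (norm (y' - x))\<^sup>2\<bar> \<le> E * (1/2) ^ k" if y: "y \<in> ?Y" "y' \<in> ?Y" for y y'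
    proof -
      have "8 * R * (1/2) ^ k \<le> E * (1/2) ^ k"
        unfolding E_def using R d by (intro mult_right_mono) auto
      then show ?thesis using q1[OF y] by linarith
    qed
    show "\<bar>(y - y') \<bullet> ?v\<bar> \<le> E * (1/2) ^ k" if y: "y \<in> ?Y" "y' \<in> ?Y" for y y'
    proof -
      have pol: "2 * ((z - x) \<bullet> ?v) = (norm (z - x))\<^sup>2 - (norm (z - x'))\<^sup>2 + (norm ?v)\<^sup>2" for z
      proof -
        have "(norm (a - b))\<^sup>2 = (norm a)\<^sup>2 - 2 * (a \<bullet> b) + (norm b)\<^sup>2" for a b :: "real^'n"
          by (simp add: power2_norm_eq_inner inner_diff_left inner_diff_right inner_commute[of b a])
        from this[of "z - x" ?v] show ?thesis by simp
      qed
      have "(y - y') \<bullet> ?v = (y - x) \<bullet> ?v - (y' - x) \<bullet> ?v" by (simp add: inner_diff_left)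
      then have "2 * ((y - y') \<bullet> ?v) = ((norm (y - x))\<^sup>2 - (norm (y' - x))\<^sup>2) - ((norm (y - x'))\<^sup>2 - (norm (y' - x'))\<^sup>2)"
        using pol[of y] pol[of y'] by linarith
      then have "2 * \<bar>(y - y') \<bullet> ?v\<bar> \<le> 8 * R * (1/2) ^ k + 8 * R * (d + 1) * (1/2) ^ k"
        using q1[OF y] q2[OF y] by linarith
      also have "\<dots> = E * (1/2) ^ k" by (simp add: E_def algebra_simps)
      finally show ?thesis by linarith
    qed
    show "(0::real) < (1/2) ^ j" "(1/2) ^ j \<le> (1::real)" by (simp_all add: power_le_one)
    show "(1/2) ^ j \<le> \<bar>((y - x) $ l - ?v $ l / ?v $ i * (y - x) $ i) + ((y' - x) $ l - ?v $ l / ?v $ i * (y' - x) $ i)\<bar>"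
      if y: "y \<in> ?Y" "y' \<in> ?Y" for y y'
    proof -
      have gen: "h \<le> \<bar>a + b\<bar>" if "h \<le> \<sigma> * a" "h \<le> \<sigma> * b" "0 < h" for a b h using \<sigma> that by auto
      show ?thesis by (rule gen) (use y in auto)
    qed
  qed
  also have "\<dots> = 180 * R * (E + 4 * R * d)\<^sup>2 * (5 * R) ^ (CARD('n) - 2) * d\<^sup>2 * ((2 ^ k) ^ (CARD('n) - 2) * 2 ^ j / \<rho>\<^sup>2)"
    using \<rho> d unfolding d_def[symmetric] by (simp add: power_divide field_simps)
  finally show ?thesis .
qed

text \<open>
The quantity \<open>2^(-j)\<close> is the radius of the tube around the line through the pins that separates the near from the far
part, and \<open>\<rho>\<close> bounds the distance of the pins from below. The first summand counts far cubes over all pairs of annuli; the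
second is the mass of the tube, which is covered either by \<open>2^j\<close> cubes of level \<open>j\<close> or by boundedly many for each annulus around \<open>x\<close>.
\<close>

theorem mass_of_annuli_intersection_le:
  fixes K :: "(real^'n) set" and R s :: real
  assumes R: "1 \<le> R" and K: "\<And>y. y \<in> K \<Longrightarrow> norm y \<le> R" and L: "frostman_mass s K L"
  obtains C where "0 < C"
    "\<And>k j x x' T T' N \<rho>. \<lbrakk>j \<le> k; norm x \<le> R; norm x' \<le> R; 0 < \<rho>; \<rho> \<le> 1; \<rho> \<le> dist x x';
      finite T; finite T'; real (card T) \<le> N; real (card T') \<le> N\<rbrakk> \<Longrightarrow>
      (\<Sum>q\<in>annuli_cells k K x T \<inter> annuli_cells k K x' T'. L k q) \<le>
        C * (N\<^sup>2 * ((2 ^ k) ^ (CARD('n) - 2) * 2 ^ j / \<rho>\<^sup>2) * 2 powr (- s * real k) + min (2 ^ j) N * 2 powr (- s * real j))"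
proof -
  define d where "d = real CARD('n)"
  define A where "A = 180 * R * (8 * R * (d + 2) + 4 * R * d)\<^sup>2 * (5 * R) ^ (CARD('n) - 2) * d\<^sup>2"
  define B where "B = max (12 ^ CARD('n) * (6 * R)) (2 * (3 * (2 * (d + 1) + 3)) ^ CARD('n))"
  have d: "1 \<le> d" by (simp add: d_def Suc_leI)
  have A: "0 \<le> A" using R d by (simp add: A_def)
  have B: "0 \<le> B" using d by (simp add: B_def le_max_iff_disj)
  have bounded_K: "bounded K" using K unfolding bounded_iff by blast
  let ?C = "d * (2 * A) + B + 1"
  show thesis
  proof (rule that[of ?C])
    show "0 < ?C" using A B d by (intro add_nonneg_pos add_nonneg_nonneg mult_nonneg_nonneg) auto
    fix k j :: nat and x x' :: "real^'n" and T T' :: "real set" and N \<rho> :: real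
    assume jk: "j \<le> k" and x: "norm x \<le> R" "norm x' \<le> R" and \<rho>: "0 < \<rho>" "\<rho> \<le> 1" "\<rho> \<le> dist x x'"
      and T: "finite T" "finite T'" "real (card T) \<le> N" "real (card T') \<le> N"
    have N: "0 \<le> N" using T(3) by linarith
    let ?v = "x' - x"
    obtain i where max_i: "\<And>l. \<bar>?v $ l\<bar> \<le> \<bar>?v $ i\<bar>" "norm ?v \<le> real CARD('n) * \<bar>?v $ i\<bar>"
      by (rule largest_coordinate[of ?v]) (rule that)
    note i = max_i(1) max_i(2)[folded d_def]
    have "norm ?v = dist x x'" by (simp add: dist_norm norm_minus_commute)
    then have "0 < norm ?v" using \<rho>(1,3) by linarith
    then have vi: "?v $ i \<noteq> 0" using i(2) by auto
    \<comment> \<open>\<open>g y\<close> is the displacement of \<open>y\<close> from the line through the pins, measured along the hyperplane of vanishing coordinate \<open>i\<close>.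
      It is comparable to the distance from the line and needs no rotation of coordinates.\<close>
    define g where "g y l = (y - x) $ l - ?v $ l / ?v $ i * (y - x) $ i" for y l
    define Near where "Near = {y \<in> K. (\<exists>t\<in>T. \<bar>dist x y - t\<bar> < (1/2) ^ k) \<and> (\<forall>l. \<bar>g y l\<bar> \<le> (1/2) ^ j)}"
    define Far where "Far t t' l \<sigma> = {y \<in> K. \<bar>dist x y - t\<bar> \<le> (1/2) ^ k \<and> \<bar>dist x' y - t'\<bar> \<le> (d + 1) * (1/2) ^ k \<and>
      (1/2) ^ j \<le> \<sigma> * g y l}" for t t' l \<sigma>
    let ?I = "T \<times> T' \<times> (UNIV - {i}) \<times> {1, - 1 :: real}"
    let ?far = "\<Union>(t, t', l, \<sigma>)\<in>?I. cell k ` Far t t' l \<sigma>"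
    have fin: "finite (cell k ` Z)" if "Z \<subseteq> K" for Z
      using finite_cells_bounded bounded_subset[OF bounded_K that] by blast
    have NearK: "Near \<subseteq> K" by (auto simp: Near_def)
    have FarK: "Far t t' l \<sigma> \<subseteq> K" for t t' l \<sigma> by (auto simp: Far_def)
    have fin_far: "finite ?far" using T(1,2) fin[OF FarK] by auto
    have cover: "annuli_cells k K x T \<inter> annuli_cells k K x' T' \<subseteq> cell k ` Near \<union> ?far"
    proof
      fix q assume "q \<in> annuli_cells k K x T \<inter> annuli_cells k K x' T'"
      then obtain y y' t t' where y: "y \<in> K" "t \<in> T" "\<bar>dist x y - t\<bar> < (1/2) ^ k" "q = cell k y"
        and y': "t' \<in> T'" "\<bar>dist x' y' - t'\<bar> < (1/2) ^ k" "q = cell k y'" by (auto simp: annuli_cells_def)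
      show "q \<in> cell k ` Near \<union> ?far"
      proof (cases "\<forall>l. \<bar>g y l\<bar> \<le> (1/2) ^ j")
        case True
        then have "y \<in> Near" using y by (auto simp: Near_def)
        then show ?thesis using y(4) by blast
      next
        case False
        then obtain l where l: "(1/2) ^ j < \<bar>g y l\<bar>" by (auto simp: not_le)
        have "g y i = 0" using vi by (simp add: g_def)
        then have li: "l \<noteq> i" using l by auto
        define \<sigma> where "\<sigma> = sgn (g y l)"
        have \<sigma>: "\<sigma> \<in> {1, -1}" "(1/2) ^ j \<le> \<sigma> * g y l" using l by (auto simp: \<sigma>_def sgn_if split: if_splits)
        have "dist y y' \<le> d * (1/2) ^ k" unfolding d_def by (rule dist_same_cell) (use y y' in simp)
        then have "\<bar>dist x' y - dist x' y'\<bar> \<le> d * (1/2) ^ k"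
          using abs_dist_diff_le[of y x' y'] by (simp add: dist_commute)
        then have "\<bar>dist x' y - t'\<bar> \<le> (d + 1) * (1/2) ^ k" using y'(2) by (simp add: distrib_right)
        then have "y \<in> Far t t' l \<sigma>" using y \<sigma>(2) by (simp add: Far_def)
        then have "q \<in> cell k ` Far t t' l \<sigma>" using y(4) by blast
        moreover have "(t, t', l, \<sigma>) \<in> ?I" using y(2) y'(1) li \<sigma>(1) by blast
        ultimately show ?thesis by blast
      qed
    qed
    have far: "(\<Sum>q\<in>?far. L k q) \<le> (d * (2 * A)) * (N\<^sup>2 * ((2 ^ k) ^ (CARD('n) - 2) * 2 ^ j / \<rho>\<^sup>2) * 2 powr (- s * real k))"
    proof -
      let ?G = "(2 ^ k) ^ (CARD('n) - 2) * 2 ^ j / \<rho>\<^sup>2"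
      have each: "real (card (cell k ` Far t t' l \<sigma>)) \<le> A * ?G" if "l \<noteq> i" "\<sigma> = 1 \<or> \<sigma> = - 1" for t t' l \<sigma>
        unfolding Far_def g_def A_def d_def
        by (rule card_cells_two_annuli_le[OF R x \<rho> K i(1) i(2)[unfolded d_def] that(1)[symmetric] that(2)]) auto
      have "card ?far \<le> (\<Sum>p\<in>?I. card (case p of (t, t', l, \<sigma>) \<Rightarrow> cell k ` Far t t' l \<sigma>))"
        by (rule card_UN_le) (use T in auto)
      then have "real (card ?far) \<le> (\<Sum>p\<in>?I. real (card (case p of (t, t', l, \<sigma>) \<Rightarrow> cell k ` Far t t' l \<sigma>)))"
        by (simp flip: of_nat_sum)
      also have "\<dots> \<le> (\<Sum>p\<in>?I. A * ?G)"
        by (intro sum_mono) (use each in auto)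
      also have "\<dots> = (real (card T) * (real (card T') * (real (card (UNIV - {i})) * 2))) * (A * ?G)"
      proof -
        have "card (T \<times> T' \<times> J \<times> {1, - 1 :: real}) = card T * (card T' * (card J * 2))" for J :: "'n set"
          by (simp add: card_cartesian_product)
        then show ?thesis by (simp only: sum_constant of_nat_mult of_nat_numeral)
      qed
      also have "\<dots> \<le> (N * (N * (d * 2))) * (A * ?G)"
      proof (intro mult_right_mono mult_mono)
        have "card (UNIV - {i}) \<le> CARD('n)" by (rule card_mono) auto
        then show "real (card (UNIV - {i})) \<le> d" by (simp add: d_def)
      qed (use T N A d in auto)
      finally have "real (card ?far) \<le> (N * (N * (d * 2))) * (A * ?G)" .
      then have "real (card ?far) * 2 powr (- s * real k) \<le> ((N * (N * (d * 2))) * (A * ?G)) * 2 powr (- s * real k)"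
        by (intro mult_right_mono) auto
      moreover have "(\<Sum>q\<in>?far. L k q) \<le> real (card ?far) * 2 powr (- s * real k)"
        by (rule frostman_mass_sum_le_card[OF L])
      ultimately show ?thesis by (simp add: power2_eq_square mult_ac)
    qed
    have near: "(\<Sum>q\<in>cell k ` Near. L k q) \<le> B * (min (2 ^ j) N * 2 powr (- s * real j))"
    proof -
      have n1: "real (card (cell j ` Near)) \<le> B * 2 ^ j"
      proof -
        have "real (card (cell j ` Near)) \<le> 12 ^ CARD('n) * (6 * (2 ^ j * R))"
          by (rule card_cells_near_line_le[OF R _ vi i(1), where x = x]) (use K in \<open>auto simp: Near_def g_def\<close>)
        also have "\<dots> = (12 ^ CARD('n) * (6 * R)) * 2 ^ j" by simp
        also have "\<dots> \<le> B * 2 ^ j" by (intro mult_right_mono) (simp_all add: B_def)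
        finally show ?thesis .
      qed
      have n2: "real (card (cell j ` Near)) \<le> B * N"
      proof -
        define Nt where "Nt t = {y \<in> Near. \<bar>dist x y - t\<bar> < (1/2) ^ k}" for t
        have Nt: "real (card (cell j ` Nt t)) \<le> B" for t
        proof -
          have "real (card (cell j ` Nt t)) \<le> 2 * (3 * (2 * (real CARD('n) + 1) + 3)) ^ CARD('n)"
          proof (rule card_cells_near_pole_le[OF _ vi _ i(1), where x = x and t = t])
            show "bounded (Nt t)" by (rule bounded_subset[OF bounded_K]) (auto simp: Nt_def Near_def)
            show "\<bar>(y - x) $ l - ?v $ l / ?v $ i * (y - x) $ i\<bar> \<le> (1/2) ^ j" if "y \<in> Nt t" for y l
              using that by (auto simp: Nt_def Near_def g_def)
            show "\<bar>norm (y - x) - t\<bar> \<le> 1 * (1/2) ^ j" if "y \<in> Nt t" for y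
            proof -
              have "(1/2 :: real) ^ k \<le> (1/2) ^ j" using jk by (intro power_decreasing) auto
              moreover have "\<bar>dist x y - t\<bar> < (1/2) ^ k" using that by (simp add: Nt_def)
              moreover have "norm (y - x) = dist x y" by (simp add: dist_norm norm_minus_commute)
              ultimately show ?thesis by (simp only: mult_1)
            qed
          qed simp
          then show ?thesis by (simp add: B_def d_def)
        qed
        have "cell j ` Near = (\<Union>t\<in>T. cell j ` Nt t)" by (auto simp: Nt_def Near_def)
        then have "card (cell j ` Near) \<le> (\<Sum>t\<in>T. card (cell j ` Nt t))" using card_UN_le[OF T(1)] by metis
        then have "real (card (cell j ` Near)) \<le> (\<Sum>t\<in>T. real (card (cell j ` Nt t)))" by (simp flip: of_nat_sum)
        also have "\<dots> \<le> (\<Sum>t\<in>T. B)" by (intro sum_mono Nt)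
        also have "\<dots> \<le> N * B" using T(3) B by (simp add: mult_right_mono)
        finally show ?thesis by (simp add: mult.commute)
      qed
      have "(\<Sum>q\<in>cell k ` Near. L k q) \<le> (\<Sum>q\<in>cell j ` Near. L j q)"
        by (rule frostman_mass_coarsen[OF L bounded_K jk NearK])
      also have "\<dots> \<le> real (card (cell j ` Near)) * 2 powr (- s * real j)" by (rule frostman_mass_sum_le_card[OF L])
      also have "\<dots> \<le> (B * min (2 ^ j) N) * 2 powr (- s * real j)"
        using n1 n2 by (intro mult_right_mono) (auto simp: min_def)
      finally show ?thesis by (simp add: mult.assoc)
    qed
    let ?a = "N\<^sup>2 * ((2 ^ k) ^ (CARD('n) - 2) * 2 ^ j / \<rho>\<^sup>2) * 2 powr (- s * real k)"
    let ?b = "min (2 ^ j) N * 2 powr (- s * real j)"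
    have "(\<Sum>q\<in>annuli_cells k K x T \<inter> annuli_cells k K x' T'. L k q) \<le> (\<Sum>q\<in>cell k ` Near \<union> ?far. L k q)"
      by (rule sum_mono2[OF _ cover]) (use fin[OF NearK] fin_far frostman_mass_nonneg[OF L] in auto)
    also have "\<dots> \<le> (\<Sum>q\<in>cell k ` Near. L k q) + (\<Sum>q\<in>?far. L k q)"
    proof -
      have "(\<Sum>q\<in>cell k ` Near \<union> ?far. L k q) + (\<Sum>q\<in>cell k ` Near \<inter> ?far. L k q)
         = (\<Sum>q\<in>cell k ` Near. L k q) + (\<Sum>q\<in>?far. L k q)"
        by (rule sum.union_inter[OF fin[OF NearK] fin_far])
      moreover have "0 \<le> (\<Sum>q\<in>cell k ` Near \<inter> ?far. L k q)" by (intro sum_nonneg frostman_mass_nonneg[OF L])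
      ultimately show ?thesis by linarith
    qed
    also have "\<dots> \<le> B * ?b + (d * (2 * A)) * ?a" by (rule add_mono[OF near far])
    also have "\<dots> \<le> ?C * (?a + ?b)"
    proof -
      have "0 \<le> ?a" "0 \<le> ?b" using N \<rho> by auto
      moreover have "0 \<le> d * (2 * A)" using A d by simp
      ultimately have "0 \<le> (d * (2 * A)) * ?b" "0 \<le> B * ?a" using B by (auto intro: mult_nonneg_nonneg)
      moreover have "(D + B' + 1) * (a + b) = B' * b + D * a + D * b + B' * a + (a + b)" for D B' a b :: real
        by (simp add: algebra_simps)
      ultimately show ?thesis using \<open>0 \<le> ?a\<close> \<open>0 \<le> ?b\<close> by (simp only:)
    qed
    finally show "(\<Sum>q\<in>annuli_cells k K x T \<inter> annuli_cells k K x' T'. L k q) \<le> ?C * (?a + ?b)" .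
  qed
qed

section \<open>Pigeonholing scales and pins\<close>

text \<open>
Double counting with Bonferroni's inequality. Were all pairwise intersections smaller, the sets \<open>A x\<close> would be so nearly disjoint that their
total mass is less than \<open>2 m\<close>.
\<close>

lemma overlapping_pair_exists:
  fixes w :: "'q \<Rightarrow> real"
  assumes fin: "finite Q" "finite X" and A: "\<And>x. x \<in> X \<Longrightarrow> A x \<subseteq> Q" and w: "\<And>q. q \<in> Q \<Longrightarrow> 0 \<le> w q"
    and m: "(\<Sum>q\<in>Q. w q) = m" "0 < m"
    and big: "\<And>x. x \<in> X \<Longrightarrow> a \<le> (\<Sum>q\<in>A x. w q)" "2 * m \<le> real (card X) * a"
  obtains x x' where "x \<in> X" "x' \<in> X" "x \<noteq> x'" "m / (real (card X))\<^sup>2 \<le> (\<Sum>q\<in>A x \<inter> A x'. w q)"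
proof -
  define n where "n = real (card X)"
  have "card X \<noteq> 0"
  proof
    assume "card X = 0"
    then have "2 * m \<le> 0 * a" using big(2) by (simp only: of_nat_0)
    then show False using m(2) by simp
  qed
  then have "1 \<le> card X" by linarith
  then have n: "1 \<le> n" unfolding n_def by (metis of_nat_1 of_nat_mono)
  have "\<exists>x\<in>X. \<exists>x'\<in>X. x \<noteq> x' \<and> m / n\<^sup>2 \<le> (\<Sum>q\<in>A x \<inter> A x'. w q)"
  proof (rule ccontr)
    assume "\<not> ?thesis"
    then have small: "(\<Sum>q\<in>A x \<inter> A x'. w q) \<le> m / n\<^sup>2" if "x \<in> X" "x' \<in> X - {x}" for x x' using that by force
    let ?i = "\<lambda>S q. if q \<in> S then 1 else 0 :: real"
    have ind: "(\<Sum>q\<in>S. w q) = (\<Sum>q\<in>Q. w q * ?i S q)" if "S \<subseteq> Q" for S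
      using that fin(1) by (simp add: sum.inter_restrict[symmetric] Int_absorb1 if_distrib cong: if_cong)
    have count: "(\<Sum>x\<in>X. ?i (A x) q) \<le> 1 + (\<Sum>x\<in>X. \<Sum>x'\<in>X - {x}. ?i (A x \<inter> A x') q)" for q
    proof (cases "\<exists>x\<in>X. q \<in> A x")
      case True
      then obtain x0 where x0: "x0 \<in> X" "q \<in> A x0" by blast
      have "(\<Sum>x\<in>X. ?i (A x) q) = 1 + (\<Sum>x\<in>X - {x0}. ?i (A x) q)"
        using x0 fin(2) by (simp add: sum.remove)
      also have "(\<Sum>x\<in>X - {x0}. ?i (A x) q) = (\<Sum>x'\<in>X - {x0}. ?i (A x0 \<inter> A x') q)"
        using x0 by (intro sum.cong) auto
      also have "\<dots> \<le> (\<Sum>x\<in>X. \<Sum>x'\<in>X - {x}. ?i (A x \<inter> A x') q)"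
        by (rule member_le_sum[OF x0(1), of "\<lambda>x. \<Sum>x'\<in>X - {x}. ?i (A x \<inter> A x') q"])
          (use fin in \<open>simp_all add: sum_nonneg\<close>)
      finally show ?thesis by simp
    next
      case False
      then have "(\<Sum>x\<in>X. ?i (A x) q) = 0" by (intro sum.neutral) auto
      moreover have "0 \<le> (\<Sum>x\<in>X. \<Sum>x'\<in>X - {x}. ?i (A x \<inter> A x') q)" by (intro sum_nonneg) auto
      ultimately show ?thesis by linarith
    qed
    have "2 * m \<le> (\<Sum>x\<in>X. a)" using big(2) by simp
    also have "\<dots> \<le> (\<Sum>x\<in>X. \<Sum>q\<in>A x. w q)" by (intro sum_mono big(1))
    also have "\<dots> = (\<Sum>x\<in>X. \<Sum>q\<in>Q. w q * ?i (A x) q)" by (intro sum.cong refl ind A)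
    also have "\<dots> = (\<Sum>q\<in>Q. \<Sum>x\<in>X. w q * ?i (A x) q)" by (rule sum.swap)
    also have "\<dots> = (\<Sum>q\<in>Q. w q * (\<Sum>x\<in>X. ?i (A x) q))" by (simp only: sum_distrib_left)
    also have "\<dots> \<le> (\<Sum>q\<in>Q. w q * (1 + (\<Sum>x\<in>X. \<Sum>x'\<in>X - {x}. ?i (A x \<inter> A x') q)))"
      by (intro sum_mono mult_left_mono count w)
    also have "\<dots> = m + (\<Sum>q\<in>Q. \<Sum>x\<in>X. \<Sum>x'\<in>X - {x}. w q * ?i (A x \<inter> A x') q)"
      by (simp only: distrib_left sum.distrib sum_distrib_left mult_1_right m(1))
    also have "(\<Sum>q\<in>Q. \<Sum>x\<in>X. \<Sum>x'\<in>X - {x}. w q * ?i (A x \<inter> A x') q)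
        = (\<Sum>x\<in>X. \<Sum>q\<in>Q. \<Sum>x'\<in>X - {x}. w q * ?i (A x \<inter> A x') q)" by (rule sum.swap)
    also have "\<dots> = (\<Sum>x\<in>X. \<Sum>x'\<in>X - {x}. \<Sum>q\<in>Q. w q * ?i (A x \<inter> A x') q)" by (intro sum.cong refl sum.swap)
    also have "\<dots> = (\<Sum>x\<in>X. \<Sum>x'\<in>X - {x}. \<Sum>q\<in>A x \<inter> A x'. w q)"
    proof (rule sum.cong[OF refl], rule sum.cong[OF refl])
      fix x x' assume "x \<in> X"
      then have "A x \<inter> A x' \<subseteq> Q" using A by blast
      then show "(\<Sum>q\<in>Q. w q * ?i (A x \<inter> A x') q) = (\<Sum>q\<in>A x \<inter> A x'. w q)" by (rule ind[symmetric])
    qed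
    also have "\<dots> \<le> (\<Sum>x\<in>X. \<Sum>x'\<in>X - {x}. m / n\<^sup>2)" by (intro sum_mono small)
    also have "\<dots> = n * ((n - 1) * (m / n\<^sup>2))" using fin(2) n by (simp add: n_def of_nat_diff)
    also have "\<dots> < m" using n m(2) by (simp add: power2_eq_square field_simps)
    finally show False by simp
  qed
  then show thesis using that unfolding n_def by blast
qed

text \<open>
Points at mutual distance at least \<open>r\<close> are chosen greedily. If the choice stops, the balls around the chosen points cover \<open>F\<close>.
\<close>

lemma separated_or_covered:
  fixes F :: "'a::metric_space set"
  assumes r: "0 < r"
  shows "(\<exists>X\<subseteq>F. finite X \<and> card X = n \<and> (\<forall>x\<in>X. \<forall>y\<in>X. x \<noteq> y \<longrightarrow> r \<le> dist x y))
    \<or> (\<exists>X\<subseteq>F. finite X \<and> card X \<le> n \<and> F \<subseteq> (\<Union>x\<in>X. ball x r))"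
proof (induction n)
  case 0
  show ?case by (rule disjI1, rule exI[of _ "{}"]) simp
next
  case (Suc n)
  then show ?case
  proof
    assume "\<exists>X\<subseteq>F. finite X \<and> card X = n \<and> (\<forall>x\<in>X. \<forall>y\<in>X. x \<noteq> y \<longrightarrow> r \<le> dist x y)"
    then obtain X where X: "X \<subseteq> F" "finite X" "card X = n" "\<forall>x\<in>X. \<forall>y\<in>X. x \<noteq> y \<longrightarrow> r \<le> dist x y" by blast
    show ?case
    proof (cases "F \<subseteq> (\<Union>x\<in>X. ball x r)")
      case True
      then show ?thesis using X by (intro disjI2 exI[of _ X]) auto
    next
      case False
      then obtain z where z: "z \<in> F" "z \<notin> (\<Union>x\<in>X. ball x r)" by blast
      have far: "r \<le> dist x z" if "x \<in> X" for x using z(2) that by (metis UN_I mem_ball not_less)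
      have "z \<notin> X" using far[of z] r by auto
      moreover have "\<forall>x\<in>insert z X. \<forall>y\<in>insert z X. x \<noteq> y \<longrightarrow> r \<le> dist x y"
        using X(4) far by (auto simp: dist_commute)
      ultimately show ?thesis using X z(1) by (intro disjI1 exI[of _ "insert z X"]) auto
    qed
  next
    assume "\<exists>X\<subseteq>F. finite X \<and> card X \<le> n \<and> F \<subseteq> (\<Union>x\<in>X. ball x r)"
    then show ?case by (meson le_SucI)
  qed
qed

lemma dyadic_content_ball_le:
  fixes p :: "real^'n"
  shows "dyadic_content s (ball p ((1/2) ^ j)) \<le> ennreal (3 ^ CARD('n) * 2 powr (- s * real j))"
proof -
  have "ball p ((1/2) ^ j) \<subseteq> (\<Union>Q\<in>{(j, cell j p)}. open_cube Q)"
    by (auto simp: open_cube_def cube_def)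
  from dyadic_content_le_of_open_cubes[OF this, of s]
  have "dyadic_content s (ball p ((1/2) ^ j)) \<le> 3 ^ CARD('n) * ennreal (2 powr (- s * real j))"
    by (simp add: cube_cost_finite)
  also have "(3 :: ennreal) ^ CARD('n) = ennreal (3 ^ CARD('n))" by (simp flip: ennreal_power)
  finally show ?thesis by (simp add: ennreal_mult)
qed

lemma sum_UN_le:
  fixes f :: "'a \<Rightarrow> real"
  assumes "finite I" "\<And>i. i \<in> I \<Longrightarrow> finite (B i)" "\<And>a. 0 \<le> f a"
  shows "(\<Sum>a\<in>(\<Union>i\<in>I. B i). f a) \<le> (\<Sum>i\<in>I. \<Sum>a\<in>B i. f a)"
  using assms(1,2)
proof (induction I)
  case (insert i I)
  have "(\<Sum>a\<in>B i \<union> (\<Union>i\<in>I. B i). f a) + (\<Sum>a\<in>B i \<inter> (\<Union>i\<in>I. B i). f a)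
      = (\<Sum>a\<in>B i. f a) + (\<Sum>a\<in>(\<Union>i\<in>I. B i). f a)"
    using insert by (intro sum.union_inter) auto
  moreover have "0 \<le> (\<Sum>a\<in>B i \<inter> (\<Union>i\<in>I. B i). f a)" by (intro sum_nonneg assms)
  moreover have "(\<Sum>a\<in>(\<Union>i\<in>I. B i). f a) \<le> (\<Sum>i\<in>I. \<Sum>a\<in>B i. f a)" using insert by simp
  ultimately show ?case using insert by simp
qed simp

text \<open>
This is the step that uses compactness of \<open>K\<close>. The open annuli of finitely many levels cover \<open>K\<close>; if \<open>n\<close> is the largest of these levels, every cube of
level \<open>n\<close> that meets \<open>K\<close> has an ancestor among the cubes of one of those families of annuli. So the masses of the families add up to at least \<open>m\<close>, and they cannot all be
below the terms of a geometric series with sum \<open>m/2\<close>.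
\<close>

lemma scale_with_large_mass:
  fixes K :: "(real^'n) set"
  assumes K: "compact K" and L: "frostman_mass s K L" and m: "m = (\<Sum>q\<in>cell 0 ` K. L 0 q)" "0 < m"
    and r: "0 < r" "r < (1::real)"
    and cover: "pinned_distance_set x K \<subseteq> (\<Union>k. \<Union>t\<in>T k. ball t ((1/2) ^ k))"
  obtains k where "m / 2 * ((1 - r) * r ^ k) \<le> (\<Sum>q\<in>annuli_cells k K x (T k). L k q)"
proof -
  have bounded_K: "bounded K" using K by (rule compact_imp_bounded)
  define G where "G k = {y. \<exists>t\<in>T k. \<bar>dist x y - t\<bar> < (1/2) ^ k}" for k
  have G_open: "open (G k)" for k
  proof -
    have "open {y. \<bar>dist x y - t\<bar> < (1/2) ^ k}" for t by (intro open_Collect_less continuous_intros)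
    then have "open (\<Union>t\<in>T k. {y. \<bar>dist x y - t\<bar> < (1/2) ^ k})" by blast
    moreover have "G k = (\<Union>t\<in>T k. {y. \<bar>dist x y - t\<bar> < (1/2) ^ k})" by (auto simp: G_def)
    ultimately show ?thesis by simp
  qed
  have "K \<subseteq> (\<Union>k. G k)"
  proof
    fix y assume "y \<in> K"
    then have "dist x y \<in> pinned_distance_set x K" by (auto simp: pinned_distance_set_def)
    then obtain k t where "t \<in> T k" "dist x y \<in> ball t ((1/2) ^ k)" using cover by blast
    then have "y \<in> G k" by (auto simp: G_def dist_real_def abs_minus_commute)
    then show "y \<in> (\<Union>k. G k)" by blast
  qed
  then obtain I where I: "finite I" "K \<subseteq> (\<Union>k\<in>I. G k)"
    using compactE_image[OF K, of UNIV G] G_open by metis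
  define n where "n = Max (insert 0 I)"
  have n: "k \<le> n" if "k \<in> I" for k using that I(1) by (simp add: n_def)
  have Gn: "K \<subseteq> (\<Union>k\<le>n. G k)" using I(2) n by blast
  have annuli: "annuli_cells k K x (T k) = cell k ` (K \<inter> G k)" for k
    unfolding annuli_cells_def G_def by (intro arg_cong[where f="image (cell k)"]) auto
  have "\<exists>k\<le>n. m / 2 * ((1 - r) * r ^ k) \<le> (\<Sum>q\<in>annuli_cells k K x (T k). L k q)"
  proof (rule ccontr)
    assume "\<not> ?thesis"
    then have small: "(\<Sum>q\<in>annuli_cells k K x (T k). L k q) \<le> m / 2 * ((1 - r) * r ^ k)" if "k \<le> n" for k
      using that by force
    define B where "B k = {q \<in> cell n ` K. ancestor k n q \<in> annuli_cells k K x (T k)}" for k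
    have finB: "finite (B k)" for k using finite_cells_bounded[OF bounded_K] by (simp add: B_def)
    have "m = (\<Sum>q | q \<in> cell n ` K \<and> ancestor 0 n q \<in> cell 0 ` K. L n q)"
      unfolding m(1) by (rule frostman_mass_ancestors[OF L bounded_K]) auto
    also have "\<dots> \<le> (\<Sum>q\<in>(\<Union>k\<le>n. B k). L n q)"
    proof (rule sum_mono2)
      show "finite (\<Union>k\<le>n. B k)" using finB by simp
      show "{q \<in> cell n ` K. ancestor 0 n q \<in> cell 0 ` K} \<subseteq> (\<Union>k\<le>n. B k)"
      proof
        fix q assume "q \<in> {q \<in> cell n ` K. ancestor 0 n q \<in> cell 0 ` K}"
        then obtain y where y: "y \<in> K" "q = cell n y" by blast
        then obtain k where k: "k \<le> n" "y \<in> G k" using Gn by blast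
        then have "q \<in> B k" using y by (auto simp: B_def annuli ancestor_cell)
        then show "q \<in> (\<Union>k\<le>n. B k)" using k(1) by blast
      qed
    qed (rule frostman_mass_nonneg[OF L])
    also have "\<dots> \<le> (\<Sum>k\<le>n. \<Sum>q\<in>B k. L n q)"
      by (rule sum_UN_le) (use finB frostman_mass_nonneg[OF L] in auto)
    also have "\<dots> = (\<Sum>k\<le>n. \<Sum>q\<in>annuli_cells k K x (T k). L k q)"
    proof (rule sum.cong[OF refl])
      fix k assume "k \<in> {..n}"
      then show "(\<Sum>q\<in>B k. L n q) = (\<Sum>q\<in>annuli_cells k K x (T k). L k q)"
        unfolding B_def by (intro frostman_mass_ancestors[OF L bounded_K, symmetric]) (auto simp: annuli)
    qed
    also have "\<dots> \<le> (\<Sum>k\<le>n. m / 2 * ((1 - r) * r ^ k))" by (intro sum_mono small) simp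
    also have "\<dots> = m / 2 * ((1 - r) * (\<Sum>k\<le>n. r ^ k))" by (simp only: sum_distrib_left)
    also have "(1 - r) * (\<Sum>k\<le>n. r ^ k) = 1 - r ^ Suc n" using r by (simp add: sum_gp0)
    also have "m / 2 * (1 - r ^ Suc n) \<le> m / 2 * 1" using m(2) r by (intro mult_left_mono) auto
    finally show False using m(2) by simp
  qed
  then show thesis using that by blast
qed

section \<open>Exceptional pins for a compact set\<close>

lemma two_powr_floor_le:
  assumes "0 \<le> a" shows "(2::real) ^ nat \<lfloor>a\<rfloor> \<le> 2 powr a"
proof -
  have "(2::real) ^ nat \<lfloor>a\<rfloor> = 2 powr (real (nat \<lfloor>a\<rfloor>))" by (simp add: powr_realpow)
  also have "\<dots> \<le> 2 powr a" using assms by (intro powr_mono) auto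
  finally show ?thesis .
qed

lemma two_powr_minus_floor_le:
  assumes "0 \<le> a" "0 \<le> s" shows "(2::real) powr (- s * real (nat \<lfloor>a\<rfloor>)) \<le> 2 powr s * 2 powr (- s * a)"
proof -
  have "a - 1 \<le> real (nat \<lfloor>a\<rfloor>)" using assms(1) by linarith
  then have "s * (a - 1) \<le> s * real (nat \<lfloor>a\<rfloor>)" using assms(2) by (intro mult_left_mono)
  then have "(2::real) powr (- s * real (nat \<lfloor>a\<rfloor>)) \<le> 2 powr (s + - s * a)" by (intro powr_mono) (auto simp: algebra_simps)
  then show ?thesis by (simp only: powr_add)
qed

text \<open>
The core of the argument; it proceeds as sketched at the beginning. In the proof, \<open>\<Delta>\<close> and \<open>\<Delta>'\<close> are the
gains in the exponents of the far and of the near part, \<open>P k = 2^(\<epsilon> k)\<close> is the unit in which losses are measured, and \<open>\<kappa>'\<close> is the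
exponent of separation of the pins. At the good scale the overlap of the two pins is at least a constant times \<open>1/P^2\<close>
and at most a constant times \<open>1/P^3\<close>, which is impossible once \<open>P\<close> is large.
\<close>

theorem exceptional_pins_content_zero:
  fixes K F :: "(real^'n) set" and L :: "nat \<Rightarrow> ('n \<Rightarrow> int) \<Rightarrow> real"
  assumes d: "2 \<le> CARD('n)" and R: "1 \<le> R" and K: "compact K" "\<And>y. y \<in> K \<Longrightarrow> norm y \<le> R"
    and L: "frostman_mass s K L" "0 < (\<Sum>q\<in>cell 0 ` K. L 0 q)" and s: "0 < s"
    and \<tau>: "0 < \<tau>" and \<kappa>: "0 < \<kappa>" "\<kappa> < 1"
    and gap: "2 * \<tau> + (real CARD('n) - 2) + \<kappa> < s" "1 < s \<or> \<tau> < \<kappa> * s"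
    and F: "\<And>x. x \<in> F \<Longrightarrow> norm x \<le> R"
    and null: "\<And>x. x \<in> F \<Longrightarrow> \<exists>\<tau>\<^sub>0. 0 \<le> \<tau>\<^sub>0 \<and> \<tau>\<^sub>0 \<le> \<tau> \<and> hausdorff_measure \<tau>\<^sub>0 (pinned_distance_set x K) = 0"
    and \<gamma>: "0 < \<gamma>"
  shows "dyadic_content \<gamma> F = 0"
proof (rule ccontr)
  assume "dyadic_content \<gamma> F \<noteq> 0"
  then have "0 < dyadic_content \<gamma> F" by (simp add: zero_less_iff_neq_zero)
  then obtain c' where c': "0 < c'" "c' < dyadic_content \<gamma> F" using dense by blast
  then have "c' < top" using top.not_eq_extremum by (metis less_le_trans top_greatest)
  define c where "c = enn2real c'"
  have c: "0 < c" "ennreal c < dyadic_content \<gamma> F"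
    using c' \<open>c' < top\<close> by (auto simp: c_def enn2real_positive_iff)
  define m where "m = (\<Sum>q\<in>cell 0 ` K. L 0 q)"
  have m: "0 < m" using L(2) by (simp add: m_def)
  have bounded_K: "bounded K" using K(1) by (rule compact_imp_bounded)
  obtain C where C: "0 < C"
    "\<And>k j x x' T T' N \<rho>. \<lbrakk>j \<le> k; norm x \<le> R; norm x' \<le> R; 0 < \<rho>; \<rho> \<le> 1; \<rho> \<le> dist x x';
      finite T; finite T'; real (card T) \<le> N; real (card T') \<le> N\<rbrakk> \<Longrightarrow>
      (\<Sum>q\<in>annuli_cells k K x T \<inter> annuli_cells k K x' T'. L k q) \<le>
        C * (N\<^sup>2 * ((2 ^ k) ^ (CARD('n) - 2) * 2 ^ j / \<rho>\<^sup>2) * 2 powr (- s * real k) + min (2 ^ j) N * 2 powr (- s * real j))"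
    by (rule mass_of_annuli_intersection_le[OF R K(2) L(1)], assumption, rule that)
  define \<Delta> where "\<Delta> = s - 2 * \<tau> - (real CARD('n) - 2) - \<kappa>"
  define \<Delta>' where "\<Delta>' = (if 1 < s then \<kappa> * (s - 1) else \<kappa> * s - \<tau>)"
  have \<Delta>: "0 < \<Delta>" "0 < \<Delta>'" using gap \<kappa> by (auto simp: \<Delta>_def \<Delta>'_def)
  \<comment> \<open>The gains must exceed \<open>3\<epsilon>\<close>; in the far part the separation of the pins costs a further \<open>2\<kappa>' = 6\<epsilon>/\<gamma>\<close>.\<close>
  define \<epsilon> where "\<epsilon> = min (\<Delta> / (6 / \<gamma> + 3)) (\<Delta>' / 3)"
  have \<epsilon>: "0 < \<epsilon>" "\<epsilon> * (6 / \<gamma> + 3) \<le> \<Delta>" "3 * \<epsilon> \<le> \<Delta>'"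
  proof -
    have p: "0 < 6 / \<gamma> + 3" using \<gamma> by (simp add: add_pos_pos)
    show "0 < \<epsilon>" using \<Delta> p by (simp add: \<epsilon>_def)
    have "\<epsilon> \<le> \<Delta> / (6 / \<gamma> + 3)" by (simp add: \<epsilon>_def)
    then show "\<epsilon> * (6 / \<gamma> + 3) \<le> \<Delta>" by (simp only: pos_le_divide_eq[OF p])
    show "3 * \<epsilon> \<le> \<Delta>'" by (simp add: \<epsilon>_def)
  qed
  define \<kappa>' where "\<kappa>' = 3 * \<epsilon> / \<gamma>"
  have \<kappa>': "0 < \<kappa>'" "\<gamma> * \<kappa>' = 3 * \<epsilon>" using \<epsilon>(1) \<gamma> by (simp_all add: \<kappa>'_def)
  define r where "r = 2 powr - \<epsilon>"
  have r: "0 < r" "r < 1" using \<epsilon>(1) powr_less_mono[of "- \<epsilon>" 0 2] by (simp_all add: r_def)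
  define \<theta> where "\<theta> = 1 - r"
  have \<theta>: "0 < \<theta>" "\<theta> \<le> 1" using r by (simp_all add: \<theta>_def)
  define P where "P k = 2 powr (\<epsilon> * real k)" for k :: nat
  have P: "1 \<le> P k" for k using \<epsilon>(1) by (simp add: P_def ge_one_powr_ge_zero)
  have rP: "r ^ k = 1 / P k" for k
  proof -
    have "r ^ k = 2 powr (- (\<epsilon> * real k))" using powr_realpow[OF r(1), of k] by (simp add: r_def powr_powr)
    then show ?thesis by (simp add: P_def powr_minus_divide)
  qed
  have P3: "1 / P k ^ 3 = 2 powr (- (3 * \<epsilon>) * real k)" for k
    by (simp add: P_def powr_realpow[symmetric] powr_powr powr_minus divide_inverse mult_ac)
  \<comment> \<open>The first threshold guarantees sufficiently many separated pins, the second one contradicts their overlap.\<close>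
  define Z where "Z = max (10 * 3 ^ CARD('n) * 2 powr \<gamma> / (c * \<theta>\<^sup>2)) (25 * C * (1 + 2 powr s) / (m * \<theta>\<^sup>2))"
  obtain k0 :: nat where k0: "Z < P k0"
  proof -
    obtain n :: nat where n: "Z < (2 powr \<epsilon>) ^ n" using real_arch_pow[of "2 powr \<epsilon>" Z] \<epsilon>(1) by auto
    have "(2 powr \<epsilon>) ^ n = P n" by (simp add: P_def powr_realpow[symmetric] powr_powr)
    then show thesis using n that by simp
  qed
  have Z: "Z < P k" if "k0 \<le> k" for k
  proof -
    have "P k0 \<le> P k" unfolding P_def using that \<epsilon>(1) by (intro powr_mono mult_left_mono) auto
    then show ?thesis using k0 by simp
  qed
  have "\<forall>x\<in>F. \<exists>T. (\<forall>k. finite (T k)) \<and> (\<forall>k. real (card (T k)) \<le> 2 powr (\<tau> * real k)) \<and> (\<forall>k<k0. T k = {}) \<and>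
      pinned_distance_set x K \<subseteq> (\<Union>k. \<Union>t\<in>T k. ball t ((1/2) ^ k))"
  proof
    fix x assume "x \<in> F"
    obtain \<tau>0 where t0: "0 \<le> \<tau>0" "\<tau>0 \<le> \<tau>" "hausdorff_measure \<tau>0 (pinned_distance_set x K) = 0" using null[OF \<open>x \<in> F\<close>] by blast
    show "\<exists>T. (\<forall>k. finite (T k)) \<and> (\<forall>k. real (card (T k)) \<le> 2 powr (\<tau> * real k)) \<and> (\<forall>k<k0. T k = {}) \<and>
      pinned_distance_set x K \<subseteq> (\<Union>k. \<Union>t\<in>T k. ball t ((1/2) ^ k))" by (rule hausdorff_null_cover_by_scales[OF t0(3,1,2) \<tau>, of k0]) blast
  qed
  from bchoice[OF this] obtain T where T_all: "\<forall>x\<in>F. (\<forall>k. finite (T x k)) \<and> (\<forall>k. real (card (T x k)) \<le> 2 powr (\<tau> * real k)) \<and>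
      (\<forall>k<k0. T x k = {}) \<and> pinned_distance_set x K \<subseteq> (\<Union>k. \<Union>t\<in>T x k. ball t ((1/2) ^ k))" ..
  have T: "\<And>x k. x \<in> F \<Longrightarrow> finite (T x k)" "\<And>x k. x \<in> F \<Longrightarrow> real (card (T x k)) \<le> 2 powr (\<tau> * real k)"
     "\<And>x k. x \<in> F \<Longrightarrow> k < k0 \<Longrightarrow> T x k = {}"
     "\<And>x. x \<in> F \<Longrightarrow> pinned_distance_set x K \<subseteq> (\<Union>k. \<Union>t\<in>T x k. ball t ((1/2) ^ k))"
    using T_all by simp_all
  define Fk where "Fk k = {x \<in> F. m / 2 * (\<theta> * r ^ k) \<le> (\<Sum>q\<in>annuli_cells k K x (T x k). L k q)}" for k
  have F_cover: "F \<subseteq> (\<Union>k. Fk k)"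
  proof
    fix x assume x: "x \<in> F"
    obtain k where "m / 2 * ((1 - r) * r ^ k) \<le> (\<Sum>q\<in>annuli_cells k K x (T x k). L k q)"
      by (rule scale_with_large_mass[OF K(1) L(1) m_def m r T(4)[OF x]])
    then have "x \<in> Fk k" using x by (simp add: Fk_def \<theta>_def)
    then show "x \<in> (\<Union>k. Fk k)" by blast
  qed
  have "\<exists>k. ennreal (c / 2 * (\<theta> * r ^ k)) < dyadic_content \<gamma> (Fk k)"
  proof (rule ccontr)
    assume "\<not> ?thesis"
    then have small: "dyadic_content \<gamma> (Fk k) \<le> ennreal (c / 2 * (\<theta> * r ^ k))" for k by (simp add: not_less)
    have "dyadic_content \<gamma> F \<le> dyadic_content \<gamma> (\<Union>k. Fk k)" by (rule dyadic_content_mono[OF F_cover])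
    also have "\<dots> \<le> (\<Sum>k. dyadic_content \<gamma> (Fk k))" by (rule dyadic_content_UN)
    also have "\<dots> \<le> (\<Sum>k. ennreal (c / 2 * (\<theta> * r ^ k)))" by (intro suminf_le small) auto
    also have "\<dots> = ennreal (c / 2)"
    proof (rule suminf_ennreal_eq)
      have "(\<lambda>k. c / 2 * (\<theta> * r ^ k)) sums (c / 2 * (\<theta> * (1 / (1 - r))))"
        using r by (intro sums_mult geometric_sums) simp
      then show "(\<lambda>k. c / 2 * (\<theta> * r ^ k)) sums (c / 2)" using \<theta> by (simp add: \<theta>_def)
    qed (use c \<theta> r in auto)
    also have "\<dots> < ennreal c" using c(1) by (simp add: ennreal_lessI)
    finally show False using c(2) by order
  qed
  then obtain k where k: "ennreal (c / 2 * (\<theta> * r ^ k)) < dyadic_content \<gamma> (Fk k)" by blast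
  have FkF: "Fk k \<subseteq> F" by (auto simp: Fk_def)
  \<comment> \<open>At coarser levels there are no annuli, hence no mass.\<close>
  have "k0 \<le> k"
  proof (rule ccontr)
    assume "\<not> k0 \<le> k"
    then have "T x k = {}" if "x \<in> F" for x using T(3)[OF that] by simp
    moreover have "0 < m / 2 * (\<theta> * r ^ k)" using m \<theta> r by simp
    ultimately have "Fk k = {}" by (auto simp: Fk_def annuli_cells_def)
    then show False using k by simp
  qed
  have PZ: "Z < P k" by (rule Z[OF \<open>k0 \<le> k\<close>])
  note P1 = P[of k]
  define n where "n = nat \<lceil>4 * P k / \<theta>\<rceil>"
  have n: "4 * P k / \<theta> \<le> real n" "real n \<le> 5 * P k / \<theta>"
  proof -
    show "4 * P k / \<theta> \<le> real n" unfolding n_def by linarith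
    have "1 \<le> P k / \<theta>" using P1 \<theta> by (simp add: le_divide_eq)
    moreover have "0 \<le> 4 * P k / \<theta>" using P1 \<theta> by simp
    ultimately show "real n \<le> 5 * P k / \<theta>" unfolding n_def by simp linarith
  qed
  define j' where "j' = nat \<lfloor>\<kappa>' * real k\<rfloor>"
  define j where "j = nat \<lfloor>\<kappa> * real k\<rfloor>"
  have jk: "j \<le> k"
  proof -
    have "\<kappa> * real k \<le> 1 * real k" using \<kappa> by (intro mult_right_mono) auto
    then show ?thesis unfolding j_def by linarith
  qed
  \<comment> \<open>\<open>n\<close> balls of radius \<open>2^(-j')\<close> have content at most a constant times \<open>P \<cdot> P^(-3)\<close>, less than the content \<open>1/P\<close> (up to a constant) of \<open>Fk k\<close>.\<close>
  have not_covered: False if X: "X \<subseteq> Fk k" "finite X" "card X \<le> n" "Fk k \<subseteq> (\<Union>x\<in>X. ball x ((1/2) ^ j'))" for X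
  proof -
    have pw: "2 powr (- \<gamma> * real j') \<le> 2 powr \<gamma> * (1 / P k ^ 3)"
    proof -
      have "2 powr (- \<gamma> * real j') \<le> 2 powr \<gamma> * 2 powr (- \<gamma> * (\<kappa>' * real k))"
        unfolding j'_def using \<kappa>' \<gamma> by (intro two_powr_minus_floor_le) auto
      also have "- \<gamma> * (\<kappa>' * real k) = - (3 * \<epsilon>) * real k" using \<kappa>'(2) by (simp add: mult.assoc[symmetric])
      finally show ?thesis unfolding P3 .
    qed
    have "dyadic_content \<gamma> (Fk k) \<le> dyadic_content \<gamma> (\<Union>x\<in>X. ball x ((1/2) ^ j'))" by (rule dyadic_content_mono[OF X(4)])
    also have "\<dots> \<le> (\<Sum>x\<in>X. dyadic_content \<gamma> (ball x ((1/2) ^ j')))" by (rule dyadic_content_Union_finite[OF X(2)])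
    also have "\<dots> \<le> (\<Sum>x\<in>X. ennreal (3 ^ CARD('n) * 2 powr (- \<gamma> * real j')))" by (intro sum_mono dyadic_content_ball_le)
    also have "\<dots> = ennreal (\<Sum>x\<in>X. 3 ^ CARD('n) * 2 powr (- \<gamma> * real j'))" by (rule sum_ennreal) simp
    also have "\<dots> \<le> ennreal (c / 2 * (\<theta> * r ^ k))"
    proof (rule ennreal_leI)
      have "(\<Sum>x\<in>X. 3 ^ CARD('n) * 2 powr (- \<gamma> * real j')) = real (card X) * (3 ^ CARD('n) * 2 powr (- \<gamma> * real j'))" by simp
      also have "\<dots> \<le> (5 * P k / \<theta>) * (3 ^ CARD('n) * (2 powr \<gamma> * (1 / P k ^ 3)))"
        using n(2) X(3) pw P1 \<theta> by (intro mult_mono mult_left_mono) auto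
      also have "\<dots> \<le> c / 2 * (\<theta> * (1 / P k))"
      proof -
        have "10 * 3 ^ CARD('n) * 2 powr \<gamma> / (c * \<theta>\<^sup>2) \<le> P k" using PZ by (simp add: Z_def)
        moreover have "0 < c * \<theta>\<^sup>2" using c(1) \<theta> by simp
        ultimately have "10 * 3 ^ CARD('n) * 2 powr \<gamma> \<le> P k * (c * \<theta>\<^sup>2)" by (simp add: pos_divide_le_eq)
        moreover have "u / \<theta> * (1 / p ^ 2) \<le> c / 2 * (\<theta> * (1 / p))" if "2 * u \<le> p * (c * \<theta>\<^sup>2)" "1 \<le> p" for u p :: real
          using that \<theta> by (simp add: field_simps power2_eq_square)
        from this[of "5 * (3 ^ CARD('n) * 2 powr \<gamma>)" "P k"] have "10 * 3 ^ CARD('n) * 2 powr \<gamma> \<le> P k * (c * \<theta>\<^sup>2) \<Longrightarrow> 5 * (3 ^ CARD('n) * 2 powr \<gamma>) / \<theta> * (1 / P k ^ 2) \<le> c / 2 * (\<theta> * (1 / P k))"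
          using P1 by simp
        moreover have "(5 * P k / \<theta>) * (3 ^ CARD('n) * (2 powr \<gamma> * (1 / P k ^ 3))) = 5 * (3 ^ CARD('n) * 2 powr \<gamma>) / \<theta> * (1 / P k ^ 2)"
          using P1 \<theta> by (simp add: power3_eq_cube power2_eq_square)
        ultimately show ?thesis by simp
      qed
      finally show "(\<Sum>x\<in>X. 3 ^ CARD('n) * 2 powr (- \<gamma> * real j')) \<le> c / 2 * (\<theta> * r ^ k)" unfolding rP .
    qed
    finally show False using k by order
  qed
  have "0 < (1/2 :: real) ^ j'" by simp
  from separated_or_covered[OF this, of "Fk k" n] not_covered
  obtain X where X: "X \<subseteq> Fk k" "finite X" "card X = n" "\<And>x y. x \<in> X \<Longrightarrow> y \<in> X \<Longrightarrow> x \<noteq> y \<Longrightarrow> (1/2) ^ j' \<le> dist x y"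
    by blast
  obtain x x' where x: "x \<in> X" "x' \<in> X" "x \<noteq> x'"
    "m / (real (card X))\<^sup>2 \<le> (\<Sum>q\<in>annuli_cells k K x (T x k) \<inter> annuli_cells k K x' (T x' k). L k q)"
  proof (rule overlapping_pair_exists[of "cell k ` K" X "\<lambda>x. annuli_cells k K x (T x k)" "L k" m "m / 2 * (\<theta> * r ^ k)"])
    show "finite (cell k ` K)" by (rule finite_cells_bounded[OF bounded_K])
    show "finite X" by fact
    show "annuli_cells k K x (T x k) \<subseteq> cell k ` K" for x by (auto simp: annuli_cells_def)
    show "0 \<le> L k q" for q by (rule frostman_mass_nonneg[OF L(1)])
    have "m = (\<Sum>q | q \<in> cell k ` K \<and> ancestor 0 k q \<in> cell 0 ` K. L k q)"
      unfolding m_def by (rule frostman_mass_ancestors[OF L(1) bounded_K]) auto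
    also have "{q. q \<in> cell k ` K \<and> ancestor 0 k q \<in> cell 0 ` K} = cell k ` K" by (auto simp: ancestor_cell)
    finally show "(\<Sum>q\<in>cell k ` K. L k q) = m" by simp
    show "m / 2 * (\<theta> * r ^ k) \<le> (\<Sum>q\<in>annuli_cells k K x (T x k). L k q)" if "x \<in> X" for x
      using that X(1) by (auto simp: Fk_def)
    have "4 * P k / \<theta> * (m / 2 * (\<theta> * r ^ k)) \<le> real (card X) * (m / 2 * (\<theta> * r ^ k))"
      unfolding X(3) using n(1) m \<theta> r by (intro mult_right_mono) auto
    moreover have "4 * P k / \<theta> * (m / 2 * (\<theta> * r ^ k)) = 2 * m" unfolding rP using P1 \<theta> by simp
    ultimately show "2 * m \<le> real (card X) * (m / 2 * (\<theta> * r ^ k))" by simp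
  qed (use m that in auto)
  have xF: "x \<in> F" "x' \<in> F" using x X(1) FkF by auto
  define N where "N = 2 powr (\<tau> * real k)"
  have upper: "(\<Sum>q\<in>annuli_cells k K x (T x k) \<inter> annuli_cells k K x' (T x' k). L k q)
     \<le> C * (N\<^sup>2 * ((2 ^ k) ^ (CARD('n) - 2) * 2 ^ j / ((1/2) ^ j')\<^sup>2) * 2 powr (- s * real k) + min (2 ^ j) N * 2 powr (- s * real j))"
    by (rule C(2)[OF jk F[OF xF(1)] F[OF xF(2)]]) (use T xF X(4)[OF x(1-3)] in \<open>auto simp: N_def power_le_one\<close>)
  have far: "N\<^sup>2 * ((2 ^ k) ^ (CARD('n) - 2) * 2 ^ j / ((1/2) ^ j')\<^sup>2) * 2 powr (- s * real k) \<le> 1 / P k ^ 3"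
  proof -
    have e1: "N\<^sup>2 = 2 powr (2 * \<tau> * real k)" by (simp add: N_def powr_realpow[symmetric] powr_powr mult_ac)
    have e2: "((2::real) ^ k) ^ (CARD('n) - 2) = 2 powr ((real CARD('n) - 2) * real k)"
      using d by (simp add: powr_realpow[symmetric] powr_powr of_nat_diff mult.commute flip: power_mult)
    have e3: "(2::real) ^ j \<le> 2 powr (\<kappa> * real k)" unfolding j_def using \<kappa> by (intro two_powr_floor_le) auto
    have e4: "1 / ((1/2 :: real) ^ j')\<^sup>2 \<le> 2 powr (2 * \<kappa>' * real k)"
    proof -
      have "(2::real) ^ j' \<le> 2 powr (\<kappa>' * real k)" unfolding j'_def using \<kappa>' by (intro two_powr_floor_le) auto
      then have "((2::real) ^ j')\<^sup>2 \<le> (2 powr (\<kappa>' * real k))\<^sup>2" by (intro power_mono) auto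
      also have "\<dots> = 2 powr (2 * \<kappa>' * real k)" by (simp add: powr_realpow[symmetric] powr_powr mult_ac)
      finally show ?thesis by (simp add: power_one_over)
    qed
    have "N\<^sup>2 * ((2 ^ k) ^ (CARD('n) - 2) * 2 ^ j / ((1/2) ^ j')\<^sup>2) * 2 powr (- s * real k)
      = N\<^sup>2 * ((2 ^ k) ^ (CARD('n) - 2) * (2 ^ j * (1 / ((1/2) ^ j')\<^sup>2))) * 2 powr (- s * real k)" by simp
    also have "\<dots> \<le> 2 powr (2 * \<tau> * real k) * (2 powr ((real CARD('n) - 2) * real k) * (2 powr (\<kappa> * real k) * 2 powr (2 * \<kappa>' * real k))) * 2 powr (- s * real k)"
      unfolding e1 e2 using e3 e4 by (intro mult_right_mono mult_left_mono mult_mono) auto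
    also have "\<dots> = 2 powr ((- \<Delta> + 2 * \<kappa>') * real k)"
      unfolding powr_add[symmetric] by (rule arg_cong[where f="\<lambda>u. 2 powr u"]) (simp add: \<Delta>_def algebra_simps)
    also have "\<dots> \<le> 2 powr (- (3 * \<epsilon>) * real k)"
    proof (intro powr_mono mult_right_mono)
      have "\<epsilon> * (6 / \<gamma> + 3) = 2 * \<kappa>' + 3 * \<epsilon>" by (simp add: \<kappa>'_def algebra_simps)
      then show "- \<Delta> + 2 * \<kappa>' \<le> - (3 * \<epsilon>)" using \<epsilon>(2) by linarith
    qed auto
    finally show ?thesis unfolding P3 .
  qed
  have near: "min (2 ^ j) N * 2 powr (- s * real j) \<le> 2 powr s * (1 / P k ^ 3)"
  proof -
    have goal: ?thesis if "min (2 ^ j) N * 2 powr (- s * real j) \<le> 2 powr s * 2 powr (- \<Delta>' * real k)"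
    proof -
      have "2 powr (- \<Delta>' * real k) \<le> 2 powr (- (3 * \<epsilon>) * real k)"
        using \<epsilon>(3) by (intro powr_mono mult_right_mono) auto
      then have "2 powr s * 2 powr (- \<Delta>' * real k) \<le> 2 powr s * (1 / P k ^ 3)" unfolding P3 by (intro mult_left_mono) auto
      then show ?thesis using that by linarith
    qed
    show ?thesis
    proof (cases "1 < s")
      case True
      have "min (2 ^ j) N * 2 powr (- s * real j) \<le> 2 ^ j * 2 powr (- s * real j)" by (intro mult_right_mono) auto
      also have "\<dots> = 2 powr (- (s - 1) * real j)"
        unfolding powr_realpow[symmetric, of 2, simplified] powr_add[symmetric]
        by (rule arg_cong[where f="\<lambda>u. 2 powr u"]) (simp add: algebra_simps)
      also have "\<dots> \<le> 2 powr (s - 1) * 2 powr (- (s - 1) * (\<kappa> * real k))"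
        unfolding j_def using True \<kappa> by (intro two_powr_minus_floor_le) auto
      also have "- (s - 1) * (\<kappa> * real k) = - \<Delta>' * real k" using True by (simp add: \<Delta>'_def algebra_simps)
      also have "2 powr (s - 1) * 2 powr (- \<Delta>' * real k) \<le> 2 powr s * 2 powr (- \<Delta>' * real k)"
        by (intro mult_right_mono powr_mono) auto
      finally show ?thesis by (rule goal)
    next
      case False
      have "min (2 ^ j) N * 2 powr (- s * real j) \<le> N * 2 powr (- s * real j)" by (intro mult_right_mono) auto
      also have "\<dots> \<le> N * (2 powr s * 2 powr (- s * (\<kappa> * real k)))"
        unfolding j_def using s \<kappa> by (intro mult_left_mono two_powr_minus_floor_le) (auto simp: N_def)
      also have "\<dots> = 2 powr s * 2 powr (- \<Delta>' * real k)"
        unfolding N_def powr_add[symmetric]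
        by (rule arg_cong[where f="\<lambda>u. 2 powr u"]) (use False in \<open>simp add: \<Delta>'_def algebra_simps\<close>)
      finally show ?thesis by (rule goal)
    qed
  qed
  have "m / (real (card X))\<^sup>2 \<le> C * (1 / P k ^ 3 + 2 powr s * (1 / P k ^ 3))"
  proof -
    note x(4)
    also note upper
    also have "C * (N\<^sup>2 * ((2 ^ k) ^ (CARD('n) - 2) * 2 ^ j / ((1/2) ^ j')\<^sup>2) * 2 powr (- s * real k) + min (2 ^ j) N * 2 powr (- s * real j))
       \<le> C * (1 / P k ^ 3 + 2 powr s * (1 / P k ^ 3))"
      using C(1) by (intro mult_left_mono add_mono far near) auto
    finally show ?thesis .
  qed
  moreover have "m / (5 * P k / \<theta>)\<^sup>2 \<le> m / (real (card X))\<^sup>2"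
  proof -
    have "0 < 4 * P k / \<theta>" using P1 \<theta> by simp
    then have "0 < real n" using n(1) by linarith
    then have "(real n)\<^sup>2 \<le> (5 * P k / \<theta>)\<^sup>2" using n(2) by (intro power_mono) auto
    then show ?thesis unfolding X(3) using m \<open>0 < real n\<close> by (intro divide_left_mono mult_pos_pos) auto
  qed
  ultimately have le: "m / (5 * P k / \<theta>)\<^sup>2 \<le> C * (1 / P k ^ 3 + 2 powr s * (1 / P k ^ 3))" by linarith
  have "P k \<le> 25 * C * (1 + 2 powr s) / (m * \<theta>\<^sup>2)"
  proof -
    have gen: "p \<le> 25 * C * (1 + u) / (m * \<theta>\<^sup>2)" if "m / (5 * p / \<theta>)\<^sup>2 \<le> C * (1 / p ^ 3 + u * (1 / p ^ 3))" "1 \<le> p" for p u :: real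
    proof -
      have "m / (5 * p / \<theta>)\<^sup>2 = m * \<theta>\<^sup>2 / (25 * p\<^sup>2)" using \<theta> that(2) by (simp add: power_divide power_mult_distrib)
      moreover have "C * (1 / p ^ 3 + u * (1 / p ^ 3)) = C * (1 + u) / p ^ 3" by (simp add: algebra_simps add_divide_distrib)
      ultimately have "m * \<theta>\<^sup>2 / (25 * p\<^sup>2) \<le> C * (1 + u) / p ^ 3" using that(1) by simp
      then have "m * \<theta>\<^sup>2 / (25 * p\<^sup>2) * (25 * p ^ 3) \<le> C * (1 + u) / p ^ 3 * (25 * p ^ 3)" using that(2) by (intro mult_right_mono) auto
      moreover have "m * \<theta>\<^sup>2 / (25 * p\<^sup>2) * (25 * p ^ 3) = p * (m * \<theta>\<^sup>2)" using that(2) by (simp add: power2_eq_square power3_eq_cube)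
      moreover have "C * (1 + u) / p ^ 3 * (25 * p ^ 3) = 25 * C * (1 + u)" using that(2) by simp
      ultimately have "p * (m * \<theta>\<^sup>2) \<le> 25 * C * (1 + u)" by simp
      moreover have "0 < m * \<theta>\<^sup>2" using m \<theta> by simp
      ultimately show ?thesis by (simp only: pos_le_divide_eq)
    qed
    show ?thesis by (rule gen[OF le P1])
  qed
  then show False using PZ by (simp add: Z_def)
qed

section \<open>From content to Hausdorff dimension\<close>

lemma hausdorff_measure_mono: "A \<subseteq> B \<Longrightarrow> hausdorff_measure s A \<le> hausdorff_measure s B"
  unfolding hausdorff_measure_def hausdorff_premeasure_def
  by (intro SUP_mono bexI[where x=x for x] INF_superset_mono) auto

lemma pinned_distance_set_mono: "K \<subseteq> E \<Longrightarrow> pinned_distance_set x K \<subseteq> pinned_distance_set x E"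
  unfolding pinned_distance_set_def by blast

lemma hausdorff_dim_nonneg: "0 \<le> hausdorff_dim A"
  unfolding hausdorff_dim_def by (rule INF_greatest) simp

lemma hausdorff_dim_le: "0 \<le> s \<Longrightarrow> hausdorff_measure s A = 0 \<Longrightarrow> hausdorff_dim A \<le> ereal s"
  unfolding hausdorff_dim_def by (rule INF_lower) simp

lemma hausdorff_dim_eq_zeroI:
  assumes "\<And>\<gamma>. 0 < \<gamma> \<Longrightarrow> hausdorff_measure \<gamma> A = 0" shows "hausdorff_dim A = 0"
proof (rule antisym)
  show "hausdorff_dim A \<le> 0"
  proof (rule ereal_le_epsilon2)
    fix e :: real assume "0 < e"
    then show "hausdorff_dim A \<le> 0 + ereal e" using hausdorff_dim_le[of e A] assms[of e] by simp
  qed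
qed (rule hausdorff_dim_nonneg)

text \<open>
Below the dimension the Hausdorff measure is nonzero, hence so is the content, and by countable subadditivity a bounded piece carries some of it.
\<close>

lemma bounded_piece_positive_content:
  fixes E :: "(real^'n) set"
  assumes "0 < s" "ereal s < hausdorff_dim E"
  obtains N :: nat where "0 < dyadic_content s (E \<inter> cball 0 (real N))"
proof -
  have "\<exists>N :: nat. dyadic_content s (E \<inter> cball 0 (real N)) \<noteq> 0"
  proof (rule ccontr)
    assume "\<not> ?thesis"
    then have zero: "dyadic_content s (E \<inter> cball 0 (real N)) = 0" for N :: nat by blast
    have "E \<subseteq> (\<Union>N :: nat. E \<inter> cball 0 (real N))" using real_arch_simple by fastforce
    then have "dyadic_content s E \<le> (\<Sum>N :: nat. dyadic_content s (E \<inter> cball 0 (real N)))"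
      using dyadic_content_mono dyadic_content_UN order_trans by blast
    then have "dyadic_content s E = 0" by (simp add: zero)
    then have "hausdorff_dim E \<le> ereal s"
      using assms(1) by (intro hausdorff_dim_le hausdorff_measure_zero_if_dyadic_content_zero) auto
    then show False using assms(2) by simp
  qed
  then show thesis using that by (auto simp: zero_less_iff_neq_zero)
qed

text \<open>
A bounded set meets at most a constant times \<open>2^(k d)\<close> cubes of level \<open>k\<close>, and for \<open>s > d\<close> their cost tends to 0. For the dimension \<open>\<beta>\<close> of a
planar set this bound yields \<open>(2\<beta> - 1)/3 \<le> \<beta>/2\<close>.
\<close>

lemma hausdorff_dim_le_dimension:
  fixes E :: "(real^'n) set"
  shows "hausdorff_dim E \<le> ereal (real CARD('n))"
proof (rule ccontr)
  assume "\<not> ?thesis"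
  then have "ereal (real CARD('n)) < hausdorff_dim E" by simp
  then obtain s where s: "ereal (real CARD('n)) < ereal s" "ereal s < hausdorff_dim E" using ereal_dense2 by blast
  then have "0 < s" by (simp add: le_less_trans[OF of_nat_0_le_iff])
  obtain N :: nat where N: "0 < dyadic_content s (E \<inter> cball 0 (real N))"
    by (rule bounded_piece_positive_content[OF \<open>0 < s\<close> s(2)])
  let ?A = "E \<inter> cball 0 (real N)"
  define R where "R = max 1 (real N)"
  define q where "q = 2 powr (real CARD('n) - s)"
  have q: "0 < q" "q < 1" using s(1) powr_less_mono[of "real CARD('n) - s" 0 2] by (simp_all add: q_def)
  have bound: "dyadic_content s ?A \<le> ennreal ((12 * R) ^ CARD('n) * q ^ k)" for k
  proof -
    have fin: "finite (cell k ` ?A)" by (rule finite_cells_bounded) (simp add: bounded_Int)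
    have "1 * 1 \<le> 2 ^ k * R" by (intro mult_mono) (auto simp: R_def)
    have card: "real (card (cell k ` ?A)) \<le> (3 * (4 * (2 ^ k * R))) ^ CARD('n)"
    proof (rule card_box_le)
      show "1 \<le> 4 * (2 ^ k * R)" using \<open>1 * 1 \<le> 2 ^ k * R\<close> by simp
      fix a b l assume "a \<in> cell k ` ?A" "b \<in> cell k ` ?A"
      then obtain y z where "y \<in> ?A" "z \<in> ?A" "a = cell k y" "b = cell k z" by blast
      then have y: "norm y \<le> R" "norm z \<le> R" "a = cell k y" "b = cell k z" by (auto simp: R_def)
      show "real_of_int \<bar>a l - b l\<bar> \<le> 4 * (2 ^ k * R)"
        using abs_cell_le[OF y(1), of k l] abs_cell_le[OF y(2), of k l] y(3,4) by (simp add: R_def)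
    qed
    have "dyadic_content s ?A \<le> cube_cost s (Pair k ` cell k ` ?A)"
      by (rule dyadic_content_le_cost) (auto simp: cube_def)
    also have "\<dots> = (\<Sum>Q\<in>Pair k ` cell k ` ?A. ennreal (2 powr (- s * real (fst Q))))"
      using fin by (intro cube_cost_finite) simp
    also have "\<dots> = (\<Sum>Q\<in>Pair k ` cell k ` ?A. ennreal (2 powr (- s * real k)))"
      by (rule sum.cong) auto
    also have "\<dots> = ennreal (real (card (Pair k ` cell k ` ?A)) * 2 powr (- s * real k))"
      by (simp add: ennreal_mult ennreal_of_nat_eq_real_of_nat)
    also have "\<dots> \<le> ennreal ((12 * R) ^ CARD('n) * q ^ k)"
    proof (rule ennreal_leI)
      have "card (Pair k ` cell k ` ?A) = card (cell k ` ?A)" by (rule card_image) (simp add: inj_on_def)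
      then have "real (card (Pair k ` cell k ` ?A)) * 2 powr (- s * real k) \<le> (3 * (4 * (2 ^ k * R))) ^ CARD('n) * 2 powr (- s * real k)"
        using card by (intro mult_right_mono) auto
      also have "\<dots> = (12 * R) ^ CARD('n) * (((2 ^ k) ^ CARD('n)) * 2 powr (- s * real k))" by (simp add: power_mult_distrib)
      also have "((2::real) ^ k) ^ CARD('n) * 2 powr (- s * real k) = q ^ k"
      proof -
        have "((2::real) ^ k) ^ CARD('n) = 2 powr (real k * real CARD('n))"
          using powr_realpow[of 2 "k * CARD('n)"] by (simp add: power_mult)
        moreover have "q ^ k = 2 powr ((real CARD('n) - s) * real k)"
          using powr_realpow[OF q(1), of k] by (simp add: q_def powr_powr)
        ultimately show ?thesis by (simp add: powr_add[symmetric] algebra_simps)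
      qed
      finally show "real (card (Pair k ` cell k ` ?A)) * 2 powr (- s * real k) \<le> (12 * R) ^ CARD('n) * q ^ k" .
    qed
    finally show ?thesis .
  qed
  have "(\<lambda>k. (12 * R) ^ CARD('n) * q ^ k) \<longlonglongrightarrow> (12 * R) ^ CARD('n) * 0"
    using q by (intro tendsto_mult tendsto_const LIMSEQ_power_zero) simp
  then have "(\<lambda>k. ennreal ((12 * R) ^ CARD('n) * q ^ k)) \<longlonglongrightarrow> ennreal 0" by (intro tendsto_ennrealI) simp
  then have "dyadic_content s ?A \<le> ennreal 0"
    by (rule LIMSEQ_le_const) (use bound in blast)
  then show False using N by simp
qed

text \<open>
The exceptional set is a countable union of bounded sets on which the dimension of \<open>D_x(E)\<close> is at most a number \<open>\<tau>\<close> strictly below \<open>\<theta>\<close>. Shrinking \<open>E\<close>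
to a compact subset \<open>K\<close> only enlarges these sets, so it is enough to treat \<open>K\<close>.
\<close>

theorem hausdorff_dim_exceptional_pins_zero:
  fixes E :: "(real^'n) set"
  assumes E: "E \<in> sets borel" and d: "2 \<le> CARD('n)" and \<theta>: "0 < \<theta>"
    and params: "\<And>\<tau>. 0 < \<tau> \<Longrightarrow> \<tau> < \<theta> \<Longrightarrow> \<exists>s \<kappa>. 0 < s \<and> ereal s < hausdorff_dim E \<and> 0 < \<kappa> \<and> \<kappa> < 1 \<and>
        2 * \<tau> + (real CARD('n) - 2) + \<kappa> < s \<and> (1 < s \<or> \<tau> < \<kappa> * s)"
  shows "hausdorff_dim {x. hausdorff_dim (pinned_distance_set x E) < ereal \<theta>} = 0"
proof (rule hausdorff_dim_eq_zeroI)
  fix \<gamma> :: real assume \<gamma>: "0 < \<gamma>"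
  let ?X = "{x. hausdorff_dim (pinned_distance_set x E) < ereal \<theta>}"
  define \<tau> where "\<tau> N = \<theta> * (1 - 1 / real (N + 2))" for N :: nat
  have \<tau>: "0 < \<tau> N" "\<tau> N < \<theta>" for N
  proof -
    have "0 < 1 - 1 / real (N + 2)" "1 - 1 / real (N + 2) < 1" by (simp_all add: field_simps)
    then show "0 < \<tau> N" "\<tau> N < \<theta>" using \<theta> mult_strict_left_mono[of "1 - 1 / real (N + 2)" 1 \<theta>] by (simp_all add: \<tau>_def)
  qed
  define X where "X N = {x. norm x \<le> real N \<and> (\<exists>t\<ge>0. t \<le> \<tau> N \<and> hausdorff_measure t (pinned_distance_set x E) = 0)}" for N :: nat
  have cover: "?X \<subseteq> (\<Union>N. X N)"
  proof
    fix x assume "x \<in> ?X"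
    then obtain t where t: "0 \<le> t" "hausdorff_measure t (pinned_distance_set x E) = 0" "t < \<theta>"
      unfolding hausdorff_dim_def by (auto simp: INF_less_iff)
    obtain N1 :: nat where N1: "norm x \<le> real N1" using real_arch_simple by blast
    obtain N2 :: nat where N2: "\<theta> / (\<theta> - t) \<le> real N2" using real_arch_simple by blast
    define N where "N = max N1 N2"
    have "\<theta> / (\<theta> - t) \<le> real (N + 2)" using N2 by (simp add: N_def)
    then have "\<theta> \<le> real (N + 2) * (\<theta> - t)" using t(3) by (simp add: pos_divide_le_eq)
    then have "\<theta> / real (N + 2) \<le> \<theta> - t" by (simp add: pos_divide_le_eq mult.commute)
    then have "t \<le> \<tau> N" by (simp add: \<tau>_def right_diff_distrib)
    moreover have "norm x \<le> real N" using N1 by (simp add: N_def)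
    ultimately have "x \<in> X N" using t by (auto simp: X_def)
    then show "x \<in> (\<Union>N. X N)" by blast
  qed
  have zero: "dyadic_content \<gamma> (X N) = 0" for N
  proof -
    obtain s \<kappa> where sk: "0 < s" "ereal s < hausdorff_dim E" "0 < \<kappa>" "\<kappa> < 1"
        "2 * \<tau> N + (real CARD('n) - 2) + \<kappa> < s" "1 < s \<or> \<tau> N < \<kappa> * s"
      using params[OF \<tau>] by blast
    obtain M :: nat where M: "0 < dyadic_content s (E \<inter> cball 0 (real M))"
      by (rule bounded_piece_positive_content[OF sk(1,2)])
    have "E \<inter> cball 0 (real M) \<in> sets borel" using E by simp
    then have "closed_projection (E \<inter> cball 0 (real M))" by (rule borel_imp_closed_projection)
    then obtain K where K: "K \<subseteq> E \<inter> cball 0 (real M)" "compact K" "0 < dyadic_content s K"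
      by (rule compact_subset_positive_content[OF _ _ M]) (simp add: bounded_Int)
    obtain L where L: "frostman_mass s K L" "0 < (\<Sum>q\<in>cell 0 ` K. L 0 q)"
      by (rule frostman_mass_exists[OF compact_imp_bounded[OF K(2)] K(3)])
    define R where "R = max 1 (max (real M) (real N))"
    show ?thesis
    proof (rule exceptional_pins_content_zero[OF d _ K(2) _ L sk(1) \<tau>(1) sk(3-6) _ _ \<gamma>])
      show "1 \<le> R" by (simp add: R_def)
      show "norm y \<le> R" if "y \<in> K" for y using that K(1) by (auto simp: R_def)
      show "norm x \<le> R" if "x \<in> X N" for x using that by (auto simp: X_def R_def)
      show "\<exists>\<tau>\<^sub>0\<ge>0. \<tau>\<^sub>0 \<le> \<tau> N \<and> hausdorff_measure \<tau>\<^sub>0 (pinned_distance_set x K) = 0" if x: "x \<in> X N" for x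
      proof -
        obtain t where t: "0 \<le> t" "t \<le> \<tau> N" "hausdorff_measure t (pinned_distance_set x E) = 0"
          using x by (auto simp: X_def)
        have "pinned_distance_set x K \<subseteq> pinned_distance_set x E" using K(1) by (intro pinned_distance_set_mono) blast
        from hausdorff_measure_mono[OF this, of t] have "hausdorff_measure t (pinned_distance_set x K) = 0" using t(3) by simp
        then show ?thesis using t by blast
      qed
    qed
  qed
  have "dyadic_content \<gamma> ?X \<le> dyadic_content \<gamma> (\<Union>N. X N)" by (rule dyadic_content_mono[OF cover])
  also have "\<dots> \<le> (\<Sum>N. dyadic_content \<gamma> (X N))" by (rule dyadic_content_UN)
  also have "\<dots> = 0" by (simp add: zero)
  finally have "dyadic_content \<gamma> ?X = 0" by simp
  then show "hausdorff_measure \<gamma> ?X = 0" by (rule hausdorff_measure_zero_if_dyadic_content_zero[OF \<gamma>])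
qed

text \<open>
For \<open>\<beta> > 1\<close> the mass of a thin tube is negligible, so \<open>\<kappa>\<close> may be arbitrarily small.
\<close>

lemma exponents_high_dimension:
  fixes \<beta> e \<tau> :: real
  assumes "1 < \<beta>" "2 * \<tau> + e < \<beta>" "0 < \<tau>" "0 \<le> e"
  obtains s \<kappa> where "0 < s" "s < \<beta>" "0 < \<kappa>" "\<kappa> < 1" "2 * \<tau> + e + \<kappa> < s" "1 < s"
proof -
  obtain s where s: "max 1 (2 * \<tau> + e) < s" "s < \<beta>" using dense[of "max 1 (2 * \<tau> + e)" \<beta>] assms by auto
  obtain \<kappa> where "0 < \<kappa>" "\<kappa> < min 1 (s - (2 * \<tau> + e))" using dense[of 0 "min 1 (s - (2 * \<tau> + e))"] s by auto
  then show thesis using that[of s \<kappa>] s by auto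
qed

text \<open>
The conditions on \<open>\<kappa>\<close> say that it lies between \<open>\<tau>/s\<close> and \<open>s - 2\<tau>\<close>, which is possible if and only if \<open>\<tau> (2s + 1) < s^2\<close>. At \<open>s = \<beta>\<close> this holds because
\<open>(2\<beta> - 1)(2\<beta> + 1) = 4\<beta>^2 - 1 \<le> 3\<beta>^2\<close> for \<open>\<beta> \<le> 1\<close>, and it persists for \<open>s\<close> slightly smaller than \<open>\<beta>\<close>.
\<close>

lemma exponents_low_dimension:
  fixes \<beta> \<tau> :: real
  assumes \<beta>: "0 < \<beta>" "\<beta> \<le> 1" and \<tau>: "0 < \<tau>" "\<tau> < (2 * \<beta> - 1) / 3"
  obtains s \<kappa> where "0 < s" "s < \<beta>" "0 < \<kappa>" "\<kappa> < 1" "2 * \<tau> + \<kappa> < s" "\<tau> < \<kappa> * s"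
proof -
  have "\<tau> * (2 * \<beta> + 1) < (2 * \<beta> - 1) / 3 * (2 * \<beta> + 1)" using \<tau> \<beta> by (intro mult_strict_right_mono) auto
  moreover have "\<beta> * \<beta> \<le> 1 * 1" using \<beta> by (intro mult_mono) auto
  moreover have "(2 * \<beta> - 1) / 3 * (2 * \<beta> + 1) = (4 * (\<beta> * \<beta>) - 1) / 3" by (simp add: algebra_simps)
  moreover have "0 < b - p" if "p < q" "b \<le> 1 * 1" "q = (4 * b - 1) / 3" for b p q :: real using that by simp
  ultimately have pos: "0 < \<beta> * \<beta> - \<tau> * (2 * \<beta> + 1)" by blast
  have "((\<lambda>s. s * s - \<tau> * (2 * s + 1)) \<longlongrightarrow> \<beta> * \<beta> - \<tau> * (2 * \<beta> + 1)) (at_left \<beta>)"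
    by (intro tendsto_intros)
  then have "\<forall>\<^sub>F s in at_left \<beta>. 0 < s * s - \<tau> * (2 * s + 1)" using pos by (rule order_tendstoD)
  moreover have "\<forall>\<^sub>F s in at_left \<beta>. s \<in> {0<..<\<beta>}" using \<beta> by (intro eventually_at_left_real)
  ultimately have "\<forall>\<^sub>F s in at_left \<beta>. 0 < s * s - \<tau> * (2 * s + 1) \<and> s \<in> {0<..<\<beta>}" by (rule eventually_conj)
  then obtain s where s: "0 < s * s - \<tau> * (2 * s + 1)" "0 < s" "s < \<beta>"
    using eventually_happens[of _ "at_left \<beta>"] by (auto simp: trivial_limit_at_left_real)
  have "\<tau> < (s - 2 * \<tau>) * s" using s(1) by (simp add: algebra_simps)
  then have "\<tau> / s < s - 2 * \<tau>" by (simp only: pos_divide_less_eq[OF s(2)])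
  then obtain \<kappa> where \<kappa>: "\<tau> / s < \<kappa>" "\<kappa> < s - 2 * \<tau>" using dense by blast
  have "0 < \<tau> / s" using \<tau> s by simp
  then have "0 < \<kappa>" using \<kappa>(1) by linarith
  moreover have "\<tau> < \<kappa> * s" using \<kappa>(1) by (simp only: pos_divide_less_eq[OF s(2)])
  ultimately show thesis using that[of s \<kappa>] s \<kappa> \<tau> \<beta> by simp
qed

theorem theorem2p4:
  fixes E :: "(real ^ 'n) set" and \<beta> :: real
  assumes "E \<in> sets borel"
    and "hausdorff_dim E = ereal \<beta>"
  shows "(CARD('n) = 2 \<and> \<beta> > 1 / 2 \<longrightarrow>
            hausdorff_dim {x :: real ^ 'n.
              hausdorff_dim (pinned_distance_set x E) < ereal ((2 * \<beta> - 1) / 3)} = 0) \<and>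
         (CARD('n) > 2 \<and> \<beta> > real CARD('n) - 2 \<longrightarrow>
            hausdorff_dim {x :: real ^ 'n.
              hausdorff_dim (pinned_distance_set x E) < ereal ((\<beta> + 2 - real CARD('n)) / 2)} = 0)"
proof (intro conjI impI)
  have dim: "\<beta> \<le> real CARD('n)" using hausdorff_dim_le_dimension[of E] assms(2) by simp
  show "hausdorff_dim {x. hausdorff_dim (pinned_distance_set x E) < ereal ((2 * \<beta> - 1) / 3)} = 0"
    if h: "CARD('n) = 2 \<and> \<beta> > 1 / 2"
  proof (rule hausdorff_dim_exceptional_pins_zero[OF assms(1)])
    fix \<tau> :: real assume \<tau>: "0 < \<tau>" "\<tau> < (2 * \<beta> - 1) / 3"
    show "\<exists>s \<kappa>. 0 < s \<and> ereal s < hausdorff_dim E \<and> 0 < \<kappa> \<and> \<kappa> < 1 \<and>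
        2 * \<tau> + (real CARD('n) - 2) + \<kappa> < s \<and> (1 < s \<or> \<tau> < \<kappa> * s)"
    proof (cases "1 < \<beta>")
      case True
      have "2 * \<tau> + 0 < \<beta>" using \<tau>(2) dim h by simp
      from exponents_high_dimension[OF True this \<tau>(1)] obtain s \<kappa>
        where "0 < s" "s < \<beta>" "0 < \<kappa>" "\<kappa> < 1" "2 * \<tau> + 0 + \<kappa> < s" "1 < s" by auto
      then show ?thesis using h assms(2) by (intro exI[of _ s] exI[of _ \<kappa>]) simp
    next
      case False
      obtain s \<kappa> where "0 < s" "s < \<beta>" "0 < \<kappa>" "\<kappa> < 1" "2 * \<tau> + \<kappa> < s" "\<tau> < \<kappa> * s"
        by (rule exponents_low_dimension[of \<beta> \<tau>]) (use False h \<tau> in auto)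
      then show ?thesis using h assms(2) by (intro exI[of _ s] exI[of _ \<kappa>]) simp
    qed
  qed (use h in auto)
  show "hausdorff_dim {x. hausdorff_dim (pinned_distance_set x E) < ereal ((\<beta> + 2 - real CARD('n)) / 2)} = 0"
    if h: "CARD('n) > 2 \<and> \<beta> > real CARD('n) - 2"
  proof (rule hausdorff_dim_exceptional_pins_zero[OF assms(1)])
    fix \<tau> :: real assume \<tau>: "0 < \<tau>" "\<tau> < (\<beta> + 2 - real CARD('n)) / 2"
    have "3 \<le> CARD('n)" using h by linarith
    then have "3 \<le> real CARD('n)" by (metis of_nat_le_iff of_nat_numeral)
    then have "1 < \<beta>" "0 \<le> real CARD('n) - 2" using h by auto
    moreover have "2 * \<tau> + (real CARD('n) - 2) < \<beta>" using \<tau>(2) by (simp add: field_simps)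
    ultimately obtain s \<kappa> where "0 < s" "s < \<beta>" "0 < \<kappa>" "\<kappa> < 1" "2 * \<tau> + (real CARD('n) - 2) + \<kappa> < s" "1 < s"
      using exponents_high_dimension[of \<beta> \<tau> "real CARD('n) - 2"] \<tau>(1) by blast
    then show "\<exists>s \<kappa>. 0 < s \<and> ereal s < hausdorff_dim E \<and> 0 < \<kappa> \<and> \<kappa> < 1 \<and>
        2 * \<tau> + (real CARD('n) - 2) + \<kappa> < s \<and> (1 < s \<or> \<tau> < \<kappa> * s)"
      using assms(2) by (intro exI[of _ s] exI[of _ \<kappa>]) simp
  qed (use h in auto)
qed

end
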